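(* Let $\gamma=\gamma_\Xi$ be a Poisson-compatible left-covariant preconnection on a Poisson-Lie group $G$ with Lie algebra $\mathfrak g$, with corresponding map $\Xi:\mathfrak g^*\otimes\mathfrak g^*\to\mathfrak g^*$. Then $\gamma$ is flat if and only if $-\Xi$ is a right $\mathfrak g^*$-action (equivalently, a left $\mathfrak g^{*op}$-action) on $\mathfrak g^*$, namely $$\Xi([\phi,\psi]_{\mathfrak g^*},\zeta)=\Xi(\phi,\Xi(\psi,\zeta))-\Xi(\psi,\Xi(\phi,\zeta)),\quad\forall\,\phi,\psi,\zeta\in\mathfrak g^*.$$ In this case, if $G$ is moreover connected and simply connected, $\gamma$ is bicovariant if and only if $(\mathrm{ad}^*,-\Xi)$ (which for bicovariant $\gamma$ makes $\mathfrak g^*$ a left almost $\mathfrak g$-crossed module) makes $\mathfrak g^*$ a left $\mathfrak g$-crossed module.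
   Context: A Poisson-Lie group $G$ is a (finite-dimensional) Lie group with a Poisson bracket $\{\ ,\ \}$ on $C^\infty(G)$ such that multiplication $G\times G\to G$ is a Poisson map. Let $P$ be its Poisson bivector, $\{f,h\}=P(df,dh)$, and $D^\vee(g)=(L_{g^{-1}})_*P(g)\in\mathfrak g\otimes\mathfrak g$. The Lie algebra $\mathfrak g$ is a Lie bialgebra with cobracket $\delta(x)=\frac{d}{dt}\big|_{0}(R_{\exp(-tx)})_*P(\exp tx)=x_{(1)}\otimes x_{(2)}$ (summation understood). The dual $\mathfrak g^*$ is a Lie bialgebra with $\langle[\phi,\psi]_{\mathfrak g^*},x\rangle=\langle\phi\otimes\psi,\delta(x)\rangle$ and $\langle\delta_{\mathfrak g^*}\phi,x\otimes y\rangle=\langle\phi,[x,y]\rangle$, written $\delta_{\mathfrak g^*}\phi=\phi_{(1)}\otimes\phi_{(2)}$. The coadjoint action is $\mathrm{ad}^*_x\phi=\phi_{(1)}\langle\phi_{(2)},x\rangle$, i.e. $(\mathrm{ad}^*_x\phi)(y)=-\phi([x,y])$; $\mathrm{Ad}^*$ is the corresponding left coadjoint action of $G$. $\mathfrak g^{*op}$ is $\mathfrak g^*$ with Lie bracket $-[\ ,\ ]_{\mathfrak g^*}$. A preconnection on $G$ is a bilinear map $\gamma:C^\infty(G)\otimes\Omega^1(G)\to\Omega^1(G)$ with $\gamma(xy,\tau)=\gamma(x,\tau)y+x\gamma(y,\tau)$ and $\gamma(x,y\tau)=y\gamma(x,\tau)+\{x,y\}\tau$. It is Poisson-compatible if $d\{x,y\}=\gamma(x,dy)-\gamma(y,dx)$.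 It is flat if $\gamma(x,\gamma(y,\tau))-\gamma(y,\gamma(x,\tau))-\gamma(\{x,y\},\tau)=0$ for all $x,y\in C^\infty(G)$, $\tau\in\Omega^1(G)$. Let $\{e_i\}$ be a basis of $\mathfrak g$, $\{f^i\}$ the dual basis, $\{\partial_i\}$ the left-invariant vector fields generated by $\{e_i\}$ and $\{\omega^i\}$ the dual basis of left-invariant 1-forms. For a linear map $\Xi:\mathfrak g^*\otimes\mathfrak g^*\to\mathfrak g^*$ with $\Xi(f^i,f^j)=\sum_k\Xi^{ij}_kf^k$ put $$\gamma_\Xi\Big(a,\sum_k\tau_k\omega^k\Big)=\sum_k\Big(\{a,\tau_k\}+\sum_{i,j}\Xi^{ij}_k(\partial_ia)\tau_j\Big)\omega^k .$$ A preconnection is called left-covariant if the associated first-order differential calculus is left-covariant to lowest deformation order; this holds exactly when $\gamma=\gamma_\Xi$ for some (unique) $\Xi$, which is taken as the definition here. A left-covariant $\gamma_\Xi$ is called bicovariant if the calculus is also right-covariant to lowest order; this is equivalent to (and taken here to mean) $$\Xi(\phi,\psi)-\mathrm{Ad}^*_{g^{-1}}\Xi(\mathrm{Ad}^*_g\phi,\mathrm{Ad}^*_g\psi)=\phi(D^\vee(g)^{(1)})\,\mathrm{ad}^*_{D^\vee(g)^{(2)}}\psi,\quad\forall g\in G,\ \phi,\psi\in\mathfrak g^*,$$ where $D^\vee(g)=D^\vee(g)^{(1)}\otimes D^\vee(g)^{(2)}$. A left almost $\mathfrak g$-crossed module is a left $\mathfrak g$-module $(V,\triangleright)$ with a linear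 map $\triangleright':\mathfrak g^*\otimes V\to V$ such that $$\phi_{(1)}\triangleright'v\,\langle\phi_{(2)},x\rangle+x_{(1)}\triangleright v\,\langle\phi,x_{(2)}\rangle=x\triangleright(\phi\triangleright'v)-\phi\triangleright'(x\triangleright v)$$ for all $x\in\mathfrak g,\phi\in\mathfrak g^*,v\in V$. It is a left $\mathfrak g$-crossed module if in addition $\triangleright'$ is a left action of $\mathfrak g^{*op}$. "$(\mathrm{ad}^*,-\Xi)$" means $x\triangleright\psi=\mathrm{ad}^*_x\psi$ and $\phi\triangleright'\psi=-\Xi(\phi,\psi)$ on $V=\mathfrak g^*$. *)

theory Defs
  imports "HOL-Analysis.Analysis" "HOL-Library.Function_Algebras" "HOL-Algebra.Group"
begin

text \<open>Functions, vector fields and forms are added and multiplied pointwise (Function_Algebras).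
  Vector fields act on functions and 1-forms act on vector fields, so the module
  structure over functions is the same formula for both.\<close>

definition fscale :: "('g \<Rightarrow> real) \<Rightarrow> ('b \<Rightarrow> 'g \<Rightarrow> real) \<Rightarrow> 'b \<Rightarrow> 'g \<Rightarrow> real" (infixr "\<cdot>" 75)
  where "a \<cdot> T = (\<lambda>x. a * T x)"

definition const :: "real \<Rightarrow> 'g \<Rightarrow> real" where "const c = (\<lambda>_. c)"


section \<open>Smooth manifolds\<close>

text \<open>Intended for open \<open>S\<close> and a finite-dimensional domain, where it agrees with the usual
  definition by partial derivatives.\<close>

primrec Ck_on :: "nat \<Rightarrow> 'a::real_normed_vector set \<Rightarrow> ('a \<Rightarrow> 'b::real_normed_vector) \<Rightarrow> bool" where
  "Ck_on 0 S f \<longleftrightarrow> continuous_on S f"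
| "Ck_on (Suc k) S f \<longleftrightarrow> (\<forall>x\<in>S. f differentiable (at x)) \<and>
     (\<forall>v. Ck_on k S (\<lambda>x. frechet_derivative f (at x) v))"

definition smooth_on :: "'a::real_normed_vector set \<Rightarrow> ('a \<Rightarrow> 'b::real_normed_vector) \<Rightarrow> bool"
  where "smooth_on S f \<longleftrightarrow> (\<forall>k. Ck_on k S f)"

text \<open>A chart is a pair of a domain and a coordinate map (relevant only on that domain).\<close>

type_synonym ('m, 'a) atlas = "('m set \<times> ('m \<Rightarrow> 'a)) set"

definition smooth_atlas :: "('m::topological_space, 'a::real_normed_vector) atlas \<Rightarrow> bool" where
  "smooth_atlas A \<longleftrightarrow>
     (\<Union>(fst ` A) = UNIV) \<and>
     (\<forall>(U, \<phi>)\<in>A. open U \<and> open (\<phi> ` U) \<and> homeomorphism U (\<phi> ` U) \<phi> (inv_into U \<phi>)) \<and>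
     (\<forall>(U, \<phi>)\<in>A. \<forall>(V, \<psi>)\<in>A. smooth_on (\<phi> ` (U \<inter> V)) (\<psi> \<circ> inv_into U \<phi>))"

definition prod_atlas :: "('m, 'a) atlas \<Rightarrow> ('n, 'b) atlas \<Rightarrow> ('m \<times> 'n, 'a \<times> 'b) atlas" where
  "prod_atlas A B = {(U \<times> V, map_prod \<phi> \<psi>) | U \<phi> V \<psi>. (U, \<phi>) \<in> A \<and> (V, \<psi>) \<in> B}"

definition id_atlas :: "('a, 'a) atlas" where
  "id_atlas = {(UNIV, \<lambda>x. x)}"

definition smooth_map ::
  "('m::topological_space, 'a::real_normed_vector) atlas \<Rightarrow>
   ('n::topological_space, 'b::real_normed_vector) atlas \<Rightarrow> ('m \<Rightarrow> 'n) \<Rightarrow> bool" where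
  "smooth_map A B F \<longleftrightarrow> continuous_on UNIV F \<and>
     (\<forall>(U, \<phi>)\<in>A. \<forall>(V, \<psi>)\<in>B. smooth_on (\<phi> ` (U \<inter> F -` V)) (\<psi> \<circ> F \<circ> inv_into U \<phi>))"


section \<open>Lie groups\<close>

record ('g, 'a) lie_group = "'g monoid" +
  charts :: "('g, 'a) atlas"

text \<open>The underlying manifold is the whole type \<open>'g\<close>. The model space is a type of class
  \<open>{real_inner, heine_borel}\<close> with a finite spanning set, rather than of class
  \<open>euclidean_space\<close>, because the latter excludes dimension 0.\<close>

locale lie_group = group G
  for G :: "('g::{t2_space, second_countable_topology}, 'a::{real_inner, heine_borel}, 'z)
              lie_group_scheme" (structure) +
  assumes carrier_UNIV: "carrier G = UNIV"
    and atlas: "smooth_atlas (charts G)"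
    and model_finite_dim: "\<exists>B :: 'a set. finite B \<and> span B = UNIV"
    and smooth_mult: "smooth_map (prod_atlas (charts G) (charts G)) (charts G) (\<lambda>(g, h). g \<otimes> h)"
    and smooth_inv: "smooth_map (charts G) (charts G) (\<lambda>g. inv g)"

definition Cinf ::
  "('g::topological_space, 'a::real_normed_vector, 'z) lie_group_scheme \<Rightarrow> ('g \<Rightarrow> real) set" where
  "Cinf G = {f. smooth_map (charts G) id_atlas f}"

definition ltrans :: "('g, 'z) monoid_scheme \<Rightarrow> 'g \<Rightarrow> 'g \<Rightarrow> 'g" where
  "ltrans G g = (\<lambda>h. g \<otimes>\<^bsub>G\<^esub> h)"

definition rtrans :: "('g, 'z) monoid_scheme \<Rightarrow> 'g \<Rightarrow> 'g \<Rightarrow> 'g" where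
  "rtrans G g = (\<lambda>h. h \<otimes>\<^bsub>G\<^esub> g)"

definition conj_by :: "('g, 'z) monoid_scheme \<Rightarrow> 'g \<Rightarrow> 'g \<Rightarrow> 'g" where
  "conj_by G g = (\<lambda>h. g \<otimes>\<^bsub>G\<^esub> h \<otimes>\<^bsub>G\<^esub> inv\<^bsub>G\<^esub> g)"


section \<open>Vector fields and 1-forms\<close>

text \<open>Vector fields are identified with the operators they induce on smooth functions. To make
  this identification injective, operators are 0 off the smooth functions; likewise 1-forms,
  as linear maps on the module of vector fields, are 0 off the vector fields.\<close>

type_synonym 'g vfield = "('g \<Rightarrow> real) \<Rightarrow> 'g \<Rightarrow> real"
type_synonym 'g form = "'g vfield \<Rightarrow> 'g \<Rightarrow> real"

text \<open>In the chart \<open>(U, \<phi>)\<close> the operator is \<open>\<Sum>i. \<xi>\<^sub>i \<partial>/\<partial>x\<^sub>i\<close> with smooth coefficients.\<close>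

definition vfields ::
  "('g::topological_space, 'a::real_normed_vector, 'z) lie_group_scheme \<Rightarrow> 'g vfield set" where
  "vfields G = {X. (\<forall>f. f \<notin> Cinf G \<longrightarrow> X f = 0) \<and>
     (\<forall>(U, \<phi>)\<in>charts G. \<exists>\<xi>. smooth_on (\<phi> ` U) \<xi> \<and>
        (\<forall>f\<in>Cinf G. \<forall>p\<in>U.
           X f p = frechet_derivative (f \<circ> inv_into U \<phi>) (at (\<phi> p)) (\<xi> (\<phi> p))))}"

definition forms ::
  "('g::topological_space, 'a::real_normed_vector, 'z) lie_group_scheme \<Rightarrow> 'g form set" where
  "forms G = {\<tau>. (\<forall>X. X \<notin> vfields G \<longrightarrow> \<tau> X = 0) \<and>
     (\<forall>X\<in>vfields G. \<tau> X \<in> Cinf G) \<and>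
     (\<forall>X\<in>vfields G. \<forall>Y\<in>vfields G. \<tau> (X + Y) = \<tau> X + \<tau> Y) \<and>
     (\<forall>a\<in>Cinf G. \<forall>X\<in>vfields G. \<tau> (a \<cdot> X) = a * \<tau> X)}"

definition ext_d ::
  "('g::topological_space, 'a::real_normed_vector, 'z) lie_group_scheme \<Rightarrow> ('g \<Rightarrow> real) \<Rightarrow> 'g form" where
  "ext_d G f = (\<lambda>X. if X \<in> vfields G then X f else 0)"

definition vcommutator :: "'g vfield \<Rightarrow> 'g vfield \<Rightarrow> 'g vfield" where
  "vcommutator X Y = (\<lambda>f. X (Y f) - Y (X f))"

text \<open>Push-forward and pull-back are used for diffeomorphisms \<open>F\<close> of the group only;
  \<open>inv_into UNIV F\<close> is then the inverse of \<open>F\<close>.\<close>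

definition push_field ::
  "('g::topological_space, 'a::real_normed_vector, 'z) lie_group_scheme \<Rightarrow> ('g \<Rightarrow> 'g) \<Rightarrow> 'g vfield \<Rightarrow> 'g vfield" where
  "push_field G F X = (\<lambda>f. if f \<in> Cinf G then X (f \<circ> F) \<circ> inv_into UNIV F else 0)"

definition pull_form ::
  "('g::topological_space, 'a::real_normed_vector, 'z) lie_group_scheme \<Rightarrow> ('g \<Rightarrow> 'g) \<Rightarrow> 'g form \<Rightarrow> 'g form" where
  "pull_form G F \<tau> = (\<lambda>X. if X \<in> vfields G then \<tau> (push_field G F X) \<circ> F else 0)"

definition left_inv_fields ::
  "('g::topological_space, 'a::real_normed_vector, 'z) lie_group_scheme \<Rightarrow> 'g vfield set" where
  "left_inv_fields G = {X \<in> vfields G. \<forall>g. push_field G (ltrans G g) X = X}"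


section \<open>Poisson-Lie groups\<close>

text \<open>The Lie algebra is a vector space \<open>'v\<close> together with an isomorphism \<open>left_field\<close> onto the
  left-invariant vector fields. The bivector is a tensor field, that is, a bilinear map on
  1-forms over the smooth functions. The basis \<open>e\<^sub>i\<close> and its dual basis \<open>f\<^sup>i\<close> (\<open>i < lie_dim\<close>) are an
  arbitrary choice, used only to write out coordinate and Sweedler sums.\<close>

record (overloaded) ('g, 'a, 'v) poisson_lie_group = "('g, 'a) lie_group" +
  left_field :: "'v \<Rightarrow> 'g vfield"
  pbracket :: "('g \<Rightarrow> real) \<Rightarrow> ('g \<Rightarrow> real) \<Rightarrow> 'g \<Rightarrow> real"
  bivector :: "'g form \<Rightarrow> 'g form \<Rightarrow> 'g \<Rightarrow> real"
  lie_dim :: nat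
  basis :: "nat \<Rightarrow> 'v"
  dual_basis :: "nat \<Rightarrow> ('v::real_normed_vector \<Rightarrow>\<^sub>L real)"

definition poisson_bracket_on ::
  "('g \<Rightarrow> real) set \<Rightarrow> (('g \<Rightarrow> real) \<Rightarrow> ('g \<Rightarrow> real) \<Rightarrow> 'g \<Rightarrow> real) \<Rightarrow> bool" where
  "poisson_bracket_on C br \<longleftrightarrow>
     (\<forall>a\<in>C. \<forall>b\<in>C. br a b \<in> C \<and> br a b = - br b a) \<and>
     (\<forall>a\<in>C. \<forall>b\<in>C. \<forall>c\<in>C. br a (b + c) = br a b + br a c) \<and>
     (\<forall>r. \<forall>a\<in>C. \<forall>b\<in>C. br a (const r * b) = const r * br a b) \<and>
     (\<forall>a\<in>C. \<forall>b\<in>C. \<forall>c\<in>C. br a (b * c) = br a b * c + b * br a c) \<and>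
     (\<forall>a\<in>C. \<forall>b\<in>C. \<forall>c\<in>C. br a (br b c) + br b (br c a) + br c (br a b) = 0)"

definition bivector_on ::
  "('g::topological_space, 'a::real_normed_vector, 'z) lie_group_scheme \<Rightarrow>
   ('g form \<Rightarrow> 'g form \<Rightarrow> 'g \<Rightarrow> real) \<Rightarrow> bool" where
  "bivector_on G P \<longleftrightarrow>
     (\<forall>\<sigma>\<in>forms G. \<forall>\<tau>\<in>forms G. P \<sigma> \<tau> \<in> Cinf G \<and> P \<sigma> \<tau> = - P \<tau> \<sigma>) \<and>
     (\<forall>\<sigma>\<in>forms G. \<forall>\<tau>\<in>forms G. \<forall>\<rho>\<in>forms G. P \<sigma> (\<tau> + \<rho>) = P \<sigma> \<tau> + P \<sigma> \<rho>) \<and>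
     (\<forall>a\<in>Cinf G. \<forall>\<sigma>\<in>forms G. \<forall>\<tau>\<in>forms G. P \<sigma> (a \<cdot> \<tau>) = a * P \<sigma> \<tau>)"

text \<open>The bracket of the product Poisson manifold.\<close>

definition prod_pbracket ::
  "(('g \<Rightarrow> real) \<Rightarrow> ('g \<Rightarrow> real) \<Rightarrow> 'g \<Rightarrow> real) \<Rightarrow>
   ('g \<times> 'g \<Rightarrow> real) \<Rightarrow> ('g \<times> 'g \<Rightarrow> real) \<Rightarrow> 'g \<times> 'g \<Rightarrow> real" where
  "prod_pbracket br F H = (\<lambda>(g, h).
     br (\<lambda>x. F (x, h)) (\<lambda>x. H (x, h)) g + br (\<lambda>y. F (g, y)) (\<lambda>y. H (g, y)) h)"

locale poisson_lie_group = lie_group G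
  for G :: "('g::{t2_space, second_countable_topology}, 'a::{real_inner, heine_borel},
             'v::real_normed_vector) poisson_lie_group" (structure) +
  assumes left_field_add: "left_field G (x + y) = left_field G x + left_field G y"
    and left_field_scale: "left_field G (r *\<^sub>R x) = const r \<cdot> left_field G x"
    and left_field_bij: "bij_betw (left_field G) UNIV (left_inv_fields G)"
    and basis_inj: "inj_on (basis G) {..<lie_dim G}"
    and basis_independent: "independent (basis G ` {..<lie_dim G})"
    and basis_span: "span (basis G ` {..<lie_dim G}) = UNIV"
    and dual_basis: "\<lbrakk>i < lie_dim G; j < lie_dim G\<rbrakk> \<Longrightarrow>
          blinfun_apply (dual_basis G i) (basis G j) = (if i = j then 1 else 0)"
    and pbracket: "poisson_bracket_on (Cinf G) (pbracket G)"
    and bivector: "bivector_on G (bivector G)"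
    and pbracket_bivector: "\<lbrakk>f \<in> Cinf G; h \<in> Cinf G\<rbrakk> \<Longrightarrow>
          pbracket G f h = bivector G (ext_d G f) (ext_d G h)"
    and mult_poisson: "\<lbrakk>f \<in> Cinf G; h \<in> Cinf G\<rbrakk> \<Longrightarrow>
          prod_pbracket (pbracket G) (\<lambda>(x, y). f (x \<otimes> y)) (\<lambda>(x, y). h (x \<otimes> y)) =
          (\<lambda>(x, y). pbracket G f h (x \<otimes> y))"

definition push_bivector ::
  "('g::topological_space, 'a::real_normed_vector, 'v::real_normed_vector) poisson_lie_group \<Rightarrow>
   ('g \<Rightarrow> 'g) \<Rightarrow> 'g form \<Rightarrow> 'g form \<Rightarrow> 'g \<Rightarrow> real" where
  "push_bivector G F \<sigma> \<tau> = bivector G (pull_form G F \<sigma>) (pull_form G F \<tau>) \<circ> inv_into UNIV F"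

text \<open>The left Maurer-Cartan form: the Lie algebra element whose left-invariant field has the
  same value at \<open>p\<close> as \<open>X\<close>.\<close>

definition maurer_cartan ::
  "('g::topological_space, 'a::real_normed_vector, 'v::real_normed_vector) poisson_lie_group \<Rightarrow>
   'g vfield \<Rightarrow> 'g \<Rightarrow> 'v" where
  "maurer_cartan G X p = (THE x. \<forall>f\<in>Cinf G. X f p = left_field G x f p)"

definition left_form ::
  "('g::topological_space, 'a::real_normed_vector, 'v::real_normed_vector) poisson_lie_group \<Rightarrow>
   ('v \<Rightarrow>\<^sub>L real) \<Rightarrow> 'g form" where
  "left_form G \<phi> = (\<lambda>X. if X \<in> vfields G then (\<lambda>p. blinfun_apply \<phi> (maurer_cartan G X p)) else 0)"

definition one_parameter_subgroup ::
  "('g::topological_space, 'a::real_normed_vector, 'z) lie_group_scheme \<Rightarrow> (real \<Rightarrow> 'g) \<Rightarrow> bool" where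
  "one_parameter_subgroup G c \<longleftrightarrow>
     smooth_map id_atlas (charts G) c \<and> (\<forall>s t. c (s + t) = c s \<otimes>\<^bsub>G\<^esub> c t)"

text \<open>The exponential map: \<open>t \<mapsto> exp (t x)\<close> is the one-parameter subgroup with velocity \<open>x\<close> at the
  identity (a unique such map exists on every Lie group).\<close>

definition lie_exp ::
  "('g::topological_space, 'a::real_normed_vector, 'v::real_normed_vector) poisson_lie_group \<Rightarrow>
   'v \<Rightarrow> 'g" where
  "lie_exp G = (SOME E. \<forall>x. one_parameter_subgroup G (\<lambda>t. E (t *\<^sub>R x)) \<and>
     (\<forall>f\<in>Cinf G. ((\<lambda>t. f (E (t *\<^sub>R x))) has_field_derivative left_field G x f \<one>\<^bsub>G\<^esub>) (at 0)))"

definition lie_bracket ::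
  "('g::topological_space, 'a::real_normed_vector, 'v::real_normed_vector) poisson_lie_group \<Rightarrow>
   'v \<Rightarrow> 'v \<Rightarrow> 'v" where
  "lie_bracket G x y = (THE z. left_field G z = vcommutator (left_field G x) (left_field G y))"

text \<open>Elements of \<open>\<gg> \<otimes> \<gg>\<close> are represented as bilinear forms on the dual \<open>\<gg>\<^sup>*\<close>, and elements of
  \<open>\<gg>\<^sup>* \<otimes> \<gg>\<^sup>*\<close> as bilinear forms on \<open>\<gg>\<close>. An element \<open>t\<close> of \<open>\<gg> \<otimes> \<gg>\<close> is thus
  \<open>\<Sum>i j. t f\<^sup>i f\<^sup>j e\<^sub>i \<otimes> e\<^sub>j\<close>, which is how Sweedler notation is expanded below.\<close>

definition D_left ::
  "('g::topological_space, 'a::real_normed_vector, 'v::real_normed_vector) poisson_lie_group \<Rightarrow>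
   'g \<Rightarrow> ('v \<Rightarrow>\<^sub>L real) \<Rightarrow> ('v \<Rightarrow>\<^sub>L real) \<Rightarrow> real" where
  "D_left G g \<phi> \<psi> =
     push_bivector G (ltrans G (inv\<^bsub>G\<^esub> g)) (left_form G \<phi>) (left_form G \<psi>) \<one>\<^bsub>G\<^esub>"

definition cobracket ::
  "('g::topological_space, 'a::real_normed_vector, 'v::real_normed_vector) poisson_lie_group \<Rightarrow>
   'v \<Rightarrow> ('v \<Rightarrow>\<^sub>L real) \<Rightarrow> ('v \<Rightarrow>\<^sub>L real) \<Rightarrow> real" where
  "cobracket G x \<phi> \<psi> = deriv (\<lambda>t. push_bivector G (rtrans G (lie_exp G (- t *\<^sub>R x)))
     (left_form G \<phi>) (left_form G \<psi>) \<one>\<^bsub>G\<^esub>) 0"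

definition dual_bracket ::
  "('g::topological_space, 'a::real_normed_vector, 'v::real_normed_vector) poisson_lie_group \<Rightarrow>
   ('v \<Rightarrow>\<^sub>L real) \<Rightarrow> ('v \<Rightarrow>\<^sub>L real) \<Rightarrow> ('v \<Rightarrow>\<^sub>L real)" where
  "dual_bracket G \<phi> \<psi> = Blinfun (\<lambda>x. cobracket G x \<phi> \<psi>)"

definition dual_cobracket ::
  "('g::topological_space, 'a::real_normed_vector, 'v::real_normed_vector) poisson_lie_group \<Rightarrow>
   ('v \<Rightarrow>\<^sub>L real) \<Rightarrow> 'v \<Rightarrow> 'v \<Rightarrow> real" where
  "dual_cobracket G \<phi> x y = blinfun_apply \<phi> (lie_bracket G x y)"

definition ad_star ::
  "('g::topological_space, 'a::real_normed_vector, 'v::real_normed_vector) poisson_lie_group \<Rightarrow>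
   'v \<Rightarrow> ('v \<Rightarrow>\<^sub>L real) \<Rightarrow> ('v \<Rightarrow>\<^sub>L real)" where
  "ad_star G x \<phi> = Blinfun (\<lambda>y. - blinfun_apply \<phi> (lie_bracket G x y))"

definition Ad ::
  "('g::topological_space, 'a::real_normed_vector, 'v::real_normed_vector) poisson_lie_group \<Rightarrow>
   'g \<Rightarrow> 'v \<Rightarrow> 'v" where
  "Ad G g x = (THE y. left_field G y = push_field G (conj_by G g) (left_field G x))"

definition Ad_star ::
  "('g::topological_space, 'a::real_normed_vector, 'v::real_normed_vector) poisson_lie_group \<Rightarrow>
   'g \<Rightarrow> ('v \<Rightarrow>\<^sub>L real) \<Rightarrow> ('v \<Rightarrow>\<^sub>L real)" where
  "Ad_star G g \<phi> = Blinfun (\<lambda>x. blinfun_apply \<phi> (Ad G (inv\<^bsub>G\<^esub> g) x))"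


section \<open>Preconnections\<close>

type_synonym 'g connection_map = "('g \<Rightarrow> real) \<Rightarrow> 'g form \<Rightarrow> 'g form"

definition preconnection ::
  "('g::topological_space, 'a::real_normed_vector, 'v::real_normed_vector) poisson_lie_group \<Rightarrow>
   'g connection_map \<Rightarrow> bool" where
  "preconnection G \<gamma> \<longleftrightarrow>
     (\<forall>a\<in>Cinf G. \<forall>\<tau>\<in>forms G. \<gamma> a \<tau> \<in> forms G) \<and>
     (\<forall>a\<in>Cinf G. \<forall>b\<in>Cinf G. \<forall>\<tau>\<in>forms G. \<gamma> (a + b) \<tau> = \<gamma> a \<tau> + \<gamma> b \<tau>) \<and>
     (\<forall>r. \<forall>a\<in>Cinf G. \<forall>\<tau>\<in>forms G. \<gamma> (const r * a) \<tau> = const r \<cdot> \<gamma> a \<tau>) \<and>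
     (\<forall>a\<in>Cinf G. \<forall>\<sigma>\<in>forms G. \<forall>\<tau>\<in>forms G. \<gamma> a (\<sigma> + \<tau>) = \<gamma> a \<sigma> + \<gamma> a \<tau>) \<and>
     (\<forall>r. \<forall>a\<in>Cinf G. \<forall>\<tau>\<in>forms G. \<gamma> a (const r \<cdot> \<tau>) = const r \<cdot> \<gamma> a \<tau>) \<and>
     (\<forall>a\<in>Cinf G. \<forall>b\<in>Cinf G. \<forall>\<tau>\<in>forms G. \<gamma> (a * b) \<tau> = b \<cdot> \<gamma> a \<tau> + a \<cdot> \<gamma> b \<tau>) \<and>
     (\<forall>a\<in>Cinf G. \<forall>b\<in>Cinf G. \<forall>\<tau>\<in>forms G. \<gamma> a (b \<cdot> \<tau>) = b \<cdot> \<gamma> a \<tau> + pbracket G a b \<cdot> \<tau>)"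

definition poisson_compatible ::
  "('g::topological_space, 'a::real_normed_vector, 'v::real_normed_vector) poisson_lie_group \<Rightarrow>
   'g connection_map \<Rightarrow> bool" where
  "poisson_compatible G \<gamma> \<longleftrightarrow>
     (\<forall>a\<in>Cinf G. \<forall>b\<in>Cinf G. ext_d G (pbracket G a b) = \<gamma> a (ext_d G b) - \<gamma> b (ext_d G a))"

definition flat ::
  "('g::topological_space, 'a::real_normed_vector, 'v::real_normed_vector) poisson_lie_group \<Rightarrow>
   'g connection_map \<Rightarrow> bool" where
  "flat G \<gamma> \<longleftrightarrow>
     (\<forall>a\<in>Cinf G. \<forall>b\<in>Cinf G. \<forall>\<tau>\<in>forms G. \<gamma> a (\<gamma> b \<tau>) - \<gamma> b (\<gamma> a \<tau>) - \<gamma> (pbracket G a b) \<tau> = 0)"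

text \<open>Below \<open>\<partial>\<^sub>i\<close> is \<open>left_field G (basis G i)\<close> and \<open>\<omega>\<^sup>i\<close> is \<open>left_form G (dual_basis G i)\<close>; the
  coefficient \<open>\<tau>\<^sub>k\<close> of a 1-form is its value on \<open>\<partial>\<^sub>k\<close>, and \<open>\<Xi>\<^sup>i\<^sup>j\<^sub>k\<close> is \<open>\<Xi> f\<^sup>i f\<^sup>j\<close> applied to \<open>e\<^sub>k\<close>.\<close>

definition gamma_of ::
  "('g::topological_space, 'a::real_normed_vector, 'v::real_normed_vector) poisson_lie_group \<Rightarrow>
   (('v \<Rightarrow>\<^sub>L real) \<Rightarrow> ('v \<Rightarrow>\<^sub>L real) \<Rightarrow> ('v \<Rightarrow>\<^sub>L real)) \<Rightarrow> 'g connection_map" where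
  "gamma_of G \<Xi> a \<tau> = (\<Sum>k<lie_dim G.
     (pbracket G a (\<tau> (left_field G (basis G k))) +
      (\<Sum>i<lie_dim G. \<Sum>j<lie_dim G.
         const (blinfun_apply (\<Xi> (dual_basis G i) (dual_basis G j)) (basis G k)) *
         left_field G (basis G i) a * \<tau> (left_field G (basis G j))))
     \<cdot> left_form G (dual_basis G k))"

definition left_covariant_via ::
  "('g::topological_space, 'a::real_normed_vector, 'v::real_normed_vector) poisson_lie_group \<Rightarrow>
   (('v \<Rightarrow>\<^sub>L real) \<Rightarrow> ('v \<Rightarrow>\<^sub>L real) \<Rightarrow> ('v \<Rightarrow>\<^sub>L real)) \<Rightarrow> 'g connection_map \<Rightarrow> bool" where
  "left_covariant_via G \<Xi> \<gamma> \<longleftrightarrow> bilinear \<Xi> \<and>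
     (\<forall>a\<in>Cinf G. \<forall>\<tau>\<in>forms G. \<gamma> a \<tau> = gamma_of G \<Xi> a \<tau>)"

definition bicovariant ::
  "('g::topological_space, 'a::real_normed_vector, 'v::real_normed_vector) poisson_lie_group \<Rightarrow>
   'g connection_map \<Rightarrow> bool" where
  "bicovariant G \<gamma> \<longleftrightarrow> (\<exists>\<Xi>. left_covariant_via G \<Xi> \<gamma> \<and>
     (\<forall>g \<phi> \<psi>. \<Xi> \<phi> \<psi> - Ad_star G (inv\<^bsub>G\<^esub> g) (\<Xi> (Ad_star G g \<phi>) (Ad_star G g \<psi>)) =
        (\<Sum>i<lie_dim G. \<Sum>j<lie_dim G.
           (D_left G g (dual_basis G i) (dual_basis G j) * blinfun_apply \<phi> (basis G i)) *\<^sub>R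
           ad_star G (basis G j) \<psi>)))"


section \<open>Actions and crossed modules\<close>

definition left_lie_action ::
  "('l::real_vector \<Rightarrow> 'l \<Rightarrow> 'l) \<Rightarrow> ('l \<Rightarrow> 'w::real_vector \<Rightarrow> 'w) \<Rightarrow> bool" where
  "left_lie_action br act \<longleftrightarrow> bilinear act \<and>
     (\<forall>x y v. act (br x y) v = act x (act y v) - act y (act x v))"

definition right_lie_action ::
  "('l::real_vector \<Rightarrow> 'l \<Rightarrow> 'l) \<Rightarrow> ('w::real_vector \<Rightarrow> 'l \<Rightarrow> 'w) \<Rightarrow> bool" where
  "right_lie_action br act \<longleftrightarrow> bilinear act \<and>
     (\<forall>x y v. act v (br x y) = act (act v x) y - act (act v y) x)"

definition left_almost_crossed_module ::
  "('g::topological_space, 'a::real_normed_vector, 'v::real_normed_vector) poisson_lie_group \<Rightarrow>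
   ('v \<Rightarrow> 'w::real_vector \<Rightarrow> 'w) \<Rightarrow> (('v \<Rightarrow>\<^sub>L real) \<Rightarrow> 'w \<Rightarrow> 'w) \<Rightarrow> bool" where
  "left_almost_crossed_module G act act' \<longleftrightarrow>
     left_lie_action (lie_bracket G) act \<and> bilinear act' \<and>
     (\<forall>x \<phi> v.
        (\<Sum>i<lie_dim G. \<Sum>j<lie_dim G.
           (dual_cobracket G \<phi> (basis G i) (basis G j) * blinfun_apply (dual_basis G j) x) *\<^sub>R
           act' (dual_basis G i) v) +
        (\<Sum>i<lie_dim G. \<Sum>j<lie_dim G.
           (cobracket G x (dual_basis G i) (dual_basis G j) * blinfun_apply \<phi> (basis G j)) *\<^sub>R
           act (basis G i) v) =
        act x (act' \<phi> v) - act' \<phi> (act x v))"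

definition left_crossed_module ::
  "('g::topological_space, 'a::real_normed_vector, 'v::real_normed_vector) poisson_lie_group \<Rightarrow>
   ('v \<Rightarrow> 'w::real_vector \<Rightarrow> 'w) \<Rightarrow> (('v \<Rightarrow>\<^sub>L real) \<Rightarrow> 'w \<Rightarrow> 'w) \<Rightarrow> bool" where
  "left_crossed_module G act act' \<longleftrightarrow> left_almost_crossed_module G act act' \<and>
     left_lie_action (\<lambda>\<phi> \<psi>. - dual_bracket G \<phi> \<psi>) act'"

end

theory Submission
  imports Defs
begin

text \<open>In the left-invariant frame the Poisson tensor is a map \<open>\<pi>\<close> from \<open>G\<close> to \<open>\<gg> \<otimes> \<gg>\<close>. That multiplication is a
  Poisson map means \<open>\<pi>(gh) = \<pi>(h) + (Ad h\<inverse> \<otimes> Ad h\<inverse>) \<pi>(g)\<close>, so \<open>\<pi>\<close> vanishes at the identity, where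
  its derivative is the cobracket. Differentiating \<open>{a,b}(gh)\<close> in \<open>h\<close> shows that a left-invariant field
  is a derivation of the bracket up to the cobracket; hence the curvature of \<open>\<gamma>\<close>, which is tensorial by
  the Jacobi identity, has on left-invariant forms the constant coefficients
  \<open>\<Xi>(\<phi>, \<Xi>(\<psi>, \<zeta>)) - \<Xi>(\<psi>, \<Xi>(\<phi>, \<zeta>)) - \<Xi>([\<phi>, \<psi>], \<zeta>)\<close>.

  The two sides of the bicovariance condition differ by a 1-cocycle on \<open>G\<close>, whose derivative at the
  identity is the defect in the almost crossed module condition. On a connected group such a cocycle
  vanishes as soon as its derivative at the identity does.

  The exponential map enters only through the definition of the cobracket. One-parameter subgroups are
  integral curves, obtained in a chart by Picard iteration; uniqueness of solutions makes them local
  homomorphisms, which extend to the line by \<open>c(t) = c(t/n)\<^sup>n\<close>.\<close>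

section \<open>Smooth functions on open sets\<close>

text \<open>Derivatives in the two factors of G \<times> G commute (\<open>op_commute\<close>). This
  one fact gives both the Lie bracket as the derivative of \<open>Ad\<close> and the derivation
  property of left-invariant fields up to the cobracket.

  The curvature coefficients are constant because, on a left-invariant form, the brackets {a, e_j b}
  produced by \<open>\<gamma> a (\<gamma> b \<omega>)\<close>, antisymmetrised in a and b, are
  exactly those that the derivation part of e_j {a,b} produces in
  \<open>\<gamma> {a,b} \<omega>\<close>. Differentials of smooth functions at a point fill the
  dual, so the curvature at the identity already tests all \<phi> and \<psi>.

  The cocycle has two sources: \<Xi> minus its transform by g, which telescopes, and a contraction
  of \<pi> that is compatible with \<open>Ad\<close>, where multiplicativity is the cocycle rule.

  Two obstacles shape the preliminaries. The model space has an inner product but no distinguished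
  basis, since dimension 0 must be allowed; finite frames are therefore constructed. The exponential
  map is a chosen object, so nothing can be said about the cobracket before such a map is shown to
  exist.\<close>

lemma frechet_derivative_eqI:
  "(f has_derivative f') (at x) \<Longrightarrow> frechet_derivative f (at x) = f'"
  using frechet_derivative_at by metis

lemma frechet_derivative_cong_open:
  assumes "open S" "x \<in> S" "\<And>y. y \<in> S \<Longrightarrow> f y = g y"
  shows "frechet_derivative f (at x) = frechet_derivative g (at x)"
proof -
  have "(f has_derivative D) (at x) \<longleftrightarrow> (g has_derivative D) (at x)" for D
    using has_derivative_transform_within_open[of f D x UNIV S g]
      has_derivative_transform_within_open[of g D x UNIV S f] assms by auto
  then show ?thesis by (simp add: frechet_derivative_def)
qed

text \<open>On an open set the full derivatives at points of \<open>S\<close> see only values in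
  \<open>S\<close>. Chart expressions may therefore be changed freely outside the chart, where
  \<open>inv_into\<close> is arbitrary.\<close>

lemma Ck_on_cong:
  assumes "open S" "\<And>x. x \<in> S \<Longrightarrow> f x = g x"
  shows "Ck_on k S f \<longleftrightarrow> Ck_on k S g"
proof -
  have imp: "Ck_on k S g" if "Ck_on k S f" "\<And>x. x \<in> S \<Longrightarrow> f x = g x" for f g :: "'a \<Rightarrow> 'b"
    using that
  proof (induction k arbitrary: f g)
    case 0
    then show ?case by (simp cong: continuous_on_cong)
  next
    case (Suc k)
    have 1: "(g has_derivative frechet_derivative f (at x)) (at x)" if "x \<in> S" for x
      using that Suc.prems assms(1) frechet_derivative_works has_derivative_transform_within_open
      by (metis Ck_on.simps(2))
    have 2: "frechet_derivative g (at x) = frechet_derivative f (at x)" if "x \<in> S" for x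
      using 1[OF that] by (rule frechet_derivative_eqI)
    show ?case
      using 1 2 Suc.IH[of "\<lambda>x. frechet_derivative f (at x) v" "\<lambda>x. frechet_derivative g (at x) v" for v]
        Suc.prems(1) by (auto simp: differentiable_def)
  qed
  show ?thesis using imp[of f g] imp[of g f] assms(2) by auto
qed

lemma Ck_on_SucI:
  assumes "open S" "\<And>x. x \<in> S \<Longrightarrow> (f has_derivative f' x) (at x)" "\<And>v. Ck_on k S (\<lambda>x. f' x v)"
  shows "Ck_on (Suc k) S f"
proof -
  have "Ck_on k S (\<lambda>x. frechet_derivative f (at x) v) \<longleftrightarrow> Ck_on k S (\<lambda>x. f' x v)" for v
    using frechet_derivative_eqI[OF assms(2)] by (intro Ck_on_cong[OF assms(1)]) simp
  then show ?thesis using assms by (auto simp: differentiable_def)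
qed

lemma Ck_on_SucD: "Ck_on (Suc k) S f \<Longrightarrow> Ck_on k S f"
proof (induction k arbitrary: f)
  case 0
  then show ?case
    using differentiable_imp_continuous_within[of f _ UNIV] continuous_at_imp_continuous_on
    by (metis Ck_on.simps)
next
  case (Suc k)
  then show ?case by (metis Ck_on.simps(2))
qed

lemma Ck_on_SucE:
  assumes "Ck_on (Suc k) S f"
  shows "\<And>x. x \<in> S \<Longrightarrow> (f has_derivative frechet_derivative f (at x)) (at x)"
    and "\<And>v. Ck_on k S (\<lambda>x. frechet_derivative f (at x) v)" and "Ck_on k S f"
  using assms Ck_on_SucD[OF assms] by (auto simp: frechet_derivative_works)

lemma Ck_on_subset: "Ck_on k S f \<Longrightarrow> T \<subseteq> S \<Longrightarrow> Ck_on k T f"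
  by (induction k arbitrary: f) (auto intro: continuous_on_subset)

lemma Ck_on_local:
  assumes "\<And>x. x \<in> S \<Longrightarrow> \<exists>T. open T \<and> x \<in> T \<and> Ck_on k T f"
  shows "Ck_on k S f"
  using assms
proof (induction k arbitrary: f)
  case 0
  have "continuous (at x) f" if "x \<in> S" for x
    using 0[OF that] continuous_on_eq_continuous_at by auto
  then show ?case by (simp add: continuous_at_imp_continuous_on)
next
  case (Suc k)
  show ?case
  proof (simp, intro conjI ballI allI)
    show "f differentiable at x" if "x \<in> S" for x using Suc.prems[OF that] by auto
    show "Ck_on k S (\<lambda>x. frechet_derivative f (at x) v)" for v
      using Suc.prems by (intro Suc.IH) fastforce
  qed
qed

section \<open>Closure properties of functions of class C^k\<close>

lemma Ck_on_const: "open S \<Longrightarrow> Ck_on k S (\<lambda>x. c)"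
proof (induction k arbitrary: c)
  case (Suc k)
  then show ?case by (intro Ck_on_SucI[where f' = "\<lambda>_ _. 0"]) auto
qed simp

lemma Ck_on_bounded_linear:
  assumes L: "bounded_linear L" and "open S" and "Ck_on k S f"
  shows "Ck_on k S (\<lambda>x. L (f x))"
  using assms(3)
proof (induction k arbitrary: f)
  case 0
  then show ?case using L by (simp add: bounded_linear.continuous_on)
next
  case (Suc k)
  note f = Ck_on_SucE[OF Suc.prems]
  show ?case
    by (rule Ck_on_SucI[OF \<open>open S\<close> bounded_linear.has_derivative[OF L f(1)] Suc.IH[OF f(2)]])
qed

lemma Ck_on_ident:
  assumes "open S"
  shows "Ck_on k S (\<lambda>x. x)"
proof (cases k)
  case (Suc k)
  then show ?thesis using Ck_on_SucI[OF assms has_derivative_ident Ck_on_const[OF assms]] by simp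
qed simp

lemma Ck_on_add:
  assumes "open S" and "Ck_on k S f" "Ck_on k S g"
  shows "Ck_on k S (\<lambda>x. f x + g x)"
  using assms(2,3)
proof (induction k arbitrary: f g)
  case 0
  then show ?case by (simp add: continuous_on_add)
next
  case (Suc k)
  note f = Ck_on_SucE[OF Suc.prems(1)] and g = Ck_on_SucE[OF Suc.prems(2)]
  show ?case
    by (rule Ck_on_SucI[OF \<open>open S\<close> has_derivative_add[OF f(1) g(1)] Suc.IH[OF f(2) g(2)]])
qed

lemma Ck_on_sum:
  "open S \<Longrightarrow> (\<And>i. i \<in> I \<Longrightarrow> Ck_on k S (f i)) \<Longrightarrow> Ck_on k S (\<lambda>x. \<Sum>i\<in>I. f i x)"
  by (induction I rule: infinite_finite_induct) (auto intro!: Ck_on_add Ck_on_const)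

text \<open>Each Leibniz term pairs one differentiated factor with one undifferentiated factor, so
  the induction also uses that C^(k+1) functions are C^k.\<close>

lemma Ck_on_bilinear:
  assumes P: "bounded_bilinear P" and "open S" and "Ck_on k S f" "Ck_on k S g"
  shows "Ck_on k S (\<lambda>x. P (f x) (g x))"
  using assms(3,4)
proof (induction k arbitrary: f g)
  case 0
  then show ?case using bounded_bilinear.continuous_on[OF P] by auto
next
  case (Suc k)
  note f = Ck_on_SucE[OF Suc.prems(1)] and g = Ck_on_SucE[OF Suc.prems(2)]
  show ?case
    by (rule Ck_on_SucI[OF \<open>open S\<close> bounded_bilinear.FDERIV[OF P f(1) g(1)]
          Ck_on_add[OF \<open>open S\<close> Suc.IH[OF f(3) g(2)] Suc.IH[OF f(2) g(3)]]])
qed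

lemma Ck_on_Pair:
  assumes "open S" and "Ck_on k S f" "Ck_on k S g"
  shows "Ck_on k S (\<lambda>x. (f x, g x))"
  using assms(2,3)
proof (induction k arbitrary: f g)
  case 0
  then show ?case by (simp add: continuous_on_Pair)
next
  case (Suc k)
  note f = Ck_on_SucE[OF Suc.prems(1)] and g = Ck_on_SucE[OF Suc.prems(2)]
  show ?case
    by (rule Ck_on_SucI[OF \<open>open S\<close> has_derivative_Pair[OF f(1) g(1)] Suc.IH[OF f(2) g(2)]])
qed

text \<open>Only the reproducing identity of an orthonormal basis is kept, that is, a finite
  Parseval frame. It makes sense in dimension 0, where the empty set qualifies, and passes easily to
  products.\<close>

definition frame_basis :: "'a::real_inner set \<Rightarrow> bool" where
  "frame_basis B \<longleftrightarrow> finite B \<and> (\<forall>x. x = (\<Sum>b\<in>B. (x \<bullet> b) *\<^sub>R b))"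

lemma frame_basis_real: "frame_basis {1::real}"
  by (simp add: frame_basis_def)

text \<open>The two embedded frames can meet only in 0, which contributes nothing to the expansion;
  deleting it makes the union disjoint.\<close>

lemma frame_basis_prod:
  fixes A :: "'a::real_inner set" and B :: "'b::real_inner set"
  assumes A: "frame_basis A" and B: "frame_basis B"
  shows "frame_basis ((\<lambda>a. (a, 0)) ` A \<union> (\<lambda>b. (0, b)) ` B - {0})"
proof -
  let ?f = "\<lambda>x c :: 'a \<times> 'b. (x \<bullet> c) *\<^sub>R c" and ?A = "(\<lambda>a. (a, 0::'b)) ` A" and ?B = "(\<lambda>b. (0::'a, b)) ` B"
  have fin: "finite A" "finite B" using A B by (auto simp: frame_basis_def)
  have "sum (?f x) (?A \<union> ?B - {0}) = x" for x
  proof -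
    have "sum (?f x) (?A \<union> ?B - {0}) = sum (?f x) ((?A - {0}) \<union> (?B - {0}))"
      by (simp add: Un_Diff)
    also have "\<dots> = sum (?f x) (?A - {0}) + sum (?f x) (?B - {0})"
      using fin by (intro sum.union_disjoint) (auto simp: zero_prod_def)
    also have "sum (?f x) (?A - {0}) = sum (?f x) ?A"
      using fin by (intro sum.mono_neutral_left) auto
    also have "sum (?f x) (?B - {0}) = sum (?f x) ?B"
      using fin by (intro sum.mono_neutral_left) auto
    also have "sum (?f x) ?A = (\<Sum>a\<in>A. ((fst x \<bullet> a) *\<^sub>R a, 0))"
      by (subst sum.reindex) (auto simp: inj_on_def inner_prod_def)
    also have "\<dots> = (\<Sum>a\<in>A. (fst x \<bullet> a) *\<^sub>R a, 0)"
      using fin(1) by (induction rule: finite_induct) (auto simp: zero_prod_def)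
    also have "sum (?f x) ?B = (\<Sum>b\<in>B. (0, (snd x \<bullet> b) *\<^sub>R b))"
      by (subst sum.reindex) (auto simp: inj_on_def inner_prod_def)
    also have "\<dots> = (0, \<Sum>b\<in>B. (snd x \<bullet> b) *\<^sub>R b)"
      using fin(2) by (induction rule: finite_induct) (auto simp: zero_prod_def)
    finally show ?thesis using A B unfolding frame_basis_def by (metis prod.collapse add.right_neutral add.left_neutral add_Pair)
  qed
  then show ?thesis using fin by (simp add: frame_basis_def)
qed

lemma frame_basis_exists:
  assumes "finite (B :: 'a::real_inner set)" "span B = UNIV"
  shows "\<exists>C :: 'a set. frame_basis C"
proof -
  obtain C :: "'a set" where C: "finite C" "span C = UNIV" "pairwise orthogonal C"
    using basis_orthogonal[OF assms(1)] assms(2) by auto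
  \<comment> \<open>\<open>basis_orthogonal\<close> yields pairwise orthogonal vectors of any
    length, possibly including 0; discarding 0 and normalising makes them orthonormal.\<close>
  define N where "N = (\<lambda>c. c /\<^sub>R norm c) ` (C - {0})"
  have fin: "finite N" using C by (simp add: N_def)
  have orth: "b \<bullet> c = (if b = c then 1 else 0)" if bc: "b \<in> N" "c \<in> N" for b c
  proof -
    obtain b' c' where *: "b' \<in> C - {0}" "c' \<in> C - {0}" "b = b' /\<^sub>R norm b'" "c = c' /\<^sub>R norm c'"
      using bc unfolding N_def by auto
    show ?thesis
    proof (cases "b' = c'")
      case True
      then show ?thesis using * by (simp add: dot_square_norm power2_eq_square)
    next
      case False
      then have "b' \<bullet> c' = 0" using C(3) * unfolding pairwise_def orthogonal_def by auto
      then have 1: "b \<bullet> c = 0" using * by simp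
      have "b \<noteq> c"
      proof
        assume "b = c"
        then have "b \<bullet> b = 0" using 1 by simp
        then show False using * by simp
      qed
      then show ?thesis using 1 by simp
    qed
  qed
  have "C \<subseteq> span N"
  proof
    fix c assume "c \<in> C"
    show "c \<in> span N"
    proof (cases "c = 0")
      case False
      then have "c /\<^sub>R norm c \<in> N" using \<open>c \<in> C\<close> by (auto simp: N_def)
      then have "norm c *\<^sub>R (c /\<^sub>R norm c) \<in> span N" by (intro span_scale span_base)
      then show ?thesis using False by simp
    qed (simp add: span_zero)
  qed
  then have sp: "span N = UNIV" using C(2) by (metis span_mono span_span top.extremum_uniqueI)
  have "x = (\<Sum>b\<in>N. (x \<bullet> b) *\<^sub>R b)" for x
  proof -
    obtain u where u: "x = (\<Sum>b\<in>N. u b *\<^sub>R b)"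
      using sp span_finite[OF fin] by auto
    have "x \<bullet> c = u c" if "c \<in> N" for c
    proof -
      have "x \<bullet> c = (\<Sum>b\<in>N. u b * (b \<bullet> c))" unfolding u by (simp add: inner_sum_left)
      also have "\<dots> = (\<Sum>b\<in>N. if b = c then u b else 0)"
        using orth that by (intro sum.cong) auto
      finally show ?thesis using fin that by simp
    qed
    then show ?thesis using u by simp
  qed
  then show ?thesis using fin by (auto simp: frame_basis_def)
qed

lemma linear_frame_basis:
  assumes "frame_basis B" "linear f"
  shows "f x = (\<Sum>b\<in>B. (x \<bullet> b) *\<^sub>R f b)"
proof -
  have "f x = f (\<Sum>b\<in>B. (x \<bullet> b) *\<^sub>R b)" using assms(1) unfolding frame_basis_def by metis
  then show ?thesis using assms(2) by (simp add: linear_sum linear_scale)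
qed

text \<open>In the chain rule the inner derivative is a moving direction for the outer one.
  Expanding it in a frame of the middle space leaves derivatives of \<open>g\<close> in fixed
  directions composed with \<open>f\<close>, to which the induction hypothesis applies.\<close>

lemma Ck_on_compose:
  fixes f :: "'a::real_normed_vector \<Rightarrow> 'b::real_inner" and g :: "'b \<Rightarrow> 'c::real_normed_vector"
  assumes B: "frame_basis (B :: 'b set)" and S: "open S" and "Ck_on k S f" "Ck_on k T g" "f ` S \<subseteq> T"
  shows "Ck_on k S (\<lambda>x. g (f x))"
  using assms(3-)
proof (induction k arbitrary: f g)
  case 0
  then show ?case using continuous_on_compose2 by (metis Ck_on.simps(1))
next
  case (Suc k)
  note f = Ck_on_SucE[OF Suc.prems(1)] and g = Ck_on_SucE[OF Suc.prems(2)]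
  let ?f' = "\<lambda>x. frechet_derivative f (at x)" and ?g' = "\<lambda>x. frechet_derivative g (at x)"
  have der: "((\<lambda>x. g (f x)) has_derivative (\<lambda>v. \<Sum>b\<in>B. (?f' x v \<bullet> b) *\<^sub>R ?g' (f x) b)) (at x)"
    if "x \<in> S" for x
  proof -
    have "f x \<in> T" using that Suc.prems by auto
    then have *: "((\<lambda>x. g (f x)) has_derivative (\<lambda>v. ?g' (f x) (?f' x v))) (at x)"
      using has_derivative_compose[OF f(1)[OF that] g(1)] by blast
    have "(\<lambda>v. ?g' (f x) (?f' x v)) = (\<lambda>v. \<Sum>b\<in>B. (?f' x v \<bullet> b) *\<^sub>R ?g' (f x) b)"
      by (intro ext linear_frame_basis[OF B has_derivative_linear[OF g(1)[OF \<open>f x \<in> T\<close>]]])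
    with * show ?thesis by (rule has_derivative_eq_rhs)
  qed
  have "Ck_on k S (\<lambda>x. (?f' x v \<bullet> b) *\<^sub>R ?g' (f x) b)" for v b
    by (rule Ck_on_bilinear[OF bounded_bilinear_scaleR S
          Ck_on_bounded_linear[OF bounded_linear_inner_left S f(2)] Suc.IH[OF f(3) g(2) Suc.prems(3)]])
  then show ?case
    by (intro Ck_on_SucI[OF S der] Ck_on_sum S)
qed

lemma smooth_on_derivative:
  "smooth_on S f \<Longrightarrow> smooth_on S (\<lambda>x. frechet_derivative f (at x) v)"
  unfolding smooth_on_def using Ck_on_SucE(2) by blast

lemma smooth_on_has_derivative:
  "smooth_on S f \<Longrightarrow> x \<in> S \<Longrightarrow> (f has_derivative frechet_derivative f (at x)) (at x)"
  unfolding smooth_on_def using Ck_on_SucE(1) by blast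

lemma smooth_on_continuous: "smooth_on S f \<Longrightarrow> continuous_on S f"
  unfolding smooth_on_def using Ck_on.simps(1) by blast

lemma smooth_on_cong:
  "open S \<Longrightarrow> (\<And>x. x \<in> S \<Longrightarrow> f x = g x) \<Longrightarrow> smooth_on S f \<longleftrightarrow> smooth_on S g"
  unfolding smooth_on_def using Ck_on_cong by blast

lemma smooth_on_subset: "smooth_on S f \<Longrightarrow> T \<subseteq> S \<Longrightarrow> smooth_on T f"
  unfolding smooth_on_def using Ck_on_subset by blast

lemma smooth_on_local:
  "(\<And>x. x \<in> S \<Longrightarrow> \<exists>T. open T \<and> x \<in> T \<and> smooth_on T f) \<Longrightarrow> smooth_on S f"
  unfolding smooth_on_def by (intro allI Ck_on_local) blast

lemma smooth_on_const: "open S \<Longrightarrow> smooth_on S (\<lambda>x. c)"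
  unfolding smooth_on_def using Ck_on_const by blast

lemma smooth_on_ident: "open S \<Longrightarrow> smooth_on S (\<lambda>x. x)"
  unfolding smooth_on_def using Ck_on_ident by blast

lemma smooth_on_bounded_linear:
  "bounded_linear L \<Longrightarrow> open S \<Longrightarrow> smooth_on S f \<Longrightarrow> smooth_on S (\<lambda>x. L (f x))"
  unfolding smooth_on_def using Ck_on_bounded_linear by blast

lemma smooth_on_add:
  "open S \<Longrightarrow> smooth_on S f \<Longrightarrow> smooth_on S g \<Longrightarrow> smooth_on S (\<lambda>x. f x + g x)"
  unfolding smooth_on_def using Ck_on_add by blast

lemma smooth_on_sum:
  "open S \<Longrightarrow> (\<And>i. i \<in> I \<Longrightarrow> smooth_on S (f i)) \<Longrightarrow> smooth_on S (\<lambda>x. \<Sum>i\<in>I. f i x)"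
  unfolding smooth_on_def by (intro allI Ck_on_sum) auto

lemma smooth_on_scaleR:
  "open S \<Longrightarrow> smooth_on S f \<Longrightarrow> smooth_on S g \<Longrightarrow> smooth_on S (\<lambda>x. f x *\<^sub>R g x)"
  unfolding smooth_on_def by (intro allI Ck_on_bilinear[OF bounded_bilinear_scaleR]) auto

lemma smooth_on_mult:
  fixes f g :: "_ \<Rightarrow> real"
  shows "open S \<Longrightarrow> smooth_on S f \<Longrightarrow> smooth_on S g \<Longrightarrow> smooth_on S (\<lambda>x. f x * g x)"
  unfolding smooth_on_def by (intro allI Ck_on_bilinear[OF bounded_bilinear_mult]) auto

lemma smooth_on_Pair:
  "open S \<Longrightarrow> smooth_on S f \<Longrightarrow> smooth_on S g \<Longrightarrow> smooth_on S (\<lambda>x. (f x, g x))"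
  unfolding smooth_on_def by (intro allI Ck_on_Pair) auto

lemma smooth_on_compose:
  fixes f :: "'a::real_normed_vector \<Rightarrow> 'b::real_inner"
  assumes "frame_basis (B :: 'b set)" "open S" "smooth_on S f" "smooth_on T g" "f ` S \<subseteq> T"
  shows "smooth_on S (\<lambda>x. g (f x))"
  unfolding smooth_on_def
proof
  fix k
  have "Ck_on k S f" "Ck_on k T g" using assms(3,4) unfolding smooth_on_def by auto
  then show "Ck_on k S (\<lambda>x. g (f x))" using assms(5) by (rule Ck_on_compose[OF assms(1,2)])
qed

lemma smooth_on_directional:
  fixes f :: "'a::real_inner \<Rightarrow> 'b::real_normed_vector"
  assumes B: "frame_basis (B :: 'a set)" and S: "open S" and f: "smooth_on S f" and V: "smooth_on S V"
  shows "smooth_on S (\<lambda>x. frechet_derivative f (at x) (V x))"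
proof -
  have "smooth_on S (\<lambda>x. \<Sum>b\<in>B. (V x \<bullet> b) *\<^sub>R frechet_derivative f (at x) b)"
    by (intro smooth_on_sum smooth_on_scaleR S smooth_on_derivative f
        smooth_on_bounded_linear[OF bounded_linear_inner_left] V)
  moreover have "frechet_derivative f (at x) (V x) = (\<Sum>b\<in>B. (V x \<bullet> b) *\<^sub>R frechet_derivative f (at x) b)"
    if "x \<in> S" for x
    using linear_frame_basis[OF B has_derivative_linear[OF smooth_on_has_derivative[OF f that]]] .
  ultimately show ?thesis by (subst smooth_on_cong[OF S])
qed

section \<open>Symmetry of second derivatives\<close>

lemma second_difference_mean_value:
  fixes F :: "'a::real_normed_vector \<Rightarrow> real"
  assumes "0 < h" and box: "\<And>s t. 0 \<le> s \<Longrightarrow> s \<le> h \<Longrightarrow> 0 \<le> t \<Longrightarrow> t \<le> h \<Longrightarrow> x + s *\<^sub>R v + t *\<^sub>R w \<in> S"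
    and F: "\<And>y. y \<in> S \<Longrightarrow> (F has_derivative F' y) (at y)"
    and F2: "\<And>y. y \<in> S \<Longrightarrow> ((\<lambda>y. F' y v) has_derivative F'' y) (at y)"
  shows "\<exists>s t. 0 < s \<and> s < h \<and> 0 < t \<and> t < h \<and>
    F (x + h *\<^sub>R v + h *\<^sub>R w) - F (x + h *\<^sub>R v) - F (x + h *\<^sub>R w) + F x =
    h * h * F'' (x + s *\<^sub>R v + t *\<^sub>R w) w"
proof -
  \<comment> \<open>The mean value theorem is applied twice: along \<open>v\<close> to the
    difference of \<open>F\<close> in the direction \<open>w\<close>, and then along
    \<open>w\<close> to the derivative of \<open>F\<close> in the direction
    \<open>v\<close>.\<close>
  define p where "p s = F (x + s *\<^sub>R v + h *\<^sub>R w) - F (x + s *\<^sub>R v)" for s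
  have d1: "((\<lambda>s. F (x + s *\<^sub>R v + r)) has_real_derivative F' (x + s *\<^sub>R v + r) v) (at s)"
    if "x + s *\<^sub>R v + r \<in> S" for s r
  proof -
    have "((\<lambda>s. x + s *\<^sub>R v + r) has_derivative (\<lambda>s. s *\<^sub>R v)) (at s)"
      by (auto intro!: derivative_eq_intros)
    from has_derivative_compose[OF this F[OF that]] show ?thesis
      using linear_scale[OF has_derivative_linear[OF F[OF that]]]
      by (simp add: has_field_derivative_def mult.commute[of _ "F' _ v"])
  qed
  have "\<exists>z>0. z < h \<and> p h - p 0 = (h - 0) * (F' (x + z *\<^sub>R v + h *\<^sub>R w) v - F' (x + z *\<^sub>R v) v)"
  proof (rule MVT2)
    fix s assume "0 \<le> s" "s \<le> h"
    then show "(p has_real_derivative F' (x + s *\<^sub>R v + h *\<^sub>R w) v - F' (x + s *\<^sub>R v) v) (at s)"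
      unfolding p_def using d1[of s "h *\<^sub>R w"] d1[of s 0] box[of s h] box[of s 0] \<open>0 < h\<close>
      by (auto intro!: derivative_intros)
  qed (use \<open>0 < h\<close> in auto)
  then obtain s where s: "0 < s" "s < h" "p h - p 0 = h * (F' (x + s *\<^sub>R v + h *\<^sub>R w) v - F' (x + s *\<^sub>R v) v)"
    by auto
  have "\<exists>z>0. z < h \<and> F' (x + s *\<^sub>R v + h *\<^sub>R w) v - F' (x + s *\<^sub>R v + 0 *\<^sub>R w) v
      = (h - 0) * F'' (x + s *\<^sub>R v + z *\<^sub>R w) w"
  proof (rule MVT2)
    fix t assume "0 \<le> t" "t \<le> h"
    then have in_S: "x + s *\<^sub>R v + t *\<^sub>R w \<in> S" using box s by auto
    have "((\<lambda>t. x + s *\<^sub>R v + t *\<^sub>R w) has_derivative (\<lambda>t. t *\<^sub>R w)) (at t)"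
      by (auto intro!: derivative_eq_intros)
    from has_derivative_compose[OF this F2[OF in_S]]
    show "((\<lambda>t. F' (x + s *\<^sub>R v + t *\<^sub>R w) v) has_real_derivative F'' (x + s *\<^sub>R v + t *\<^sub>R w) w) (at t)"
      using linear_scale[OF has_derivative_linear[OF F2[OF in_S]]]
      by (simp add: has_field_derivative_def mult.commute[of _ "F'' _ w"])
  qed (use \<open>0 < h\<close> in auto)
  then obtain t where t: "0 < t" "t < h" "F' (x + s *\<^sub>R v + h *\<^sub>R w) v - F' (x + s *\<^sub>R v) v
      = h * F'' (x + s *\<^sub>R v + t *\<^sub>R w) w"
    by auto
  have "F (x + h *\<^sub>R v + h *\<^sub>R w) - F (x + h *\<^sub>R v) - F (x + h *\<^sub>R w) + F x = p h - p 0"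
    by (simp add: p_def)
  then show ?thesis using s t by (metis mult.assoc)
qed

text \<open>The second difference is symmetric in \<open>v\<close> and \<open>w\<close>, and divided
  by the square of the step it tends to either mixed derivative, by continuity of the
  latter.\<close>

lemma symmetric_second_derivative:
  fixes F :: "'a::real_normed_vector \<Rightarrow> real"
  assumes S: "open S" and F: "smooth_on S F" and x: "x \<in> S"
  shows "frechet_derivative (\<lambda>y. frechet_derivative F (at y) v) (at x) w =
    frechet_derivative (\<lambda>y. frechet_derivative F (at y) w) (at x) v"
proof -
  let ?H = "\<lambda>v w y. frechet_derivative (\<lambda>y. frechet_derivative F (at y) v) (at y) w"
  let ?D = "\<lambda>v w h. F (x + h *\<^sub>R v + h *\<^sub>R w) - F (x + h *\<^sub>R v) - F (x + h *\<^sub>R w) + F x"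
  have close: "\<exists>r>0. \<forall>h. 0 < h \<and> h < r \<longrightarrow> \<bar>?D v w h - h * h * ?H v w x\<bar> \<le> h * h * e"
    if "e > 0" for e v w
  proof -
    have "continuous_on S (?H v w)"
      by (intro smooth_on_continuous smooth_on_derivative F)
    then have "continuous (at x) (?H v w)" using S x continuous_on_eq_continuous_at by blast
    then obtain d where d: "d > 0" "\<And>y. dist y x < d \<Longrightarrow> dist (?H v w y) (?H v w x) < e"
      using \<open>e > 0\<close> unfolding continuous_at_eps_delta dist_norm by (metis dist_norm)
    obtain c where c: "c > 0" "ball x c \<subseteq> S" using S x open_contains_ball by blast
    define m where "m = min c d"
    \<comment> \<open>Steps below \<open>r\<close> keep the whole parallelogram spanned by
      \<open>h *\<^sub>R v\<close> and \<open>h *\<^sub>R w\<close> within distance \<open>m\<close>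
      of \<open>x\<close>; the summand 1 avoids division by 0.\<close>
    define r where "r = m / (norm v + norm w + 1)"
    have pos: "norm v + norm w + 1 > 0" by (simp add: add_nonneg_pos)
    have m: "m > 0" using c d by (simp add: m_def)
    have "r > 0" using m pos by (simp add: r_def)
    moreover have "\<bar>?D v w h - h * h * ?H v w x\<bar> \<le> h * h * e" if h: "0 < h" "h < r" for h
    proof -
      have near: "dist (x + s *\<^sub>R v + t *\<^sub>R w) x < m" if "0 \<le> s" "s \<le> h" "0 \<le> t" "t \<le> h" for s t
      proof -
        have "dist (x + s *\<^sub>R v + t *\<^sub>R w) x = norm (s *\<^sub>R v + t *\<^sub>R w)"
          by (simp add: dist_norm algebra_simps)
        also have "\<dots> \<le> s * norm v + t * norm w" using that norm_triangle_ineq[of "s *\<^sub>R v" "t *\<^sub>R w"] by simp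
        also have "\<dots> \<le> h * norm v + h * norm w" using that by (intro add_mono mult_right_mono) auto
        also have "\<dots> < h * (norm v + norm w + 1)" using h by (simp add: algebra_simps)
        also have "\<dots> < r * (norm v + norm w + 1)" using h pos by (intro mult_strict_right_mono)
        also have "\<dots> = m" using pos by (simp add: r_def)
        finally show ?thesis .
      qed
      have "\<exists>s t. 0 < s \<and> s < h \<and> 0 < t \<and> t < h \<and> ?D v w h = h * h * ?H v w (x + s *\<^sub>R v + t *\<^sub>R w)"
      proof (rule second_difference_mean_value[where S = S])
        show "x + s *\<^sub>R v + t *\<^sub>R w \<in> S" if "0 \<le> s" "s \<le> h" "0 \<le> t" "t \<le> h" for s t
          using near[OF that] c(2) by (auto simp: m_def dist_commute subset_iff)
      qed (use h in \<open>auto intro!: smooth_on_has_derivative[OF F]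
             smooth_on_has_derivative[OF smooth_on_derivative[OF F]]\<close>)
      then obtain s t where st: "0 < s" "s < h" "0 < t" "t < h"
        "?D v w h = h * h * ?H v w (x + s *\<^sub>R v + t *\<^sub>R w)" by blast
      have "dist (?H v w (x + s *\<^sub>R v + t *\<^sub>R w)) (?H v w x) < e"
        using near[of s t] st by (intro d(2)) (simp add: m_def)
      then have "\<bar>?H v w (x + s *\<^sub>R v + t *\<^sub>R w) - ?H v w x\<bar> < e" by (simp add: dist_real_def)
      moreover have "\<bar>?D v w h - h * h * ?H v w x\<bar> = h * h * \<bar>?H v w (x + s *\<^sub>R v + t *\<^sub>R w) - ?H v w x\<bar>"
        unfolding st(5) using h by (simp add: abs_mult flip: right_diff_distrib)
      ultimately show ?thesis using h by (simp add: mult_left_mono)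
    qed
    ultimately show ?thesis by blast
  qed
  have "\<bar>?H v w x - ?H w v x\<bar> \<le> 0 + e" if "e > 0" for e
  proof -
    obtain r1 where r1: "r1 > 0" "\<And>h. 0 < h \<Longrightarrow> h < r1 \<Longrightarrow> \<bar>?D v w h - h * h * ?H v w x\<bar> \<le> h * h * (e/2)"
      using close[of "e/2" v w] \<open>e > 0\<close> by auto
    obtain r2 where r2: "r2 > 0" "\<And>h. 0 < h \<Longrightarrow> h < r2 \<Longrightarrow> \<bar>?D w v h - h * h * ?H w v x\<bar> \<le> h * h * (e/2)"
      using close[of "e/2" w v] \<open>e > 0\<close> by auto
    define h where "h = min r1 r2 / 2"
    have h: "0 < h" "h < r1" "h < r2" using r1 r2 by (auto simp: h_def)
    have "?D v w h = ?D w v h" by (simp add: algebra_simps)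
    then have "\<bar>h * h * ?H v w x - h * h * ?H w v x\<bar> \<le> h * h * e"
      using r1(2)[OF h(1,2)] r2(2)[OF h(1,3)] by linarith
    moreover have "\<bar>h * h * ?H v w x - h * h * ?H w v x\<bar> = (h * h) * \<bar>?H v w x - ?H w v x\<bar>"
      by (simp add: abs_mult flip: right_diff_distrib)
    ultimately show ?thesis using h by simp
  qed
  then have "\<bar>?H v w x - ?H w v x\<bar> \<le> 0" by (rule field_le_epsilon)
  then show ?thesis by simp
qed

section \<open>Smooth functions on a Lie group and on its square\<close>

context lie_group
begin

lemma chart:
  assumes "(U, \<phi>) \<in> charts G"
  shows "open U" "open (\<phi> ` U)" "continuous_on U \<phi>" "continuous_on (\<phi> ` U) (inv_into U \<phi>)"
    "\<And>p. p \<in> U \<Longrightarrow> inv_into U \<phi> (\<phi> p) = p" "\<And>u. u \<in> \<phi> ` U \<Longrightarrow> inv_into U \<phi> u \<in> U"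
    "\<And>u. u \<in> \<phi> ` U \<Longrightarrow> \<phi> (inv_into U \<phi> u) = u" "inj_on \<phi> U"
proof -
  have *: "open U \<and> open (\<phi> ` U) \<and> homeomorphism U (\<phi> ` U) \<phi> (inv_into U \<phi>)"
    using atlas assms unfolding smooth_atlas_def by fast
  then show "open U" "open (\<phi> ` U)" "continuous_on U \<phi>" "continuous_on (\<phi> ` U) (inv_into U \<phi>)"
    "\<And>p. p \<in> U \<Longrightarrow> inv_into U \<phi> (\<phi> p) = p"
    by (auto simp: homeomorphism_def)
  then show "inj_on \<phi> U" by (metis inj_onI)
qed (auto simp: f_inv_into_f inv_into_into)

lemma chart_at: obtains U \<phi> where "(U, \<phi>) \<in> charts G" "p \<in> U"
proof -
  have "p \<in> \<Union>(fst ` charts G)" using atlas unfolding smooth_atlas_def by auto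
  then show ?thesis using that by auto
qed

definition model_basis :: "'a set" where "model_basis = (SOME B. frame_basis B)"

lemma model_basis: "frame_basis model_basis"
  using frame_basis_exists model_finite_dim unfolding model_basis_def by (metis someI_ex)

definition model_basis2 :: "('a \<times> 'a) set" where "model_basis2 = (SOME B. frame_basis B)"

lemma model_basis2: "frame_basis model_basis2"
  using frame_basis_prod[OF model_basis model_basis] unfolding model_basis2_def by (metis someI_ex)

lemma in_carrier [simp]: "x \<in> carrier G"
  by (simp add: carrier_UNIV)

lemma continuous_group_mult: "continuous_on UNIV (\<lambda>z. fst z \<otimes> snd z)"
  using smooth_mult unfolding smooth_map_def by (simp add: case_prod_beta')

lemma continuous_group_inv: "continuous_on UNIV (\<lambda>x. inv x)"
  using smooth_inv unfolding smooth_map_def by simp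

definition mult_chart where
  "mult_chart U \<phi> V \<psi> \<theta> = (\<lambda>z. \<theta> (inv_into U \<phi> (fst z) \<otimes> inv_into V \<psi> (snd z)))"

definition mult_dom where
  "mult_dom U \<phi> V \<psi> W = {z \<in> \<phi> ` U \<times> \<psi> ` V. inv_into U \<phi> (fst z) \<otimes> inv_into V \<psi> (snd z) \<in> W}"

lemma open_mult_dom:
  assumes c: "(U, \<phi>) \<in> charts G" "(V, \<psi>) \<in> charts G" and "open W"
  shows "open (mult_dom U \<phi> V \<psi> W)"
proof -
  have "continuous_on (\<phi> ` U \<times> \<psi> ` V) (\<lambda>z. (inv_into U \<phi> (fst z), inv_into V \<psi> (snd z)))"
    by (intro continuous_on_Pair continuous_on_compose2[OF chart(4)[OF c(1)]]
        continuous_on_compose2[OF chart(4)[OF c(2)]]) (auto intro: continuous_intros)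
  then have "continuous_on (\<phi> ` U \<times> \<psi> ` V) (\<lambda>z. inv_into U \<phi> (fst z) \<otimes> inv_into V \<psi> (snd z))"
    using continuous_on_compose2[OF continuous_group_mult, of "\<phi> ` U \<times> \<psi> ` V"] by fastforce
  from continuous_open_preimage[OF this _ \<open>open W\<close>] show ?thesis
    using chart(2)[OF c(1)] chart(2)[OF c(2)]
    by (auto simp: mult_dom_def open_Times vimage_def Int_def)
qed

text \<open>The product atlas inverts its charts by \<open>inv_into\<close> on U \<times> V, a
  choice operator that splits into components because both charts are injective.\<close>

lemma smooth_mult_chart:
  assumes c: "(U, \<phi>) \<in> charts G" "(V, \<psi>) \<in> charts G" "(W, \<theta>) \<in> charts G"
  shows "smooth_on (mult_dom U \<phi> V \<psi> W) (mult_chart U \<phi> V \<psi> \<theta>)"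
proof -
  have inj: "inj_on (map_prod \<phi> \<psi>) (U \<times> V)"
    using chart(8)[OF c(1)] chart(8)[OF c(2)] by (auto simp: inj_on_def)
  have eq: "inv_into (U \<times> V) (map_prod \<phi> \<psi>) z = (inv_into U \<phi> (fst z), inv_into V \<psi> (snd z))"
    if "z \<in> \<phi> ` U \<times> \<psi> ` V" for z
  proof (rule inv_into_f_eq[OF inj])
    show "(inv_into U \<phi> (fst z), inv_into V \<psi> (snd z)) \<in> U \<times> V"
      "map_prod \<phi> \<psi> (inv_into U \<phi> (fst z), inv_into V \<psi> (snd z)) = z"
      using chart(6,7)[OF c(1)] chart(6,7)[OF c(2)] that by (auto simp: mem_Times_iff)
  qed
  have dom: "map_prod \<phi> \<psi> ` ((U \<times> V) \<inter> (\<lambda>(g, h). g \<otimes> h) -` W) = mult_dom U \<phi> V \<psi> W"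
    using chart(5,6,7)[OF c(1)] chart(5,6,7)[OF c(2)] by (force simp: mult_dom_def image_iff)
  have "(U \<times> V, map_prod \<phi> \<psi>) \<in> prod_atlas (charts G) (charts G)"
    using c by (auto simp: prod_atlas_def)
  then have "smooth_on (mult_dom U \<phi> V \<psi> W)
      (\<theta> \<circ> (\<lambda>(g, h). g \<otimes> h) \<circ> inv_into (U \<times> V) (map_prod \<phi> \<psi>))"
    using smooth_mult c(3) unfolding smooth_map_def dom[symmetric] by fast
  moreover have "(\<theta> \<circ> (\<lambda>(g, h). g \<otimes> h) \<circ> inv_into (U \<times> V) (map_prod \<phi> \<psi>)) z = mult_chart U \<phi> V \<psi> \<theta> z"
    if "z \<in> mult_dom U \<phi> V \<psi> W" for z
    using that eq[of z] by (simp add: mult_dom_def mult_chart_def)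
  ultimately show ?thesis
    using smooth_on_cong[OF open_mult_dom[OF c(1,2) chart(1)[OF c(3)]]] by blast
qed

lemma inv_chart:
  assumes c: "(U, \<phi>) \<in> charts G" "(W, \<theta>) \<in> charts G"
  defines "D \<equiv> {u \<in> \<phi> ` U. inv (inv_into U \<phi> u) \<in> W}"
  shows "open D" "smooth_on D (\<lambda>u. \<theta> (inv (inv_into U \<phi> u)))"
proof -
  have "continuous_on (\<phi> ` U) (\<lambda>u. inv (inv_into U \<phi> u))"
    using continuous_on_compose2[OF continuous_group_inv chart(4)[OF c(1)]] by auto
  from continuous_open_preimage[OF this chart(2)[OF c(1)] chart(1)[OF c(2)]] show D: "open D"
    by (auto simp: D_def vimage_def Int_def)
  have dom: "\<phi> ` (U \<inter> (\<lambda>g. inv g) -` W) = D"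
    using chart(5,6,7)[OF c(1)] by (force simp: D_def image_iff)
  have "smooth_on D (\<theta> \<circ> (\<lambda>g. inv g) \<circ> inv_into U \<phi>)"
    using smooth_inv c unfolding smooth_map_def dom[symmetric] by fast
  then show "smooth_on D (\<lambda>u. \<theta> (inv (inv_into U \<phi> u)))" by (simp add: o_def)
qed

text \<open>The continuity clause of \<open>smooth_map\<close> follows from smoothness in charts,
  since charts are homeomorphisms and cover the group.\<close>

lemma Cinf_iff:
  "f \<in> Cinf G \<longleftrightarrow> (\<forall>(U, \<phi>)\<in>charts G. smooth_on (\<phi> ` U) (\<lambda>u. f (inv_into U \<phi> u)))"
proof
  assume "f \<in> Cinf G"
  then show "\<forall>(U, \<phi>)\<in>charts G. smooth_on (\<phi> ` U) (\<lambda>u. f (inv_into U \<phi> u))"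
    by (fastforce simp: Cinf_def smooth_map_def id_atlas_def o_def)
next
  assume f: "\<forall>(U, \<phi>)\<in>charts G. smooth_on (\<phi> ` U) (\<lambda>u. f (inv_into U \<phi> u))"
  have "continuous (at p) f" for p
  proof -
    obtain U \<phi> where c: "(U, \<phi>) \<in> charts G" "p \<in> U" using chart_at .
    have "continuous_on (\<phi> ` U) (\<lambda>u. f (inv_into U \<phi> u))"
      using f c by (auto intro: smooth_on_continuous)
    then have "continuous_on U (\<lambda>x. f (inv_into U \<phi> (\<phi> x)))"
      using continuous_on_compose2[OF _ chart(3)[OF c(1)]] by blast
    then have "continuous_on U f" using chart(5)[OF c(1)] by (simp cong: continuous_on_cong)
    then show ?thesis using c chart(1)[OF c(1)] continuous_on_eq_continuous_at by blast
  qed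
  then have "continuous_on UNIV f" by (simp add: continuous_at_imp_continuous_on)
  then show "f \<in> Cinf G" using f by (fastforce simp: Cinf_def smooth_map_def id_atlas_def o_def)
qed

lemma CinfD: "f \<in> Cinf G \<Longrightarrow> (U, \<phi>) \<in> charts G \<Longrightarrow> smooth_on (\<phi> ` U) (\<lambda>u. f (inv_into U \<phi> u))"
  unfolding Cinf_iff by auto

lemma CinfI: "(\<And>U \<phi>. (U, \<phi>) \<in> charts G \<Longrightarrow> smooth_on (\<phi> ` U) (\<lambda>u. f (inv_into U \<phi> u))) \<Longrightarrow> f \<in> Cinf G"
  unfolding Cinf_iff by auto

lemma Cinf_const: "const c \<in> Cinf G"
  by (auto intro!: CinfI smooth_on_const chart simp: const_def)

lemma Cinf_zero: "0 \<in> Cinf G"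
  using Cinf_const[of 0] by (simp add: const_def zero_fun_def)

lemma Cinf_add: "f \<in> Cinf G \<Longrightarrow> h \<in> Cinf G \<Longrightarrow> f + h \<in> Cinf G"
  by (auto intro!: CinfI smooth_on_add chart dest: CinfD simp: plus_fun_def)

lemma Cinf_mult: "f \<in> Cinf G \<Longrightarrow> h \<in> Cinf G \<Longrightarrow> f * h \<in> Cinf G"
  by (auto intro!: CinfI smooth_on_mult chart dest: CinfD simp: times_fun_def)

lemma Cinf_scale: "f \<in> Cinf G \<Longrightarrow> (\<lambda>x. c * f x) \<in> Cinf G"
  using Cinf_mult[OF Cinf_const, of f c] by (simp add: const_def times_fun_def)

lemma Cinf_uminus: "f \<in> Cinf G \<Longrightarrow> - f \<in> Cinf G"
  using Cinf_scale[of f "-1"] by (simp add: fun_Compl_def)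

lemma Cinf_diff: "f \<in> Cinf G \<Longrightarrow> h \<in> Cinf G \<Longrightarrow> f - h \<in> Cinf G"
  using Cinf_add[OF _ Cinf_uminus, of f h] by simp

lemma Cinf_sum: "(\<And>i. i \<in> I \<Longrightarrow> f i \<in> Cinf G) \<Longrightarrow> sum f I \<in> Cinf G"
  by (induction I rule: infinite_finite_induct) (auto intro: Cinf_zero Cinf_add)

text \<open>Smoothness on G \<times> G, stated directly in pairs of charts because the product is
  not itself presented as a \<open>lie_group\<close>. Smooth functions of one variable arise from it
  as slices or on the diagonal.\<close>

definition smooth2 :: "('g \<times> 'g \<Rightarrow> real) \<Rightarrow> bool" where
  "smooth2 F \<longleftrightarrow> (\<forall>(U, \<phi>)\<in>charts G. \<forall>(V, \<psi>)\<in>charts G.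
     smooth_on (\<phi> ` U \<times> \<psi> ` V) (\<lambda>z. F (inv_into U \<phi> (fst z), inv_into V \<psi> (snd z))))"

lemma smooth2D:
  "smooth2 F \<Longrightarrow> (U, \<phi>) \<in> charts G \<Longrightarrow> (V, \<psi>) \<in> charts G \<Longrightarrow>
     smooth_on (\<phi> ` U \<times> \<psi> ` V) (\<lambda>z. F (inv_into U \<phi> (fst z), inv_into V \<psi> (snd z)))"
  unfolding smooth2_def by auto

lemma smooth2I:
  "(\<And>U \<phi> V \<psi>. (U, \<phi>) \<in> charts G \<Longrightarrow> (V, \<psi>) \<in> charts G \<Longrightarrow>
     smooth_on (\<phi> ` U \<times> \<psi> ` V) (\<lambda>z. F (inv_into U \<phi> (fst z), inv_into V \<psi> (snd z)))) \<Longrightarrow> smooth2 F"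
  unfolding smooth2_def by auto

lemma smooth2_mult:
  assumes f: "f \<in> Cinf G"
  shows "smooth2 (\<lambda>z. f (fst z \<otimes> snd z))"
proof (rule smooth2I, rule smooth_on_local)
  fix U \<phi> V \<psi> and z :: "'a \<times> 'a"
  assume c: "(U, \<phi>) \<in> charts G" "(V, \<psi>) \<in> charts G" and z: "z \<in> \<phi> ` U \<times> \<psi> ` V"
  obtain W \<theta> where w: "(W, \<theta>) \<in> charts G" "inv_into U \<phi> (fst z) \<otimes> inv_into V \<psi> (snd z) \<in> W"
    using chart_at .
  let ?T = "mult_dom U \<phi> V \<psi> W"
  have T: "open ?T" "z \<in> ?T" using open_mult_dom[OF c chart(1)[OF w(1)]] z w by (auto simp: mult_dom_def)
  have "smooth_on ?T (\<lambda>z. f (inv_into W \<theta> (mult_chart U \<phi> V \<psi> \<theta> z)))"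
    by (rule smooth_on_compose[OF model_basis T(1) smooth_mult_chart[OF c w(1)] CinfD[OF f w(1)]])
      (auto simp: mult_dom_def mult_chart_def)
  then have "smooth_on ?T (\<lambda>z. f (inv_into U \<phi> (fst z) \<otimes> inv_into V \<psi> (snd z)))"
    by (rule smooth_on_cong[THEN iffD1, OF T(1), rotated])
      (simp add: mult_dom_def mult_chart_def chart(5)[OF w(1)])
  then show "\<exists>T. open T \<and> z \<in> T \<and> smooth_on T (\<lambda>z. f (fst (inv_into U \<phi> (fst z), inv_into V \<psi> (snd z))
      \<otimes> snd (inv_into U \<phi> (fst z), inv_into V \<psi> (snd z))))"
    using T by auto
qed

lemma smooth2_swap:
  assumes "smooth2 F"
  shows "smooth2 (\<lambda>z. F (snd z, fst z))"
proof (rule smooth2I)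
  fix U \<phi> V \<psi> assume c: "(U, \<phi>) \<in> charts G" "(V, \<psi>) \<in> charts G"
  have o: "open (\<phi> ` U \<times> \<psi> ` V)" using chart(2) c by (simp add: open_Times)
  have "smooth_on (\<phi> ` U \<times> \<psi> ` V) (\<lambda>z. (snd z, fst z))"
    by (intro smooth_on_Pair o smooth_on_bounded_linear[OF bounded_linear_snd o smooth_on_ident[OF o]]
        smooth_on_bounded_linear[OF bounded_linear_fst o smooth_on_ident[OF o]])
  from smooth_on_compose[OF model_basis2 o this smooth2D[OF assms c(2,1)]]
  show "smooth_on (\<phi> ` U \<times> \<psi> ` V) (\<lambda>z. F (snd (inv_into U \<phi> (fst z), inv_into V \<psi> (snd z)),
      fst (inv_into U \<phi> (fst z), inv_into V \<psi> (snd z))))"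
    by force
qed

lemma smooth2_inv_snd:
  assumes F: "smooth2 F"
  shows "smooth2 (\<lambda>z. F (fst z, inv (snd z)))"
proof (rule smooth2I, rule smooth_on_local)
  fix U \<phi> V \<psi> and z :: "'a \<times> 'a"
  assume c: "(U, \<phi>) \<in> charts G" "(V, \<psi>) \<in> charts G" and z: "z \<in> \<phi> ` U \<times> \<psi> ` V"
  obtain W \<theta> where w: "(W, \<theta>) \<in> charts G" "inv (inv_into V \<psi> (snd z)) \<in> W"
    using chart_at .
  define D where "D = {v \<in> \<psi> ` V. inv (inv_into V \<psi> v) \<in> W}"
  note D = inv_chart[OF c(2) w(1), folded D_def]
  let ?T = "\<phi> ` U \<times> D"
  have T: "open ?T" "z \<in> ?T" using chart(2)[OF c(1)] D z w by (auto simp: D_def open_Times)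
  have "smooth_on ?T (\<lambda>z. (fst z, \<theta> (inv (inv_into V \<psi> (snd z)))))"
    using D(2) by (intro smooth_on_Pair T(1) smooth_on_bounded_linear[OF bounded_linear_fst T(1) smooth_on_ident[OF T(1)]]
        smooth_on_compose[OF model_basis T(1) smooth_on_bounded_linear[OF bounded_linear_snd T(1) smooth_on_ident[OF T(1)]]])
      auto
  from smooth_on_compose[OF model_basis2 T(1) this smooth2D[OF F c(1) w(1)]]
  have "smooth_on ?T (\<lambda>z. F (inv_into U \<phi> (fst z), inv_into W \<theta> (\<theta> (inv (inv_into V \<psi> (snd z))))))"
    by (force simp: D_def)
  then have "smooth_on ?T (\<lambda>z. F (inv_into U \<phi> (fst z), inv (inv_into V \<psi> (snd z))))"
    by (rule smooth_on_cong[THEN iffD1, OF T(1), rotated]) (auto simp add: D_def chart(5)[OF w(1)])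
  then show "\<exists>T. open T \<and> z \<in> T \<and> smooth_on T (\<lambda>z. F (fst (inv_into U \<phi> (fst z), inv_into V \<psi> (snd z)),
      inv (snd (inv_into U \<phi> (fst z), inv_into V \<psi> (snd z)))))"
    using T by auto
qed

lemma smooth2_slice_fst:
  assumes F: "smooth2 F"
  shows "(\<lambda>x. F (x, y)) \<in> Cinf G"
proof (rule CinfI)
  fix U \<phi> assume c: "(U, \<phi>) \<in> charts G"
  obtain V \<psi> where v: "(V, \<psi>) \<in> charts G" "y \<in> V" using chart_at .
  note o = chart(2)[OF c]
  have "smooth_on (\<phi> ` U) (\<lambda>u. (u, \<psi> y))"
    by (intro smooth_on_Pair o smooth_on_ident smooth_on_const)
  from smooth_on_compose[OF model_basis2 o this smooth2D[OF F c v(1)]] v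
  show "smooth_on (\<phi> ` U) (\<lambda>u. F (inv_into U \<phi> u, y))" using chart(5)[OF v] by force
qed

lemma smooth2_slice_snd:
  assumes F: "smooth2 F"
  shows "(\<lambda>y. F (x, y)) \<in> Cinf G"
  using smooth2_slice_fst[OF smooth2_swap[OF F]] by simp

lemma smooth2_diagonal:
  assumes F: "smooth2 F"
  shows "(\<lambda>x. F (x, x)) \<in> Cinf G"
proof (rule CinfI)
  fix U \<phi> assume c: "(U, \<phi>) \<in> charts G"
  note o = chart(2)[OF c]
  have "smooth_on (\<phi> ` U) (\<lambda>u. (u, u))" by (intro smooth_on_Pair o smooth_on_ident)
  from smooth_on_compose[OF model_basis2 o this smooth2D[OF F c c]]
  show "smooth_on (\<phi> ` U) (\<lambda>u. F (inv_into U \<phi> u, inv_into U \<phi> u))" by force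
qed

lemma Cinf_translate:
  assumes f: "f \<in> Cinf G"
  shows "(\<lambda>x. f (g \<otimes> x)) \<in> Cinf G" "(\<lambda>x. f (x \<otimes> g)) \<in> Cinf G" "(\<lambda>x. f (inv x)) \<in> Cinf G"
proof -
  show "(\<lambda>x. f (g \<otimes> x)) \<in> Cinf G" using smooth2_slice_snd[OF smooth2_mult[OF f]] by simp
  show "(\<lambda>x. f (x \<otimes> g)) \<in> Cinf G" using smooth2_slice_fst[OF smooth2_mult[OF f]] by simp
  show "(\<lambda>x. f (inv x)) \<in> Cinf G"
    using smooth2_slice_snd[OF smooth2_inv_snd[OF smooth2_mult[OF f]], of \<one>] by simp
qed

subsection \<open>Vector fields on the two factors\<close>

lemma vfield_off: "X \<in> vfields G \<Longrightarrow> f \<notin> Cinf G \<Longrightarrow> X f = 0"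
  unfolding vfields_def by auto

definition field_rep where
  "field_rep X U \<phi> \<xi> \<longleftrightarrow> smooth_on (\<phi> ` U) \<xi> \<and> (\<forall>f\<in>Cinf G. \<forall>u\<in>\<phi> ` U.
     X f (inv_into U \<phi> u) = frechet_derivative (\<lambda>u. f (inv_into U \<phi> u)) (at u) (\<xi> u))"

lemma field_repD:
  assumes "field_rep X U \<phi> \<xi>"
  shows "smooth_on (\<phi> ` U) \<xi>"
    "f \<in> Cinf G \<Longrightarrow> u \<in> \<phi> ` U \<Longrightarrow>
      X f (inv_into U \<phi> u) = frechet_derivative (\<lambda>u. f (inv_into U \<phi> u)) (at u) (\<xi> u)"
  using assms unfolding field_rep_def by auto

lemma field_rep_exists:
  assumes X: "X \<in> vfields G" and c: "(U, \<phi>) \<in> charts G"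
  obtains \<xi> where "field_rep X U \<phi> \<xi>"
proof -
  obtain \<xi> where \<xi>: "smooth_on (\<phi> ` U) \<xi>"
    "\<And>f p. f \<in> Cinf G \<Longrightarrow> p \<in> U \<Longrightarrow> X f p = frechet_derivative (f \<circ> inv_into U \<phi>) (at (\<phi> p)) (\<xi> (\<phi> p))"
    using X c unfolding vfields_def by force
  have "X f (inv_into U \<phi> u) = frechet_derivative (\<lambda>u. f (inv_into U \<phi> u)) (at u) (\<xi> u)"
    if "f \<in> Cinf G" "u \<in> \<phi> ` U" for f u
    using \<xi>(2)[OF that(1), of "inv_into U \<phi> u"] chart(6,7)[OF c that(2)] by (simp add: o_def)
  then show ?thesis using that \<xi>(1) unfolding field_rep_def by blast
qed

lemma vfieldI:
  assumes "\<And>f. f \<notin> Cinf G \<Longrightarrow> X f = 0"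
    and "\<And>U \<phi>. (U, \<phi>) \<in> charts G \<Longrightarrow> \<exists>\<xi>. smooth_on (\<phi> ` U) \<xi> \<and> (\<forall>f\<in>Cinf G. \<forall>p\<in>U.
        X f p = frechet_derivative (\<lambda>u. f (inv_into U \<phi> u)) (at (\<phi> p)) (\<xi> (\<phi> p)))"
  shows "X \<in> vfields G"
  using assms unfolding vfields_def o_def by blast

lemma Cinf_derivative:
  "f \<in> Cinf G \<Longrightarrow> (U, \<phi>) \<in> charts G \<Longrightarrow> u \<in> \<phi> ` U \<Longrightarrow>
    ((\<lambda>u. f (inv_into U \<phi> u)) has_derivative frechet_derivative (\<lambda>u. f (inv_into U \<phi> u)) (at u)) (at u)"
  using smooth_on_has_derivative CinfD by blast

lemma vfield_Cinf:
  assumes X: "X \<in> vfields G"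
  shows "X f \<in> Cinf G"
proof (cases "f \<in> Cinf G")
  case True
  show ?thesis
  proof (rule CinfI)
    fix U \<phi> assume c: "(U, \<phi>) \<in> charts G"
    obtain \<xi> where \<xi>_rep: "field_rep X U \<phi> \<xi>" by (rule field_rep_exists[OF X c])
    note \<xi> = field_repD[OF \<xi>_rep]
    show "smooth_on (\<phi> ` U) (\<lambda>u. X f (inv_into U \<phi> u))"
      by (rule smooth_on_cong[THEN iffD2, OF chart(2)[OF c] \<xi>(2)[OF True]
            smooth_on_directional[OF model_basis chart(2)[OF c] CinfD[OF True c] \<xi>(1)]])
  qed
qed (simp add: vfield_off[OF X] Cinf_zero)

lemma vfield_algebra:
  assumes X: "X \<in> vfields G" and f: "f \<in> Cinf G" and h: "h \<in> Cinf G"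
  shows "X (f + h) = X f + X h" "X (f * h) = X f * h + f * X h"
proof -
  have "X (f + h) p = (X f + X h) p \<and> X (f * h) p = (X f * h + f * X h) p" for p
  proof -
    obtain U \<phi> where c: "(U, \<phi>) \<in> charts G" "p \<in> U" using chart_at .
    obtain \<xi> where \<xi>_rep: "field_rep X U \<phi> \<xi>" by (rule field_rep_exists[OF X c(1)])
    note \<xi> = field_repD(2)[OF \<xi>_rep]
    have p: "\<phi> p \<in> \<phi> ` U" "inv_into U \<phi> (\<phi> p) = p" using c chart(5) by auto
    note d = Cinf_derivative[OF f c(1) p(1)] Cinf_derivative[OF h c(1) p(1)]
    have "X (f + h) p = X f p + X h p"
      using \<xi>[OF Cinf_add[OF f h] p(1)] \<xi>[OF f p(1)] \<xi>[OF h p(1)]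
        frechet_derivative_eqI[OF has_derivative_add[OF d]] p(2) by simp
    moreover have "X (f * h) p = X f p * h p + f p * X h p"
      using \<xi>[OF Cinf_mult[OF f h] p(1)] \<xi>[OF f p(1)] \<xi>[OF h p(1)]
        frechet_derivative_eqI[OF has_derivative_mult[OF d]] p(2) by simp
    ultimately show ?thesis by simp
  qed
  then show "X (f + h) = X f + X h" "X (f * h) = X f * h + f * X h" by auto
qed

lemma vfield_const:
  assumes X: "X \<in> vfields G"
  shows "X (const c) = 0"
proof -
  have "X (const c) p = 0" for p
  proof -
    obtain U \<phi> where u: "(U, \<phi>) \<in> charts G" "p \<in> U" using chart_at .
    obtain \<xi> where \<xi>_rep: "field_rep X U \<phi> \<xi>" by (rule field_rep_exists[OF X u(1)])
    note \<xi> = field_repD(2)[OF \<xi>_rep]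
    have "X (const c) (inv_into U \<phi> (\<phi> p)) = 0"
      using \<xi>[OF Cinf_const imageI[OF u(2)], of c] by (simp add: const_def)
    then show ?thesis by (simp add: chart(5)[OF u])
  qed
  then show ?thesis by auto
qed

lemma vfield_scale:
  assumes X: "X \<in> vfields G" and f: "f \<in> Cinf G"
  shows "X (\<lambda>x. c * f x) = (\<lambda>p. c * X f p)"
  using vfield_algebra(2)[OF X Cinf_const f] vfield_const[OF X]
  by (simp add: const_def times_fun_def plus_fun_def zero_fun_def)

lemma vfield_zero: "X \<in> vfields G \<Longrightarrow> X 0 = 0"
  using vfield_const[of X 0] by (simp add: const_def zero_fun_def)

lemma vfield_sum:
  assumes X: "X \<in> vfields G" and "\<And>i. i \<in> I \<Longrightarrow> f i \<in> Cinf G"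
  shows "X (sum f I) = (\<Sum>i\<in>I. X (f i))"
  using assms(2)
  by (induction I rule: infinite_finite_induct) (auto simp: vfield_zero[OF X] vfield_algebra(1)[OF X] Cinf_sum)

definition op_fst :: "'g vfield \<Rightarrow> ('g \<times> 'g \<Rightarrow> real) \<Rightarrow> 'g \<times> 'g \<Rightarrow> real" where
  "op_fst X F = (\<lambda>z. X (\<lambda>x. F (x, snd z)) (fst z))"

definition op_snd :: "'g vfield \<Rightarrow> ('g \<times> 'g \<Rightarrow> real) \<Rightarrow> 'g \<times> 'g \<Rightarrow> real" where
  "op_snd X F = (\<lambda>z. X (\<lambda>y. F (fst z, y)) (snd z))"

lemma op_snd_swap: "op_snd X F = (\<lambda>z. op_fst X (\<lambda>z. F (snd z, fst z)) (snd z, fst z))"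
  by (simp add: op_snd_def op_fst_def)

lemma partial_derivative:
  assumes "(F has_derivative F') (at (u, v))"
  shows "frechet_derivative (\<lambda>u. F (u, v)) (at u) w = F' (w, 0)"
    and "frechet_derivative (\<lambda>v. F (u, v)) (at v) w = F' (0, w)"
proof -
  have "((\<lambda>u. (u, v)) has_derivative (\<lambda>w. (w, 0))) (at u)" by (auto intro!: derivative_eq_intros)
  from frechet_derivative_eqI[OF has_derivative_compose[OF this assms]]
  show "frechet_derivative (\<lambda>u. F (u, v)) (at u) w = F' (w, 0)" by simp
  have "((\<lambda>v. (u, v)) has_derivative (\<lambda>w. (0, w))) (at v)" by (auto intro!: derivative_eq_intros)
  from frechet_derivative_eqI[OF has_derivative_compose[OF this assms]]
  show "frechet_derivative (\<lambda>v. F (u, v)) (at v) w = F' (0, w)" by simp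
qed

lemma op_chart:
  assumes F: "smooth2 F" and c: "(U, \<phi>) \<in> charts G" "(V, \<psi>) \<in> charts G"
    and u: "u \<in> \<phi> ` U" and v: "v \<in> \<psi> ` V"
  defines "F' \<equiv> frechet_derivative (\<lambda>z. F (inv_into U \<phi> (fst z), inv_into V \<psi> (snd z))) (at (u, v))"
  shows "field_rep X U \<phi> \<xi> \<Longrightarrow> op_fst X F (inv_into U \<phi> u, inv_into V \<psi> v) = F' (\<xi> u, 0)"
    and "field_rep Y V \<psi> \<eta> \<Longrightarrow> op_snd Y F (inv_into U \<phi> u, inv_into V \<psi> v) = F' (0, \<eta> v)"
proof -
  have d: "((\<lambda>z. F (inv_into U \<phi> (fst z), inv_into V \<psi> (snd z))) has_derivative F') (at (u, v))"
    unfolding F'_def using u v by (intro smooth_on_has_derivative[OF smooth2D[OF F c]]) auto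
  show "op_fst X F (inv_into U \<phi> u, inv_into V \<psi> v) = F' (\<xi> u, 0)" if "field_rep X U \<phi> \<xi>"
    using field_repD(2)[OF that smooth2_slice_fst[OF F] u] partial_derivative(1)[OF d] by (simp add: op_fst_def)
  show "op_snd Y F (inv_into U \<phi> u, inv_into V \<psi> v) = F' (0, \<eta> v)" if "field_rep Y V \<psi> \<eta>"
    using field_repD(2)[OF that smooth2_slice_snd[OF F] v] partial_derivative(2)[OF d] by (simp add: op_snd_def)
qed

lemma smooth2_op_fst:
  assumes X: "X \<in> vfields G" and F: "smooth2 F"
  shows "smooth2 (op_fst X F)"
proof (rule smooth2I)
  fix U \<phi> V \<psi> assume c: "(U, \<phi>) \<in> charts G" "(V, \<psi>) \<in> charts G"
  let ?F = "\<lambda>z. F (inv_into U \<phi> (fst z), inv_into V \<psi> (snd z))"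
  let ?S = "\<phi> ` U \<times> \<psi> ` V"
  have o: "open ?S" using chart(2) c by (simp add: open_Times)
  obtain \<xi> where \<xi>_rep: "field_rep X U \<phi> \<xi>" by (rule field_rep_exists[OF X c(1)])
  note \<xi> = field_repD[OF \<xi>_rep]
  have "smooth_on ?S (\<lambda>z. \<xi> (fst z))"
    by (rule smooth_on_compose[OF model_basis o smooth_on_bounded_linear[OF bounded_linear_fst o smooth_on_ident[OF o]] \<xi>(1)]) auto
  then have "smooth_on ?S (\<lambda>z. (\<xi> (fst z), 0))" by (intro smooth_on_Pair o smooth_on_const)
  from smooth_on_directional[OF model_basis2 o smooth2D[OF F c] this]
  show "smooth_on ?S (\<lambda>z. op_fst X F (inv_into U \<phi> (fst z), inv_into V \<psi> (snd z)))"
  proof (rule smooth_on_cong[THEN iffD2, OF o, rotated])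
    fix z :: "'a \<times> 'a" assume "z \<in> ?S"
    then show "op_fst X F (inv_into U \<phi> (fst z), inv_into V \<psi> (snd z)) =
        frechet_derivative ?F (at z) (\<xi> (fst z), 0)"
      using op_chart(1)[OF F c _ _ \<xi>_rep, of "fst z" "snd z"] by auto
  qed
qed

lemma smooth2_op_snd:
  assumes X: "X \<in> vfields G" and F: "smooth2 F"
  shows "smooth2 (op_snd X F)"
  using smooth2_swap[OF smooth2_op_fst[OF X smooth2_swap[OF F]]] by (simp add: op_snd_swap)

text \<open>In charts the operators differentiate along (\<xi> u, 0) and (0, \<eta> v). Each
  coefficient depends on its own variable only, so it is a constant direction while the other
  operator acts, and symmetry of second derivatives applies.\<close>

lemma op_commute:
  assumes X: "X \<in> vfields G" and Y: "Y \<in> vfields G" and F: "smooth2 F"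
  shows "op_fst X (op_snd Y F) = op_snd Y (op_fst X F)"
proof
  fix p :: "'g \<times> 'g"
  obtain U \<phi> where c1: "(U, \<phi>) \<in> charts G" "fst p \<in> U" using chart_at .
  obtain V \<psi> where c2: "(V, \<psi>) \<in> charts G" "snd p \<in> V" using chart_at .
  let ?F = "\<lambda>z. F (inv_into U \<phi> (fst z), inv_into V \<psi> (snd z))"
  let ?S = "\<phi> ` U \<times> \<psi> ` V"
  have o: "open ?S" using chart(2) c1 c2 by (simp add: open_Times)
  obtain \<xi> where \<xi>_rep: "field_rep X U \<phi> \<xi>" by (rule field_rep_exists[OF X c1(1)])
  note \<xi> = field_repD(2)[OF \<xi>_rep]
  obtain \<eta> where \<eta>_rep: "field_rep Y V \<psi> \<eta>" by (rule field_rep_exists[OF Y c2(1)])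
  note \<eta> = field_repD(2)[OF \<eta>_rep]
  define u v where "u = \<phi> (fst p)" and "v = \<psi> (snd p)"
  have uv: "u \<in> \<phi> ` U" "v \<in> \<psi> ` V" "(u, v) \<in> ?S" using c1 c2 by (auto simp: u_def v_def)
  have p: "p = (inv_into U \<phi> u, inv_into V \<psi> v)"
    using chart(5)[OF c1] chart(5)[OF c2] by (simp add: u_def v_def)
  note sF = smooth2D[OF F c1(1) c2(1)]
  let ?D = "\<lambda>w z. frechet_derivative ?F (at z) w"
  have dD: "(?D w has_derivative frechet_derivative (?D w) (at (u, v))) (at (u, v))" for w
    by (rule smooth_on_has_derivative[OF smooth_on_derivative[OF sF] uv(3)])
  have 1: "op_fst X (op_snd Y F) p = frechet_derivative (?D (0, \<eta> v)) (at (u, v)) (\<xi> u, 0)"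
  proof -
    have sm: "(\<lambda>x. op_snd Y F (x, inv_into V \<psi> v)) \<in> Cinf G"
      by (rule smooth2_slice_fst[OF smooth2_op_snd[OF Y F]])
    have eq: "op_snd Y F (inv_into U \<phi> u', inv_into V \<psi> v) = ?D (0, \<eta> v) (u', v)" if "u' \<in> \<phi> ` U" for u'
      using op_chart(2)[OF F c1(1) c2(1) that uv(2) \<eta>_rep] by simp
    have "op_fst X (op_snd Y F) p =
        frechet_derivative (\<lambda>u'. op_snd Y F (inv_into U \<phi> u', inv_into V \<psi> v)) (at u) (\<xi> u)"
      using \<xi>[OF sm uv(1)] by (simp add: op_fst_def p)
    also have "\<dots> = frechet_derivative (\<lambda>u'. ?D (0, \<eta> v) (u', v)) (at u) (\<xi> u)"
      by (subst frechet_derivative_cong_open[OF chart(2)[OF c1(1)] uv(1) eq]) auto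
    also have "\<dots> = frechet_derivative (?D (0, \<eta> v)) (at (u, v)) (\<xi> u, 0)"
      by (rule partial_derivative(1)[OF dD])
    finally show ?thesis .
  qed
  have 2: "op_snd Y (op_fst X F) p = frechet_derivative (?D (\<xi> u, 0)) (at (u, v)) (0, \<eta> v)"
  proof -
    have sm: "(\<lambda>y. op_fst X F (inv_into U \<phi> u, y)) \<in> Cinf G"
      by (rule smooth2_slice_snd[OF smooth2_op_fst[OF X F]])
    have eq: "op_fst X F (inv_into U \<phi> u, inv_into V \<psi> v') = ?D (\<xi> u, 0) (u, v')" if "v' \<in> \<psi> ` V" for v'
      using op_chart(1)[OF F c1(1) c2(1) uv(1) that \<xi>_rep] by simp
    have "op_snd Y (op_fst X F) p =
        frechet_derivative (\<lambda>v'. op_fst X F (inv_into U \<phi> u, inv_into V \<psi> v')) (at v) (\<eta> v)"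
      using \<eta>[OF sm uv(2)] by (simp add: op_snd_def p)
    also have "\<dots> = frechet_derivative (\<lambda>v'. ?D (\<xi> u, 0) (u, v')) (at v) (\<eta> v)"
      by (subst frechet_derivative_cong_open[OF chart(2)[OF c2(1)] uv(2) eq]) auto
    also have "\<dots> = frechet_derivative (?D (\<xi> u, 0)) (at (u, v)) (0, \<eta> v)"
      by (rule partial_derivative(2)[OF dD])
    finally show ?thesis .
  qed
  show "op_fst X (op_snd Y F) p = op_snd Y (op_fst X F) p"
    unfolding 1 2 by (rule symmetric_second_derivative[OF o sF uv(3)])
qed

text \<open>The diagonal has velocity (\<xi>, \<xi>) = (\<xi>, 0) + (0, \<xi>). This is the product
  rule for expressions in which the group element occurs twice.\<close>

lemma vfield_diagonal:
  assumes X: "X \<in> vfields G" and F: "smooth2 F"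
  shows "X (\<lambda>x. F (x, x)) p = op_fst X F (p, p) + op_snd X F (p, p)"
proof -
  obtain U \<phi> where c: "(U, \<phi>) \<in> charts G" "p \<in> U" using chart_at .
  obtain \<xi> where \<xi>_rep: "field_rep X U \<phi> \<xi>" by (rule field_rep_exists[OF X c(1)])
  note \<xi> = field_repD(2)[OF \<xi>_rep]
  let ?F = "\<lambda>z. F (inv_into U \<phi> (fst z), inv_into U \<phi> (snd z))"
  define u where "u = \<phi> p"
  have u: "u \<in> \<phi> ` U" "inv_into U \<phi> u = p" using c chart(5)[OF c] by (auto simp: u_def)
  have dF: "(?F has_derivative frechet_derivative ?F (at (u, u))) (at (u, u))"
    using u by (intro smooth_on_has_derivative[OF smooth2D[OF F c(1) c(1)]]) auto
  have "((\<lambda>u. (u, u)) has_derivative (\<lambda>w. (w, w))) (at u)" by (auto intro!: derivative_eq_intros)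
  from frechet_derivative_eqI[OF has_derivative_compose[OF this dF]]
  have "X (\<lambda>x. F (x, x)) p = frechet_derivative ?F (at (u, u)) (\<xi> u, \<xi> u)"
    using \<xi>[OF smooth2_diagonal[OF F] u(1)] u(2) by simp
  also have "(\<xi> u, \<xi> u) = (\<xi> u, 0) + (0, \<xi> u)" by simp
  also have "frechet_derivative ?F (at (u, u)) ((\<xi> u, 0) + (0, \<xi> u)) =
      frechet_derivative ?F (at (u, u)) (\<xi> u, 0) + frechet_derivative ?F (at (u, u)) (0, \<xi> u)"
    by (rule linear_add[OF has_derivative_linear[OF dF]])
  finally show ?thesis
    using op_chart(1)[OF F c(1) c(1) u(1) u(1) \<xi>_rep] op_chart(2)[OF F c(1) c(1) u(1) u(1) \<xi>_rep] u(2) by simp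
qed

subsection \<open>Tangent vectors as functionals\<close>

text \<open>Tangent vectors are functionals that some chart around the point displays as a
  directional derivative. Leaving the chart existential allows it to change under translations; only
  values on smooth functions matter.\<close>

definition tangent :: "'g \<Rightarrow> (('g \<Rightarrow> real) \<Rightarrow> real) \<Rightarrow> bool" where
  "tangent p L \<longleftrightarrow> (\<exists>U \<phi> v. (U, \<phi>) \<in> charts G \<and> p \<in> U \<and>
     (\<forall>f\<in>Cinf G. L f = frechet_derivative (\<lambda>u. f (inv_into U \<phi> u)) (at (\<phi> p)) v))"

lemma vfield_tangent:
  assumes X: "X \<in> vfields G"
  shows "tangent p (\<lambda>f. X f p)"
proof -
  obtain U \<phi> where c: "(U, \<phi>) \<in> charts G" "p \<in> U" using chart_at .
  obtain \<xi> where \<xi>_rep: "field_rep X U \<phi> \<xi>" by (rule field_rep_exists[OF X c(1)])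
  note \<xi> = field_repD(2)[OF \<xi>_rep]
  have "X f p = frechet_derivative (\<lambda>u. f (inv_into U \<phi> u)) (at (\<phi> p)) (\<xi> (\<phi> p))" if "f \<in> Cinf G" for f
    using \<xi>[OF that, of "\<phi> p"] c chart(5)[OF c] by auto
  then show ?thesis unfolding tangent_def using c by blast
qed

lemma tangent_push:
  assumes L: "tangent p L" and \<alpha>: "\<alpha> = (\<lambda>x. g \<otimes> x) \<or> \<alpha> = (\<lambda>x. x \<otimes> g)"
  shows "tangent (\<alpha> p) (\<lambda>f. L (\<lambda>x. f (\<alpha> x)))"
proof -
  obtain U \<phi> v where c: "(U, \<phi>) \<in> charts G" "p \<in> U" and
    L: "\<And>f. f \<in> Cinf G \<Longrightarrow> L f = frechet_derivative (\<lambda>u. f (inv_into U \<phi> u)) (at (\<phi> p)) v"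
    using L unfolding tangent_def by blast
  obtain V \<psi> where d: "(V, \<psi>) \<in> charts G" "g \<in> V" using chart_at .
  obtain W \<theta> where w: "(W, \<theta>) \<in> charts G" "\<alpha> p \<in> W" using chart_at .
  have p: "\<phi> p \<in> \<phi> ` U" "inv_into U \<phi> (\<phi> p) = p" and g: "\<psi> g \<in> \<psi> ` V" "inv_into V \<psi> (\<psi> g) = g"
    using c d chart(5) by auto
  \<comment> \<open>The two kinds of translation differ only here: their coordinate expression is
    multiplication in charts with one of the two variables frozen at \<open>g\<close>. Afterwards
    the chain rule sends \<open>v\<close> to \<open>s v\<close>.\<close>
  have "\<exists>S s. open S \<and> \<phi> p \<in> S \<and> S \<subseteq> \<phi> ` U \<and> (\<forall>u\<in>S. \<alpha> (inv_into U \<phi> u) \<in> W) \<and>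
      ((\<lambda>u. \<theta> (\<alpha> (inv_into U \<phi> u))) has_derivative s) (at (\<phi> p))"
    using \<alpha>
  proof
    assume \<alpha>: "\<alpha> = (\<lambda>x. g \<otimes> x)"
    let ?T = "mult_dom V \<psi> U \<phi> W" and ?M = "mult_chart V \<psi> U \<phi> \<theta>"
    have T: "open ?T" "(\<psi> g, \<phi> p) \<in> ?T"
      using open_mult_dom[OF d(1) c(1) chart(1)[OF w(1)]] p g w \<alpha> by (auto simp: mult_dom_def)
    have "open ((\<lambda>u. (\<psi> g, u)) -` ?T)" by (intro open_vimage T continuous_intros)
    moreover have "((\<lambda>u. (\<psi> g, u)) has_derivative (\<lambda>w. (0, w))) (at (\<phi> p))"
      by (auto intro!: derivative_eq_intros)
    note has_derivative_compose[OF this smooth_on_has_derivative[OF smooth_mult_chart[OF d(1) c(1) w(1)] T(2)]]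
    ultimately show ?thesis
      using T(2) g by (intro exI[of _ "(\<lambda>u. (\<psi> g, u)) -` ?T"]) (auto simp: mult_dom_def mult_chart_def \<alpha>)
  next
    assume \<alpha>: "\<alpha> = (\<lambda>x. x \<otimes> g)"
    let ?T = "mult_dom U \<phi> V \<psi> W" and ?M = "mult_chart U \<phi> V \<psi> \<theta>"
    have T: "open ?T" "(\<phi> p, \<psi> g) \<in> ?T"
      using open_mult_dom[OF c(1) d(1) chart(1)[OF w(1)]] p g w \<alpha> by (auto simp: mult_dom_def)
    have "open ((\<lambda>u. (u, \<psi> g)) -` ?T)" by (intro open_vimage T continuous_intros)
    moreover have "((\<lambda>u. (u, \<psi> g)) has_derivative (\<lambda>w. (w, 0))) (at (\<phi> p))"
      by (auto intro!: derivative_eq_intros)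
    note has_derivative_compose[OF this smooth_on_has_derivative[OF smooth_mult_chart[OF c(1) d(1) w(1)] T(2)]]
    ultimately show ?thesis
      using T(2) g by (intro exI[of _ "(\<lambda>u. (u, \<psi> g)) -` ?T"]) (auto simp: mult_dom_def mult_chart_def \<alpha>)
  qed
  then obtain S s where S: "open S" "\<phi> p \<in> S" "S \<subseteq> \<phi> ` U" "\<And>u. u \<in> S \<Longrightarrow> \<alpha> (inv_into U \<phi> u) \<in> W"
    "((\<lambda>u. \<theta> (\<alpha> (inv_into U \<phi> u))) has_derivative s) (at (\<phi> p))" by blast
  have "L (\<lambda>x. f (\<alpha> x)) = frechet_derivative (\<lambda>u. f (inv_into W \<theta> u)) (at (\<theta> (\<alpha> p))) (s v)"
    if f: "f \<in> Cinf G" for f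
  proof -
    have f\<alpha>: "(\<lambda>x. f (\<alpha> x)) \<in> Cinf G" using \<alpha> Cinf_translate[OF f] by auto
    have "\<theta> (\<alpha> (inv_into U \<phi> (\<phi> p))) \<in> \<theta> ` W" using S by auto
    from has_derivative_compose[OF S(5) Cinf_derivative[OF f w(1) this]]
    have "((\<lambda>u. f (inv_into W \<theta> (\<theta> (\<alpha> (inv_into U \<phi> u))))) has_derivative
        (\<lambda>v. frechet_derivative (\<lambda>u. f (inv_into W \<theta> u)) (at (\<theta> (\<alpha> p))) (s v))) (at (\<phi> p))"
      using p by simp
    from has_derivative_transform_within_open[OF this S(1,2)]
    have "((\<lambda>u. f (\<alpha> (inv_into U \<phi> u))) has_derivative
        (\<lambda>v. frechet_derivative (\<lambda>u. f (inv_into W \<theta> u)) (at (\<theta> (\<alpha> p))) (s v))) (at (\<phi> p))"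
      using S(4) chart(5)[OF w(1)] by auto
    from frechet_derivative_eqI[OF this] show ?thesis using L[OF f\<alpha>] by simp
  qed
  then show ?thesis unfolding tangent_def using w by blast
qed

text \<open>Every directional derivative in a chart is a tangent vector, so the coordinate
  expression has zero derivative on a ball and \<open>f\<close> is locally constant.\<close>

lemma constant_if_tangent_zero:
  assumes conn: "connected (UNIV :: 'g set)" and f: "f \<in> Cinf G"
    and zero: "\<And>p L. tangent p L \<Longrightarrow> L f = 0"
  shows "f p = f q"
proof -
  have loc: "\<exists>N. open N \<and> p \<in> N \<and> (\<forall>x\<in>N. f x = f p)" for p
  proof -
    obtain U \<phi> where c: "(U, \<phi>) \<in> charts G" "p \<in> U" using chart_at .
    obtain r where r: "r > 0" "ball (\<phi> p) r \<subseteq> \<phi> ` U"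
      using chart(2)[OF c(1)] c(2) open_contains_ball by blast
    define N where "N = U \<inter> \<phi> -` ball (\<phi> p) r"
    have "open N" unfolding N_def by (intro continuous_open_preimage chart(1,3)[OF c(1)] open_ball)
    moreover have "p \<in> N" using c r by (simp add: N_def)
    moreover have "f x = f p" if x: "x \<in> N" for x
    proof -
      have d0: "((\<lambda>u. f (inv_into U \<phi> u)) has_derivative (\<lambda>v. 0)) (at u)" if u: "u \<in> \<phi> ` U" for u
      proof -
        have "frechet_derivative (\<lambda>u. f (inv_into U \<phi> u)) (at u) v = 0" for v
        proof -
          have "tangent (inv_into U \<phi> u) (\<lambda>f. frechet_derivative (\<lambda>u. f (inv_into U \<phi> u)) (at u) v)"
            unfolding tangent_def using c(1) chart(6,7)[OF c(1) u] by metis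
          from zero[OF this] show ?thesis .
        qed
        then have "frechet_derivative (\<lambda>u. f (inv_into U \<phi> u)) (at u) = (\<lambda>v. 0)" by auto
        then show ?thesis using Cinf_derivative[OF f c(1) u] by simp
      qed
      have "f (inv_into U \<phi> (\<phi> x)) = f (inv_into U \<phi> (\<phi> p))"
      proof (rule has_derivative_zero_unique[where s = "ball (\<phi> p) r" and f = "\<lambda>u. f (inv_into U \<phi> u)"])
        show "((\<lambda>u. f (inv_into U \<phi> u)) has_derivative (\<lambda>v. 0)) (at u within ball (\<phi> p) r)"
          if "u \<in> ball (\<phi> p) r" for u
          using d0 that r has_derivative_at_withinI by blast
      qed (use x r in \<open>auto simp: N_def\<close>)
      then show ?thesis using x c chart(5)[OF c(1)] by (simp add: N_def)
    qed
    ultimately show ?thesis by blast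
  qed
  have "f constant_on UNIV"
  proof (rule locally_constant_imp_constant[OF conn])
    show "\<exists>T. openin (top_of_set UNIV) T \<and> a \<in> T \<and> (\<forall>x\<in>T. f x = f a)" for a
      using loc[of a] by auto
  qed
  then show ?thesis by (auto simp: constant_on_def)
qed

end

section \<open>Left-invariant frames, the adjoint action and the Lie bracket\<close>

lemma fscale_apply: "(a \<cdot> T) x = a * T x"
  by (simp add: fscale_def)

lemma sum_fun_apply: "(\<Sum>i\<in>I. f i) x = (\<Sum>i\<in>I. f i x)"
  by (induction I rule: infinite_finite_induct) auto

context lie_group
begin

lemma vfield_add:
  assumes X: "X \<in> vfields G" and Y: "Y \<in> vfields G"
  shows "X + Y \<in> vfields G"
proof (rule vfieldI)
  show "(X + Y) f = 0" if "f \<notin> Cinf G" for f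
    using vfield_off[OF X that] vfield_off[OF Y that] by simp
next
  fix U \<phi> assume c: "(U, \<phi>) \<in> charts G"
  obtain \<xi> where \<xi>_rep: "field_rep X U \<phi> \<xi>" by (rule field_rep_exists[OF X c])
  note \<xi> = field_repD(2)[OF \<xi>_rep]
  obtain \<eta> where \<eta>_rep: "field_rep Y U \<phi> \<eta>" by (rule field_rep_exists[OF Y c])
  note \<eta> = field_repD(2)[OF \<eta>_rep]
  have "smooth_on (\<phi> ` U) (\<lambda>u. \<xi> u + \<eta> u)"
    by (intro smooth_on_add chart(2)[OF c] field_repD(1)[OF \<xi>_rep] field_repD(1)[OF \<eta>_rep])
  moreover have "(X + Y) f p = frechet_derivative (\<lambda>u. f (inv_into U \<phi> u)) (at (\<phi> p)) (\<xi> (\<phi> p) + \<eta> (\<phi> p))"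
    if "f \<in> Cinf G" "p \<in> U" for f p
  proof -
    have p: "\<phi> p \<in> \<phi> ` U" using that by simp
    show ?thesis
      using \<xi>[OF that(1) p] \<eta>[OF that(1) p] chart(5)[OF c that(2)]
        linear_add[OF has_derivative_linear[OF Cinf_derivative[OF that(1) c p]]] by simp
  qed
  ultimately show "\<exists>\<xi>. smooth_on (\<phi> ` U) \<xi> \<and> (\<forall>f\<in>Cinf G. \<forall>p\<in>U.
      (X + Y) f p = frechet_derivative (\<lambda>u. f (inv_into U \<phi> u)) (at (\<phi> p)) (\<xi> (\<phi> p)))"
    by (intro exI[of _ "\<lambda>u. \<xi> u + \<eta> u"]) simp
qed

lemma vfield_fscale:
  assumes a: "a \<in> Cinf G" and X: "X \<in> vfields G"
  shows "a \<cdot> X \<in> vfields G"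
proof (rule vfieldI)
  show "(a \<cdot> X) f = 0" if "f \<notin> Cinf G" for f
    using vfield_off[OF X that] by (simp add: fscale_def)
next
  fix U \<phi> assume c: "(U, \<phi>) \<in> charts G"
  obtain \<xi> where \<xi>_rep: "field_rep X U \<phi> \<xi>" by (rule field_rep_exists[OF X c])
  note \<xi> = field_repD(2)[OF \<xi>_rep]
  have "smooth_on (\<phi> ` U) (\<lambda>u. a (inv_into U \<phi> u) *\<^sub>R \<xi> u)"
    by (intro smooth_on_scaleR chart(2)[OF c] CinfD[OF a c] field_repD(1)[OF \<xi>_rep])
  moreover have "(a \<cdot> X) f p = frechet_derivative (\<lambda>u. f (inv_into U \<phi> u)) (at (\<phi> p))
      (a (inv_into U \<phi> (\<phi> p)) *\<^sub>R \<xi> (\<phi> p))"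
    if "f \<in> Cinf G" "p \<in> U" for f p
  proof -
    have p: "\<phi> p \<in> \<phi> ` U" using that by simp
    show ?thesis
      using \<xi>[OF that(1) p] chart(5)[OF c that(2)]
        linear_scale[OF has_derivative_linear[OF Cinf_derivative[OF that(1) c p]]]
      by (simp add: fscale_def)
  qed
  ultimately show "\<exists>\<xi>. smooth_on (\<phi> ` U) \<xi> \<and> (\<forall>f\<in>Cinf G. \<forall>p\<in>U.
      (a \<cdot> X) f p = frechet_derivative (\<lambda>u. f (inv_into U \<phi> u)) (at (\<phi> p)) (\<xi> (\<phi> p)))"
    by (intro exI[of _ "\<lambda>u. a (inv_into U \<phi> u) *\<^sub>R \<xi> u"]) simp
qed

lemma vfield_0: "0 \<in> vfields G"
proof (rule vfieldI)
  fix U \<phi> assume c: "(U, \<phi>) \<in> charts G"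
  have "0 f p = frechet_derivative (\<lambda>u. f (inv_into U \<phi> u)) (at (\<phi> p)) 0"
    if "f \<in> Cinf G" "p \<in> U" for f p
    using linear_0[OF has_derivative_linear[OF Cinf_derivative[OF that(1) c imageI[OF that(2)]]]] by simp
  then show "\<exists>\<xi>. smooth_on (\<phi> ` U) \<xi> \<and> (\<forall>f\<in>Cinf G. \<forall>p\<in>U.
      0 f p = frechet_derivative (\<lambda>u. f (inv_into U \<phi> u)) (at (\<phi> p)) (\<xi> (\<phi> p)))"
    by (intro exI[of _ "\<lambda>u. 0"]) (simp add: smooth_on_const chart(2)[OF c])
qed simp

lemma vfield_sum_closed: "(\<And>i. i \<in> I \<Longrightarrow> X i \<in> vfields G) \<Longrightarrow> sum X I \<in> vfields G"
  by (induction I rule: infinite_finite_induct) (auto intro: vfield_0 vfield_add)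

section \<open>Translations and left-invariant extension of tangent vectors\<close>

lemma tangent_ltrans: "tangent p L \<Longrightarrow> tangent (g \<otimes> p) (\<lambda>f. L (\<lambda>x. f (g \<otimes> x)))"
  using tangent_push[where \<alpha> = "\<lambda>x. g \<otimes> x" and g = g] by simp

lemma tangent_rtrans: "tangent p L \<Longrightarrow> tangent (p \<otimes> g) (\<lambda>f. L (\<lambda>x. f (x \<otimes> g)))"
  using tangent_push[where \<alpha> = "\<lambda>x. x \<otimes> g" and g = g] by simp

lemma inv_into_ltrans: "inv_into UNIV (ltrans G g) = (\<lambda>h. inv g \<otimes> h)"
  by (intro ext inv_into_f_eq) (auto simp: ltrans_def inj_on_def m_assoc[symmetric])

lemma inv_into_rtrans: "inv_into UNIV (rtrans G g) = (\<lambda>h. h \<otimes> inv g)"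
  by (intro ext inv_into_f_eq) (auto simp: rtrans_def inj_on_def m_assoc)

lemma inv_into_conj_by: "inv_into UNIV (conj_by G g) = (\<lambda>h. inv g \<otimes> h \<otimes> g)"
proof (intro ext inv_into_f_eq)
  show "inj (conj_by G g)" by (auto simp: conj_by_def inj_on_def)
  show "conj_by G g (inv g \<otimes> h \<otimes> g) = h" for h
    by (simp add: conj_by_def m_assoc) (simp add: m_assoc[symmetric])
qed simp

lemma push_field_ltrans:
  "f \<in> Cinf G \<Longrightarrow> push_field G (ltrans G g) X f p = X (\<lambda>h. f (g \<otimes> h)) (inv g \<otimes> p)"
  unfolding push_field_def inv_into_ltrans by (simp add: ltrans_def o_def)

lemma push_field_rtrans:
  "f \<in> Cinf G \<Longrightarrow> push_field G (rtrans G g) X f p = X (\<lambda>h. f (h \<otimes> g)) (p \<otimes> inv g)"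
  unfolding push_field_def inv_into_rtrans by (simp add: rtrans_def o_def)

lemma push_field_conj_by:
  "f \<in> Cinf G \<Longrightarrow> push_field G (conj_by G g) X f p = X (\<lambda>h. f (g \<otimes> h \<otimes> inv g)) (inv g \<otimes> p \<otimes> g)"
  unfolding push_field_def inv_into_conj_by by (simp add: conj_by_def o_def)

text \<open>Left invariance is built into the formula; the content is smoothness. It comes from
  smoothness of multiplication, because the coefficients in a chart are a derivative of the product
  in its second variable at the identity.\<close>

lemma left_invariant_extension:
  assumes L: "tangent \<one> L"
  defines "X \<equiv> \<lambda>f. if f \<in> Cinf G then (\<lambda>p. L (\<lambda>h. f (p \<otimes> h))) else 0"
  shows "X \<in> left_inv_fields G"
proof -
  obtain V \<psi> v where d: "(V, \<psi>) \<in> charts G" "\<one> \<in> V" and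
    L: "\<And>f. f \<in> Cinf G \<Longrightarrow> L f = frechet_derivative (\<lambda>u. f (inv_into V \<psi> u)) (at (\<psi> \<one>)) v"
    using L unfolding tangent_def by blast
  have "X \<in> vfields G"
  proof (rule vfieldI)
    fix U \<phi> assume c: "(U, \<phi>) \<in> charts G"
    let ?T = "mult_dom U \<phi> V \<psi> U" and ?M = "mult_chart U \<phi> V \<psi> \<phi>"
    \<comment> \<open>The chart around \<open>p\<close> can also serve as target, because p times
      the identity is p and nearby products remain in \<open>U\<close>.\<close>
    define \<xi> where "\<xi> u = frechet_derivative ?M (at (u, \<psi> \<one>)) (0, v)" for u
    note oT = open_mult_dom[OF c d(1) chart(1)[OF c]]
    note sM = smooth_mult_chart[OF c d(1) c]
    have T: "(u, \<psi> \<one>) \<in> ?T" if "u \<in> \<phi> ` U" for u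
      using that d chart(5)[OF d] chart(6)[OF c that] by (simp add: mult_dom_def)
    have "smooth_on (\<phi> ` U) (\<lambda>u. (u, \<psi> \<one>))"
      by (intro smooth_on_Pair smooth_on_ident smooth_on_const chart(2)[OF c])
    from smooth_on_compose[OF model_basis2 chart(2)[OF c] this smooth_on_derivative[OF sM]]
    have "smooth_on (\<phi> ` U) \<xi>" unfolding \<xi>_def using T by blast
    moreover have "X f p = frechet_derivative (\<lambda>u. f (inv_into U \<phi> u)) (at (\<phi> p)) (\<xi> (\<phi> p))"
      if f: "f \<in> Cinf G" and p: "p \<in> U" for f p
    proof -
      have p': "\<phi> p \<in> \<phi> ` U" "inv_into U \<phi> (\<phi> p) = p" using p chart(5)[OF c p] by auto
      have M1: "?M (\<phi> p, \<psi> \<one>) = \<phi> p" using p' chart(5)[OF d] by (simp add: mult_chart_def)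
      have "((\<lambda>w. (\<phi> p, w)) has_derivative (\<lambda>w. (0, w))) (at (\<psi> \<one>))"
        by (auto intro!: derivative_eq_intros)
      note M = has_derivative_compose[OF this smooth_on_has_derivative[OF sM T[OF p'(1)]]]
      have "((\<lambda>u. f (inv_into U \<phi> u)) has_derivative
          frechet_derivative (\<lambda>u. f (inv_into U \<phi> u)) (at (\<phi> p))) (at (?M (\<phi> p, \<psi> \<one>)))"
        using Cinf_derivative[OF f c p'(1)] M1 by simp
      from has_derivative_compose[OF M this]
      have "((\<lambda>w. f (inv_into U \<phi> (?M (\<phi> p, w)))) has_derivative
          (\<lambda>w. frechet_derivative (\<lambda>u. f (inv_into U \<phi> u)) (at (\<phi> p))
            (frechet_derivative ?M (at (\<phi> p, \<psi> \<one>)) (0, w)))) (at (\<psi> \<one>))" .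
      moreover have "open ((\<lambda>w. (\<phi> p, w)) -` ?T)" by (intro open_vimage oT continuous_intros)
      ultimately have "((\<lambda>w. f (p \<otimes> inv_into V \<psi> w)) has_derivative
          (\<lambda>w. frechet_derivative (\<lambda>u. f (inv_into U \<phi> u)) (at (\<phi> p))
            (frechet_derivative ?M (at (\<phi> p, \<psi> \<one>)) (0, w)))) (at (\<psi> \<one>))"
        by (rule has_derivative_transform_within_open)
          (use T[OF p'(1)] p'(2) in \<open>auto simp: mult_dom_def mult_chart_def chart(5)[OF c]\<close>)
      from frechet_derivative_eqI[OF this] show ?thesis
        using f L[OF Cinf_translate(1)[OF f]] by (simp add: X_def \<xi>_def)
    qed
    ultimately show "\<exists>\<xi>. smooth_on (\<phi> ` U) \<xi> \<and> (\<forall>f\<in>Cinf G. \<forall>p\<in>U.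
        X f p = frechet_derivative (\<lambda>u. f (inv_into U \<phi> u)) (at (\<phi> p)) (\<xi> (\<phi> p)))"
      by blast
  qed (simp add: X_def)
  moreover have "push_field G (ltrans G g) X = X" for g
  proof
    show "push_field G (ltrans G g) X f = X f" for f
    proof (cases "f \<in> Cinf G")
      case True
      then show ?thesis
        using Cinf_translate(1)[OF True, of g]
        by (simp add: fun_eq_iff push_field_ltrans X_def m_assoc[symmetric])
    qed (simp add: push_field_def X_def)
  qed
  ultimately show ?thesis by (simp add: left_inv_fields_def)
qed

end

context poisson_lie_group
begin

section \<open>The Lie algebra as tangent space at the identity\<close>

abbreviation lf :: "'v \<Rightarrow> 'g vfield" where "lf \<equiv> left_field G"

lemma lf_left_inv: "lf x \<in> left_inv_fields G"
  using left_field_bij by (auto simp: bij_betw_def)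

lemma lf_vfield: "lf x \<in> vfields G"
  using lf_left_inv by (auto simp: left_inv_fields_def)

lemmas lf_Cinf = vfield_Cinf[OF lf_vfield]
lemmas lf_off = vfield_off[OF lf_vfield]

lemma lf_translate:
  assumes f: "f \<in> Cinf G"
  shows "lf x (\<lambda>h. f (g \<otimes> h)) h = lf x f (g \<otimes> h)"
proof -
  have "push_field G (ltrans G g) (lf x) = lf x"
    using lf_left_inv by (auto simp: left_inv_fields_def)
  then have "push_field G (ltrans G g) (lf x) f (g \<otimes> h) = lf x f (g \<otimes> h)" by simp
  then show ?thesis
    using f by (simp add: push_field_ltrans m_assoc[symmetric])
qed

lemma lf_translate_fun: "f \<in> Cinf G \<Longrightarrow> lf x (\<lambda>h. f (g \<otimes> h)) = (\<lambda>h. lf x f (g \<otimes> h))"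
  by (rule ext) (rule lf_translate)

lemma lf_at: "f \<in> Cinf G \<Longrightarrow> lf x f g = lf x (\<lambda>h. f (g \<otimes> h)) \<one>"
  by (simp add: lf_translate)

lemma lf_inj: "lf x = lf y \<Longrightarrow> x = y"
  using left_field_bij by (auto simp: bij_betw_def inj_def)

lemma lf_eqI:
  assumes "\<And>f. f \<in> Cinf G \<Longrightarrow> lf x f \<one> = lf y f \<one>"
  shows "x = y"
proof (rule lf_inj, rule ext)
  fix f show "lf x f = lf y f"
  proof (cases "f \<in> Cinf G")
    case True
    show ?thesis
    proof
      fix g show "lf x f g = lf y f g"
        using assms[OF Cinf_translate(1)[OF True]] lf_at[OF True] by simp
    qed
  qed (simp add: lf_off)
qed

lemma lf_add: "lf (x + y) f p = lf x f p + lf y f p"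
  by (simp add: left_field_add)

lemma lf_scale: "lf (r *\<^sub>R x) f p = r * lf x f p"
  by (simp add: left_field_scale fscale_def const_def)

lemma lf_linear: "linear (\<lambda>x. lf x f p)"
  by (rule linearI) (simp_all add: lf_add lf_scale)

lemma lf_sum: "lf (sum x I) f p = (\<Sum>i\<in>I. lf (x i) f p)"
  using linear_sum[OF lf_linear] .

text \<open>\<open>left_field\<close> is onto the left-invariant fields, so the invariant extension
  of \<open>L\<close> has a preimage. New elements of the Lie algebra are constructed in this
  way.\<close>

lemma tangent_is_lf:
  assumes L: "tangent \<one> L"
  obtains x where "\<And>f. f \<in> Cinf G \<Longrightarrow> lf x f \<one> = L f"
proof -
  have "(\<lambda>f. if f \<in> Cinf G then (\<lambda>p. L (\<lambda>h. f (p \<otimes> h))) else 0) \<in> range lf"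
    using left_invariant_extension[OF L] left_field_bij unfolding bij_betw_def by simp
  then obtain x where x: "(\<lambda>f. if f \<in> Cinf G then (\<lambda>p. L (\<lambda>h. f (p \<otimes> h))) else 0) = lf x"
    by (rule rangeE)
  show ?thesis by (rule that[of x]) (simp flip: x)
qed

lemma constant_if_lf_zero:
  assumes conn: "connected (UNIV :: 'g set)" and f: "f \<in> Cinf G" and zero: "\<And>x p. lf x f p = 0"
  shows "f p = f q"
proof (rule constant_if_tangent_zero[OF conn f])
  fix p L assume L: "tangent p L"
  then have "tangent (inv p \<otimes> p) (\<lambda>f. L (\<lambda>x. f (inv p \<otimes> x)))" by (rule tangent_ltrans)
  then obtain x where x: "\<And>f. f \<in> Cinf G \<Longrightarrow> lf x f \<one> = L (\<lambda>x. f (inv p \<otimes> x))"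
    using tangent_is_lf by auto
  have "L f = lf x (\<lambda>h. f (p \<otimes> h)) \<one>"
    using x[OF Cinf_translate(1)[OF f]] by (simp add: m_assoc[symmetric])
  then show "L f = 0" using zero lf_at[OF f] by simp
qed

text \<open>Translating the tangent vector from \<open>p\<close> to the identity gives existence,
  translating the test functions back gives uniqueness. Hence the description by \<open>THE\<close>
  in \<open>maurer_cartan\<close> is meaningful.\<close>

lemma maurer_cartan_ex:
  assumes X: "X \<in> vfields G"
  shows "\<exists>!x. \<forall>f\<in>Cinf G. X f p = lf x f p"
proof -
  have "tangent (inv p \<otimes> p) (\<lambda>f. X (\<lambda>x. f (inv p \<otimes> x)) p)"
    by (rule tangent_ltrans[OF vfield_tangent[OF X]])
  then obtain x where x: "\<And>f. f \<in> Cinf G \<Longrightarrow> lf x f \<one> = X (\<lambda>x. f (inv p \<otimes> x)) p"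
    using tangent_is_lf by auto
  have "X f p = lf x f p" if f: "f \<in> Cinf G" for f
    using x[OF Cinf_translate(1)[OF f]] lf_at[OF f] by (simp add: m_assoc[symmetric])
  moreover have "x = y" if "\<forall>f\<in>Cinf G. lf x f p = lf y f p" for x y
  proof (rule lf_eqI)
    fix f assume f: "f \<in> Cinf G"
    show "lf x f \<one> = lf y f \<one>"
      using bspec[OF that Cinf_translate(1)[OF f, of "inv p"]]
        lf_translate[OF f, of x "inv p" p] lf_translate[OF f, of y "inv p" p] by simp
  qed
  ultimately show ?thesis by metis
qed

abbreviation mc :: "'g vfield \<Rightarrow> 'g \<Rightarrow> 'v" where "mc \<equiv> maurer_cartan G"

lemma mc_apply: "X \<in> vfields G \<Longrightarrow> f \<in> Cinf G \<Longrightarrow> lf (mc X p) f p = X f p"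
  using theI'[OF maurer_cartan_ex[of X p]] unfolding maurer_cartan_def by simp

lemma mc_eqI: "X \<in> vfields G \<Longrightarrow> (\<And>f. f \<in> Cinf G \<Longrightarrow> X f p = lf x f p) \<Longrightarrow> mc X p = x"
  unfolding maurer_cartan_def using maurer_cartan_ex[of X p] by (intro the1_equality) auto

lemma mc_lf: "mc (lf x) p = x"
  by (rule mc_eqI[OF lf_vfield]) simp

lemma mc_add: "X \<in> vfields G \<Longrightarrow> Y \<in> vfields G \<Longrightarrow> mc (X + Y) p = mc X p + mc Y p"
  by (rule mc_eqI) (auto simp: vfield_add lf_add mc_apply)

lemma mc_fscale: "X \<in> vfields G \<Longrightarrow> a \<in> Cinf G \<Longrightarrow> mc (a \<cdot> X) p = a p *\<^sub>R mc X p"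
  by (rule mc_eqI) (auto simp: vfield_fscale lf_scale mc_apply fscale_apply)

section \<open>Dual bases and functions with prescribed differentials\<close>

abbreviation eb :: "nat \<Rightarrow> 'v" where "eb \<equiv> basis G"
abbreviation fb :: "nat \<Rightarrow> 'v \<Rightarrow>\<^sub>L real" where "fb \<equiv> dual_basis G"
abbreviation dm :: nat where "dm \<equiv> lie_dim G"

lemma basis_expansion: "x = (\<Sum>i<dm. fb i x *\<^sub>R eb i)"
proof -
  have "x \<in> span (eb ` {..<dm})" using basis_span by simp
  then obtain u where u: "x = (\<Sum>b\<in>eb ` {..<dm}. u b *\<^sub>R b)"
    using span_finite[of "eb ` {..<dm}"] by auto
  then have x: "x = (\<Sum>i<dm. u (eb i) *\<^sub>R eb i)" by (simp add: sum.reindex[OF basis_inj])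
  have "fb j x = u (eb j)" if "j < dm" for j
  proof -
    have "fb j x = (\<Sum>i<dm. u (eb i) * fb j (eb i))"
      by (subst x) (simp add: blinfun.sum_right blinfun.scaleR_right)
    also have "\<dots> = (\<Sum>i<dm. if i = j then u (eb i) else 0)"
      using that by (intro sum.cong) (auto simp: dual_basis)
    finally show ?thesis using that by simp
  qed
  then show ?thesis using x by simp
qed

lemma linear_expansion:
  assumes "linear f"
  shows "f x = (\<Sum>i<dm. fb i x *\<^sub>R f (eb i))"
  by (subst basis_expansion[of x]) (simp add: linear_sum[OF assms] linear_scale[OF assms])

text \<open>A linear functional is a finite combination of the bounded functionals
  \<open>dual_basis G i\<close>, hence bounded. So \<open>Blinfun\<close> returns the intended
  functional in \<open>ad_star\<close>, \<open>Ad_star\<close> and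
  \<open>dual_bracket\<close>.\<close>

lemma linear_functional_apply:
  assumes "linear (f :: 'v \<Rightarrow> real)"
  shows "blinfun_apply (Blinfun f) = f"
proof (rule bounded_linear_Blinfun_apply)
  have "bounded_linear (\<lambda>x. \<Sum>i<dm. fb i x *\<^sub>R f (eb i))"
    by (intro bounded_linear_sum bounded_linear_compose[OF bounded_linear_scaleR_left blinfun.bounded_linear_right])
  also have "(\<lambda>x. \<Sum>i<dm. fb i x *\<^sub>R f (eb i)) = f" by (rule ext) (rule linear_expansion[OF assms, symmetric])
  finally show "bounded_linear f" .
qed

lemma dual_expansion:
  fixes \<phi> :: "'v \<Rightarrow>\<^sub>L real"
  shows "\<phi> = (\<Sum>i<dm. \<phi> (eb i) *\<^sub>R fb i)"
proof (rule blinfun_eqI)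
  fix x
  have "\<phi> x = (\<Sum>i<dm. fb i x *\<^sub>R \<phi> (eb i))"
    using linear_expansion[OF bounded_linear.linear[OF blinfun.bounded_linear_right]] .
  then show "\<phi> x = (\<Sum>i<dm. \<phi> (eb i) *\<^sub>R fb i) x"
    by (simp add: blinfun.sum_left blinfun.scaleR_left mult.commute)
qed

lemma dual_linear_expansion:
  fixes \<phi> :: "'v \<Rightarrow>\<^sub>L real"
  assumes "linear f"
  shows "f \<phi> = (\<Sum>i<dm. \<phi> (eb i) *\<^sub>R f (fb i))"
  using arg_cong[OF dual_expansion, of f \<phi>] by (simp add: linear_sum[OF assms] linear_scale[OF assms])

text \<open>Functions with prescribed left-invariant derivatives at the identity exist by linear algebra
  alone, since the functionals \<open>f \<mapsto> lf x f \<one>\<close> determine \<open>x\<close>: cut-off functions are not needed.\<close>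

lemma dual_functions_aux:
  "k \<le> dm \<Longrightarrow> \<exists>u. \<forall>j<k. u j \<in> Cinf G \<and> (\<forall>i<k. lf (eb i) (u j) \<one> = (if i = j then 1 else 0))"
proof (induction k)
  case (Suc k)
  then obtain u where u: "\<And>j. j < k \<Longrightarrow> u j \<in> Cinf G"
    "\<And>i j. i < k \<Longrightarrow> j < k \<Longrightarrow> lf (eb i) (u j) \<one> = (if i = j then 1 else 0)" by auto
  \<comment> \<open>\<open>eb k\<close> is corrected so that every earlier \<open>u i\<close> has
    zero derivative along \<open>y\<close>. Its \<open>k\<close>-th coordinate is still 1, so some
    function \<open>h\<close> has nonzero derivative along it.\<close>
  define y where "y = eb k - (\<Sum>i<k. lf (eb k) (u i) \<one> *\<^sub>R eb i)"
  have "fb k y = 1"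
    using Suc.prems by (simp add: y_def blinfun.diff_right blinfun.sum_right blinfun.scaleR_right dual_basis)
  then have "y \<noteq> 0" by auto
  then obtain h where h: "h \<in> Cinf G" "lf y h \<one> \<noteq> 0"
    using lf_eqI[of y 0] linear_0[OF lf_linear] by force
  \<comment> \<open>Dually, \<open>h\<close> is corrected to have zero derivative along the earlier
    basis vectors; its derivative along \<open>eb k\<close> then becomes that of \<open>h\<close>
    along \<open>y\<close>.\<close>
  define w where "w = h - (\<Sum>i<k. (\<lambda>x. lf (eb i) h \<one> * u i x))"
  have sc: "(\<lambda>x. lf (eb i) h \<one> * u i x) \<in> Cinf G" if "i < k" for i by (intro Cinf_scale u that)
  have Dd: "lf x (f - f') \<one> = lf x f \<one> - lf x f' \<one>" if "f \<in> Cinf G" "f' \<in> Cinf G" for x f f'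
    using vfield_algebra(1)[OF lf_vfield Cinf_diff[OF that] that(2), of x] by simp
  have w: "w \<in> Cinf G" unfolding w_def by (intro Cinf_diff h Cinf_sum sc) simp
  have lw: "lf x w \<one> = lf x h \<one> - (\<Sum>i<k. lf (eb i) h \<one> * lf x (u i) \<one>)" for x
  proof -
    have "lf x w \<one> = lf x h \<one> - lf x (\<Sum>i<k. (\<lambda>x. lf (eb i) h \<one> * u i x)) \<one>"
      unfolding w_def by (intro Dd h Cinf_sum sc) simp
    also have "lf x (\<Sum>i<k. (\<lambda>x. lf (eb i) h \<one> * u i x)) \<one> = (\<Sum>i<k. lf (eb i) h \<one> * lf x (u i) \<one>)"
      using sc u(1) by (subst vfield_sum[OF lf_vfield]) (auto simp: vfield_scale[OF lf_vfield] sum_fun_apply)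
    finally show ?thesis .
  qed
  have w0: "lf (eb j) w \<one> = 0" if "j < k" for j
    using that u(2) by (simp add: lw if_distrib[of "\<lambda>x. _ * x"] cong: if_cong)
  have wk: "lf (eb k) w \<one> = lf y h \<one>"
    by (simp add: lw y_def linear_diff[OF lf_linear] lf_sum lf_scale mult.commute)
  define v where "v = (\<lambda>x. inverse (lf y h \<one>) * w x)"
  have v: "v \<in> Cinf G" unfolding v_def by (intro Cinf_scale w)
  have lv: "lf (eb j) v \<one> = (if j = k then 1 else 0)" if "j < Suc k" for j
    using that w0 wk h by (auto simp: v_def vfield_scale[OF lf_vfield w] less_Suc_eq)
  \<comment> \<open>The earlier functions lose their derivative along \<open>eb k\<close>; their
    derivatives along the earlier basis vectors are unchanged, because those of \<open>v\<close>
    vanish.\<close>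
  define u' where "u' j = (if j = k then v else u j - (\<lambda>x. lf (eb k) (u j) \<one> * v x))" for j
  have "u' j \<in> Cinf G" if "j < Suc k" for j
    using that u(1) v by (auto simp: u'_def less_Suc_eq intro!: Cinf_diff Cinf_scale)
  moreover have "lf (eb i) (u' j) \<one> = (if i = j then 1 else 0)" if "i < Suc k" "j < Suc k" for i j
  proof (cases "j = k")
    case True
    then show ?thesis using lv that by (simp add: u'_def)
  next
    case False
    then have "lf (eb i) (u' j) \<one> = lf (eb i) (u j) \<one> - lf (eb k) (u j) \<one> * lf (eb i) v \<one>"
      using that u(1) v by (simp add: u'_def Dd Cinf_scale vfield_scale[OF lf_vfield v])
    then show ?thesis using False lv[OF that(1)] u(2)[of i j] that by (auto simp: less_Suc_eq)
  qed
  ultimately show ?case by blast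
qed simp

definition ufun :: "nat \<Rightarrow> 'g \<Rightarrow> real" where
  "ufun = (SOME u. \<forall>j<dm. u j \<in> Cinf G \<and> (\<forall>i<dm. lf (eb i) (u j) \<one> = (if i = j then 1 else 0)))"

lemma ufun: "j < dm \<Longrightarrow> ufun j \<in> Cinf G"
    "i < dm \<Longrightarrow> j < dm \<Longrightarrow> lf (eb i) (ufun j) \<one> = (if i = j then 1 else 0)"
  using someI_ex[OF dual_functions_aux[OF order_refl]] unfolding ufun_def[symmetric] by blast+

lemma lf_expansion: "lf x f p = (\<Sum>k<dm. fb k x * lf (eb k) f p)"
  using linear_expansion[OF lf_linear[of f p], of x] by simp

lemma lf_ufun: "k < dm \<Longrightarrow> lf x (ufun k) \<one> = fb k x"
  by (subst lf_expansion) (simp add: ufun(2) if_distrib[of "\<lambda>x. _ * x"] cong: if_cong)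

lemma fb_smooth:
  assumes "\<And>k. k < dm \<Longrightarrow> (\<lambda>p. fb k (x p)) \<in> Cinf G"
  shows "(\<lambda>p. blinfun_apply \<phi> (x p)) \<in> Cinf G"
proof -
  have "(\<lambda>p. blinfun_apply \<phi> (x p)) = (\<Sum>k<dm. (\<lambda>p. \<phi> (eb k) * fb k (x p)))"
  proof
    fix p
    have "\<phi> (x p) = (\<Sum>i<dm. fb i (x p) *\<^sub>R \<phi> (eb i))"
      using linear_expansion[OF bounded_linear.linear[OF blinfun.bounded_linear_right]] .
    then show "\<phi> (x p) = (\<Sum>k<dm. (\<lambda>p. \<phi> (eb k) * fb k (x p))) p"
      by (simp add: sum_fun_apply mult.commute)
  qed
  then show ?thesis using assms by (auto intro!: Cinf_sum Cinf_scale)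
qed

text \<open>The \<open>k\<close>-th coordinate at \<open>p\<close> is read off by applying
  \<open>X\<close> to the function \<open>ufun k\<close> translated from the identity to
  \<open>p\<close>. This is the value on the diagonal of a smooth function of two variables.\<close>

lemma mc_smooth:
  assumes X: "X \<in> vfields G"
  shows "(\<lambda>p. blinfun_apply \<phi> (mc X p)) \<in> Cinf G"
proof (rule fb_smooth)
  fix k assume k: "k < dm"
  let ?F = "\<lambda>z. ufun k (inv (snd z) \<otimes> fst z)"
  have "smooth2 ?F" using smooth2_inv_snd[OF smooth2_swap[OF smooth2_mult[OF ufun(1)[OF k]]]] by simp
  from smooth2_diagonal[OF smooth2_op_fst[OF X this]]
  have "(\<lambda>p. X (\<lambda>q. ufun k (inv p \<otimes> q)) p) \<in> Cinf G" by (simp add: op_fst_def)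
  moreover have "fb k (mc X p) = X (\<lambda>q. ufun k (inv p \<otimes> q)) p" for p
    using mc_apply[OF X Cinf_translate(1)[OF ufun(1)[OF k]], of p "inv p"]
      lf_translate[OF ufun(1)[OF k], of _ "inv p" p] lf_ufun[OF k] by simp
  ultimately show "(\<lambda>p. fb k (mc X p)) \<in> Cinf G" by simp
qed

lemma vfield_expansion:
  assumes X: "X \<in> vfields G"
  shows "X = (\<Sum>k<dm. (\<lambda>p. blinfun_apply (fb k) (mc X p)) \<cdot> lf (eb k))"
proof (intro ext)
  fix f p
  show "X f p = (\<Sum>k<dm. (\<lambda>p. blinfun_apply (fb k) (mc X p)) \<cdot> lf (eb k)) f p"
  proof (cases "f \<in> Cinf G")
    case True
    then show ?thesis
      using mc_apply[OF X True, of p] lf_expansion[of "mc X p" f p]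
      by (simp add: sum_fun_apply fscale_apply)
  qed (simp add: vfield_off[OF X] lf_off sum_fun_apply fscale_apply)
qed

subsection \<open>1-forms\<close>

abbreviation om :: "('v \<Rightarrow>\<^sub>L real) \<Rightarrow> 'g form" where "om \<equiv> left_form G"

lemma om_form: "om \<phi> \<in> forms G"
  unfolding forms_def left_form_def
  by (auto simp: mc_smooth vfield_add vfield_fscale mc_add mc_fscale blinfun.add_right
      blinfun.scaleR_right fun_eq_iff)

lemma om_lf: "om \<phi> (lf x) = const (\<phi> x)"
  by (simp add: left_form_def lf_vfield mc_lf const_def)

lemma om_apply: "X \<in> vfields G \<Longrightarrow> om \<phi> X p = \<phi> (mc X p)"
  by (simp add: left_form_def)

lemma formsD:
  assumes "\<tau> \<in> forms G"
  shows "X \<notin> vfields G \<Longrightarrow> \<tau> X = 0" "X \<in> vfields G \<Longrightarrow> \<tau> X \<in> Cinf G"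
    "X \<in> vfields G \<Longrightarrow> Y \<in> vfields G \<Longrightarrow> \<tau> (X + Y) = \<tau> X + \<tau> Y"
    "a \<in> Cinf G \<Longrightarrow> X \<in> vfields G \<Longrightarrow> \<tau> (a \<cdot> X) = a * \<tau> X"
  using assms unfolding forms_def by auto

lemma form_sum:
  assumes \<tau>: "\<tau> \<in> forms G"
  shows "finite I \<Longrightarrow> (\<And>i. i \<in> I \<Longrightarrow> X i \<in> vfields G) \<Longrightarrow> \<tau> (sum X I) = (\<Sum>i\<in>I. \<tau> (X i))"
proof (induction I rule: finite_induct)
  case empty
  \<comment> \<open>That forms vanish on the zero field is extracted from linearity over functions,
    by writing 0 as the function 0 times the field 0.\<close>
  have "(0 :: 'g vfield) = 0 \<cdot> 0" by (simp add: fscale_def fun_eq_iff)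
  then have "\<tau> 0 = 0 * \<tau> 0" using formsD(4)[OF \<tau> Cinf_zero vfield_0] by metis
  then show ?case by (simp only: sum.empty mult_zero_left)
next
  case (insert x F)
  have "\<tau> (X x + sum X F) = \<tau> (X x) + \<tau> (sum X F)"
    using insert.prems by (intro formsD(3)[OF \<tau>] vfield_sum_closed) auto
  also have "\<tau> (sum X F) = (\<Sum>i\<in>F. \<tau> (X i))" using insert by auto
  finally show ?case by (simp only: sum.insert[OF insert.hyps])
qed

lemma form_expansion:
  assumes \<tau>: "\<tau> \<in> forms G"
  shows "\<tau> = (\<Sum>k<dm. \<tau> (lf (eb k)) \<cdot> om (fb k))"
proof (intro ext)
  fix X p
  show "\<tau> X p = (\<Sum>k<dm. \<tau> (lf (eb k)) \<cdot> om (fb k)) X p"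
  proof (cases "X \<in> vfields G")
    case True
    have "\<tau> X = \<tau> (\<Sum>k<dm. (\<lambda>p. blinfun_apply (fb k) (mc X p)) \<cdot> lf (eb k))"
      using vfield_expansion[OF True] by simp
    also have "\<dots> = (\<Sum>k<dm. \<tau> ((\<lambda>p. blinfun_apply (fb k) (mc X p)) \<cdot> lf (eb k)))"
      by (rule form_sum[OF \<tau>]) (auto intro: vfield_fscale mc_smooth[OF True] lf_vfield)
    also have "\<dots> = (\<Sum>k<dm. (\<lambda>p. blinfun_apply (fb k) (mc X p)) * \<tau> (lf (eb k)))"
      by (intro sum.cong refl formsD(4)[OF \<tau>] mc_smooth[OF True] lf_vfield)
    finally show ?thesis
      by (simp add: sum_fun_apply fscale_apply om_apply[OF True] mult.commute)
  qed (simp add: formsD(1)[OF \<tau>] sum_fun_apply fscale_apply left_form_def)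
qed

lemma form_eqI:
  assumes "\<sigma> \<in> forms G" "\<tau> \<in> forms G" "\<And>k. k < dm \<Longrightarrow> \<sigma> (lf (eb k)) = \<tau> (lf (eb k))"
  shows "\<sigma> = \<tau>"
  using form_expansion[OF assms(1)] form_expansion[OF assms(2)] assms(3) by simp

lemma forms_add: "\<sigma> \<in> forms G \<Longrightarrow> \<tau> \<in> forms G \<Longrightarrow> \<sigma> + \<tau> \<in> forms G"
  unfolding forms_def by (auto simp: Cinf_add algebra_simps)

lemma forms_fscale: "a \<in> Cinf G \<Longrightarrow> \<tau> \<in> forms G \<Longrightarrow> a \<cdot> \<tau> \<in> forms G"
  unfolding forms_def fscale_def[of a \<tau>] by (auto simp: Cinf_mult algebra_simps)

lemma forms_zero: "0 \<in> forms G"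
  unfolding forms_def by (auto simp: Cinf_zero)

lemma forms_sum: "(\<And>i. i \<in> I \<Longrightarrow> \<tau> i \<in> forms G) \<Longrightarrow> sum \<tau> I \<in> forms G"
  by (induction I rule: infinite_finite_induct) (auto intro: forms_zero forms_add)

lemma ext_d_form: "f \<in> Cinf G \<Longrightarrow> ext_d G f \<in> forms G"
  unfolding forms_def ext_d_def
  by (auto simp: vfield_Cinf vfield_add vfield_fscale fscale_apply)

lemma ext_d_lf: "ext_d G f (lf x) = lf x f"
  by (simp add: ext_d_def lf_vfield)

subsection \<open>The adjoint action and the Lie bracket\<close>

text \<open>Right translation commutes with all left translations, so it carries a left-invariant
  field to a left-invariant field, which is found from its value at the identity.\<close>

lemma right_translate_ex:
  "\<exists>y. \<forall>f\<in>Cinf G. \<forall>p. lf x (\<lambda>q. f (q \<otimes> h)) p = lf y f (p \<otimes> h)"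
proof -
  have "tangent (inv h \<otimes> h) (\<lambda>f. lf x (\<lambda>q. f (q \<otimes> h)) (inv h))"
    by (rule tangent_rtrans[OF vfield_tangent[OF lf_vfield]])
  then obtain y where y: "\<And>f. f \<in> Cinf G \<Longrightarrow> lf y f \<one> = lf x (\<lambda>q. f (q \<otimes> h)) (inv h)"
    using tangent_is_lf by auto
  have "lf x (\<lambda>q. f (q \<otimes> h)) p = lf y f (p \<otimes> h)" if f: "f \<in> Cinf G" for f p
  proof -
    have "lf y f (p \<otimes> h) = lf x (\<lambda>q. f (p \<otimes> h \<otimes> (q \<otimes> h))) (inv h)"
      using lf_at[OF f] y[OF Cinf_translate(1)[OF f]] by simp
    also have "\<dots> = lf x (\<lambda>q. f (p \<otimes> h \<otimes> q \<otimes> h)) (inv h)" by (simp add: m_assoc)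
    also have "\<dots> = lf x (\<lambda>q. f (q \<otimes> h)) (p \<otimes> h \<otimes> inv h)"
      by (rule lf_translate[OF Cinf_translate(2)[OF f]])
    finally show ?thesis by (simp add: m_assoc)
  qed
  then show ?thesis by blast
qed

text \<open>Conjugation is a left translation combined with a right one, and the field does not see
  the left one. So \<open>Ad\<close> can be computed from right translations alone.\<close>

lemma Ad_inv_apply:
  assumes f: "f \<in> Cinf G"
  shows "lf x (\<lambda>q. f (q \<otimes> h)) p = lf (Ad G (inv h) x) f (p \<otimes> h)"
proof -
  obtain y where y: "\<And>f p. f \<in> Cinf G \<Longrightarrow> lf x (\<lambda>q. f (q \<otimes> h)) p = lf y f (p \<otimes> h)"
    using right_translate_ex by blast
  have eq: "lf y = push_field G (conj_by G (inv h)) (lf x)"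
  proof (intro ext)
    fix f p
    show "lf y f p = push_field G (conj_by G (inv h)) (lf x) f p"
    proof (cases "f \<in> Cinf G")
      case True
      have "push_field G (conj_by G (inv h)) (lf x) f p = lf x (\<lambda>q. f (inv h \<otimes> q \<otimes> h)) (h \<otimes> p \<otimes> inv h)"
        using True by (simp add: push_field_conj_by)
      also have "\<dots> = lf x (\<lambda>q. f (q \<otimes> h)) (inv h \<otimes> (h \<otimes> p \<otimes> inv h))"
        by (rule lf_translate[OF Cinf_translate(2)[OF True]])
      also have "\<dots> = lf y f (inv h \<otimes> (h \<otimes> p \<otimes> inv h) \<otimes> h)" by (rule y[OF True])
      also have "inv h \<otimes> (h \<otimes> p \<otimes> inv h) \<otimes> h = p"
        by (simp add: m_assoc) (simp add: m_assoc[symmetric])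
      finally show ?thesis by simp
    qed (simp add: lf_off push_field_def)
  qed
  have "Ad G (inv h) x = y"
    unfolding Ad_def eq[symmetric] by (rule the_equality) (auto dest: lf_inj)
  then show ?thesis using y[OF f] by simp
qed

lemma Ad_apply:
  assumes f: "f \<in> Cinf G"
  shows "lf (Ad G g x) f p = lf x (\<lambda>q. f (q \<otimes> inv g)) (p \<otimes> g)"
  using Ad_inv_apply[OF f, of x "inv g" "p \<otimes> g"] by (simp add: m_assoc)

lemma Ad_linear: "linear (Ad G g)"
  by (rule linearI) (auto intro!: lf_eqI simp: Ad_apply lf_add lf_scale)

lemma Ad_mult: "Ad G (g \<otimes> h) x = Ad G g (Ad G h x)"
  by (rule lf_eqI) (simp add: Ad_apply Cinf_translate(2) inv_mult_group m_assoc)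

lemma Ad_one: "Ad G \<one> x = x"
  by (rule lf_eqI) (simp add: Ad_apply)

lemma smooth2_mult_inv: "f \<in> Cinf G \<Longrightarrow> smooth2 (\<lambda>z. f (fst z \<otimes> inv (snd z)))"
  using smooth2_inv_snd[OF smooth2_mult] by simp

lemma Ad_smooth: "(\<lambda>g. blinfun_apply \<phi> (Ad G g y)) \<in> Cinf G"
proof (rule fb_smooth)
  fix k assume k: "k < dm"
  have "(\<lambda>g. fb k (Ad G g y)) = (\<lambda>g. op_fst (lf y) (\<lambda>z. ufun k (fst z \<otimes> inv (snd z))) (g, g))"
    by (simp add: op_fst_def Ad_apply ufun(1)[OF k] flip: lf_ufun[OF k])
  then show "(\<lambda>g. fb k (Ad G g y)) \<in> Cinf G"
    using smooth2_diagonal[OF smooth2_op_fst[OF lf_vfield smooth2_mult_inv[OF ufun(1)[OF k]]]] by simp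
qed

text \<open>The expression \<open>f (q \<otimes> (g \<otimes> inv g))\<close> is constant in
  \<open>g\<close>, and its derivative splits into the contributions of the two occurrences of
  \<open>g\<close>.\<close>

lemma lf_inverse_at_one:
  assumes f: "f \<in> Cinf G"
  shows "lf x (\<lambda>g. f (q \<otimes> inv g)) \<one> = - lf x f q"
proof -
  let ?F = "\<lambda>z. f (q \<otimes> (fst z \<otimes> inv (snd z)))"
  have F: "smooth2 ?F" by (rule smooth2_mult_inv[OF Cinf_translate(1)[OF f]])
  have "0 = lf x (\<lambda>g. ?F (g, g)) \<one>" using vfield_const[OF lf_vfield[of x], of "f q"] by (simp add: const_def)
  also have "\<dots> = lf x (\<lambda>g. f (q \<otimes> g)) \<one> + lf x (\<lambda>g. f (q \<otimes> inv g)) \<one>"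
    unfolding vfield_diagonal[OF lf_vfield F] by (simp add: op_fst_def op_snd_def)
  finally show ?thesis using lf_at[OF f, of x q] by simp
qed

text \<open>The left side is a derivative along the diagonal of
  \<open>f (p \<otimes> inv g)\<close>, already differentiated by \<open>y\<close> in
  \<open>p\<close>. The first variable contributes x(y f); in the second, after exchanging the
  order, the inverse contributes -y(x f).\<close>

lemma lf_Ad_derivative:
  assumes f: "f \<in> Cinf G"
  shows "lf x (\<lambda>g. lf (Ad G g y) f \<one>) \<one> = lf x (lf y f) \<one> - lf y (lf x f) \<one>"
proof -
  let ?F = "\<lambda>z. f (fst z \<otimes> inv (snd z))"
  have F: "smooth2 ?F" by (rule smooth2_mult_inv[OF f])
  have "(\<lambda>g. lf (Ad G g y) f \<one>) = (\<lambda>g. op_fst (lf y) ?F (g, g))"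
    by (simp add: op_fst_def Ad_apply f)
  then have "lf x (\<lambda>g. lf (Ad G g y) f \<one>) \<one> =
      op_fst (lf x) (op_fst (lf y) ?F) (\<one>, \<one>) + op_snd (lf x) (op_fst (lf y) ?F) (\<one>, \<one>)"
    using vfield_diagonal[OF lf_vfield smooth2_op_fst[OF lf_vfield F]] by simp
  also have "op_fst (lf x) (op_fst (lf y) ?F) (\<one>, \<one>) = lf x (lf y f) \<one>"
    by (simp add: op_fst_def)
  also have "op_snd (lf x) (op_fst (lf y) ?F) = op_fst (lf y) (op_snd (lf x) ?F)"
    by (rule op_commute[OF lf_vfield lf_vfield F, symmetric])
  also have "op_fst (lf y) (op_snd (lf x) ?F) (\<one>, \<one>) = lf y (\<lambda>q. - lf x f q) \<one>"
    by (simp add: op_fst_def op_snd_def lf_inverse_at_one[OF f])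
  also have "\<dots> = - lf y (lf x f) \<one>"
    using vfield_scale[OF lf_vfield lf_Cinf, of y "-1" x f] by simp
  finally show ?thesis by simp
qed

lemma lf_fb_Ad:
  assumes f: "f \<in> Cinf G"
  shows "lf (\<Sum>k<dm. lf x (\<lambda>g. fb k (Ad G g y)) \<one> *\<^sub>R eb k) f \<one> = lf x (\<lambda>g. lf (Ad G g y) f \<one>) \<one>"
proof -
  have "(\<lambda>g. lf (Ad G g y) f \<one>) = (\<Sum>k<dm. (\<lambda>g. lf (eb k) f \<one> * fb k (Ad G g y)))"
    by (rule ext, subst lf_expansion) (simp add: sum_fun_apply mult.commute)
  moreover have "lf x (\<Sum>k<dm. (\<lambda>g. lf (eb k) f \<one> * fb k (Ad G g y))) =
      (\<Sum>k<dm. lf x (\<lambda>g. lf (eb k) f \<one> * fb k (Ad G g y)))"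
    by (intro vfield_sum[OF lf_vfield] Cinf_scale Ad_smooth)
  ultimately show ?thesis
    by (simp add: vfield_scale[OF lf_vfield Ad_smooth] sum_fun_apply lf_sum lf_scale) (simp add: mult.commute)
qed

text \<open>The bracket is the derivative of \<open>Ad\<close>. Reading the formula backwards, the commutator of two
  left-invariant fields is again one.\<close>

lemma lie_bracket_eq: "lie_bracket G x y = (\<Sum>k<dm. lf x (\<lambda>g. fb k (Ad G g y)) \<one> *\<^sub>R eb k)"
proof -
  let ?z = "\<Sum>k<dm. lf x (\<lambda>g. fb k (Ad G g y)) \<one> *\<^sub>R eb k"
  have "lf ?z = vcommutator (lf x) (lf y)"
  proof (intro ext)
    fix f p
    show "lf ?z f p = vcommutator (lf x) (lf y) f p"
    proof (cases "f \<in> Cinf G")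
      case True
      let ?f = "\<lambda>h. f (p \<otimes> h)"
      have *: "lf a (lf b ?f) \<one> = lf a (lf b f) p" for a b
        using lf_at[OF lf_Cinf, of a b f p] by (simp add: lf_translate_fun[OF True])
      have "lf ?z f p = lf x (lf y ?f) \<one> - lf y (lf x ?f) \<one>"
        using lf_at[OF True, of ?z p] lf_fb_Ad[OF Cinf_translate(1)[OF True]]
          lf_Ad_derivative[OF Cinf_translate(1)[OF True]] by simp
      then show ?thesis by (simp add: vcommutator_def *)
    qed (simp add: lf_off vcommutator_def vfield_zero[OF lf_vfield])
  qed
  then show ?thesis unfolding lie_bracket_def using lf_inj by (metis (mono_tags, lifting) the_equality)
qed

lemma lf_bracket:
  assumes f: "f \<in> Cinf G"
  shows "lf (lie_bracket G x y) f p = lf x (lf y f) p - lf y (lf x f) p"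
proof -
  let ?f = "\<lambda>h. f (p \<otimes> h)"
  have *: "lf a (lf b ?f) \<one> = lf a (lf b f) p" for a b
    using lf_at[OF lf_Cinf, of a b f p] by (simp add: lf_translate_fun[OF f])
  show ?thesis
    using lf_at[OF f, of _ p] lf_fb_Ad[OF Cinf_translate(1)[OF f]]
      lf_Ad_derivative[OF Cinf_translate(1)[OF f]] by (simp add: lie_bracket_eq *)
qed

lemma Ad_derivative: "lf x (\<lambda>g. blinfun_apply \<phi> (Ad G g y)) \<one> = \<phi> (lie_bracket G x y)"
proof -
  have "(\<lambda>g. blinfun_apply \<phi> (Ad G g y)) = (\<Sum>k<dm. (\<lambda>g. \<phi> (eb k) * fb k (Ad G g y)))"
  proof
    fix g
    have "\<phi> (Ad G g y) = (\<Sum>i<dm. fb i (Ad G g y) *\<^sub>R \<phi> (eb i))"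
      using linear_expansion[OF bounded_linear.linear[OF blinfun.bounded_linear_right]] .
    then show "\<phi> (Ad G g y) = (\<Sum>k<dm. (\<lambda>g. \<phi> (eb k) * fb k (Ad G g y))) g"
      by (simp add: sum_fun_apply mult.commute)
  qed
  moreover have "lf x (\<Sum>k<dm. (\<lambda>g. \<phi> (eb k) * fb k (Ad G g y))) =
      (\<Sum>k<dm. lf x (\<lambda>g. \<phi> (eb k) * fb k (Ad G g y)))"
    by (intro vfield_sum[OF lf_vfield] Cinf_scale Ad_smooth)
  ultimately show ?thesis
    by (simp add: vfield_scale[OF lf_vfield Ad_smooth] sum_fun_apply lie_bracket_eq
        blinfun.sum_right blinfun.scaleR_right) (simp add: mult.commute)
qed

lemma lie_bracket_linear_right: "linear (lie_bracket G x)"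
proof (rule linearI)
  fix y z r
  have d: "lf x (lf y f + lf z f) = lf x (lf y f) + lf x (lf z f)" for f
    by (rule vfield_algebra(1)[OF lf_vfield lf_Cinf lf_Cinf])
  show "lie_bracket G x (y + z) = lie_bracket G x y + lie_bracket G x z"
    by (rule lf_eqI) (simp add: lf_bracket lf_add left_field_add d)
  have e: "lf x (lf (r *\<^sub>R y) f) p = r * lf x (lf y f) p" for f p
    using vfield_scale[OF lf_vfield lf_Cinf, of x r y f]
    by (simp add: left_field_scale fscale_def const_def times_fun_def)
  show "lie_bracket G x (r *\<^sub>R y) = r *\<^sub>R lie_bracket G x y"
    by (rule lf_eqI) (simp add: lf_bracket lf_scale e algebra_simps)
qed

lemma lie_bracket_antisym: "lie_bracket G y x = - lie_bracket G x y"
  by (rule lf_eqI) (simp add: lf_bracket linear_neg[OF lf_linear])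

lemma lie_bracket_jacobi:
  "lie_bracket G (lie_bracket G x y) z = lie_bracket G x (lie_bracket G y z) - lie_bracket G y (lie_bracket G x z)"
proof (rule lf_eqI)
  fix f assume f: "f \<in> Cinf G"
  have d: "lf a (lf (lie_bracket G b c) f) p = lf a (lf b (lf c f)) p - lf a (lf c (lf b f)) p" for a b c p
  proof -
    have "lf (lie_bracket G b c) f + lf c (lf b f) = lf b (lf c f)" by (auto simp: lf_bracket[OF f])
    then show ?thesis
      using vfield_algebra(1)[OF lf_vfield lf_Cinf lf_Cinf, of a "lie_bracket G b c" f c "lf b f"] by simp
  qed
  show "lf (lie_bracket G (lie_bracket G x y) z) f \<one> =
      lf (lie_bracket G x (lie_bracket G y z) - lie_bracket G y (lie_bracket G x z)) f \<one>"
    by (simp add: lf_bracket f lf_Cinf d linear_diff[OF lf_linear])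
qed

lemma Ad_bracket: "Ad G g (lie_bracket G x y) = lie_bracket G (Ad G g x) (Ad G g y)"
proof (rule lf_eqI)
  fix f assume f: "f \<in> Cinf G"
  have "(\<lambda>q. lf (Ad G g a) f (q \<otimes> inv g)) = lf a (\<lambda>q. f (q \<otimes> inv g))" for a
    by (simp add: Ad_apply[OF f] m_assoc)
  then show "lf (Ad G g (lie_bracket G x y)) f \<one> = lf (lie_bracket G (Ad G g x) (Ad G g y)) f \<one>"
    by (simp add: lf_bracket f Cinf_translate(2) Ad_apply[OF f] Ad_apply[OF lf_Cinf])
qed

end

section \<open>One-parameter subgroups\<close>

subsection \<open>Autonomous differential equations\<close>

text \<open>Finitely many directional derivatives along a frame are bounded on a compact ball and
  control the operator norm there; convexity of the ball then gives the Lipschitz estimate.\<close>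

lemma smooth_locally_lipschitz:
  fixes \<xi> :: "'a::{real_inner, heine_borel} \<Rightarrow> 'a"
  assumes B: "frame_basis (B :: 'a set)" and S: "open S" "p \<in> S" and \<xi>: "smooth_on S \<xi>"
  obtains r K where "r > 0" "cball p r \<subseteq> S"
    "\<And>u w. u \<in> cball p r \<Longrightarrow> w \<in> cball p r \<Longrightarrow> norm (\<xi> u - \<xi> w) \<le> K * norm (u - w)"
proof -
  obtain r where r: "r > 0" "cball p r \<subseteq> S" using S open_contains_cball by blast
  let ?n = "\<lambda>u. \<Sum>b\<in>B. norm b * norm (frechet_derivative \<xi> (at u) b)"
  have "continuous_on (cball p r) ?n"
    by (intro continuous_intros continuous_on_subset[OF smooth_on_continuous[OF smooth_on_derivative[OF \<xi>]] r(2)])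
  then have "bounded (?n ` cball p r)"
    by (intro compact_imp_bounded compact_continuous_image compact_cball)
  then obtain K where K: "\<And>u. u \<in> cball p r \<Longrightarrow> norm (?n u) \<le> K"
    by (fastforce simp: bounded_iff)
  have "norm (\<xi> u - \<xi> w) \<le> K * norm (u - w)" if "u \<in> cball p r" "w \<in> cball p r" for u w
  proof (rule differentiable_bound[OF convex_cball[of p r]])
    fix x assume x: "x \<in> cball p r"
    note d = smooth_on_has_derivative[OF \<xi> subsetD[OF r(2) x]]
    show "(\<xi> has_derivative frechet_derivative \<xi> (at x)) (at x within cball p r)"
      using d by (rule has_derivative_at_withinI)
    show "onorm (frechet_derivative \<xi> (at x)) \<le> K"
    proof (rule onorm_bound)
      show "0 \<le> K" using order_trans[OF norm_ge_zero K[OF x]] .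
      fix v
      have "norm (frechet_derivative \<xi> (at x) v) = norm (\<Sum>b\<in>B. (v \<bullet> b) *\<^sub>R frechet_derivative \<xi> (at x) b)"
        using linear_frame_basis[OF B has_derivative_linear[OF d], of v] by simp
      also have "\<dots> \<le> (\<Sum>b\<in>B. norm v * (norm b * norm (frechet_derivative \<xi> (at x) b)))"
        using Cauchy_Schwarz_ineq2[of v]
        by (intro sum_norm_le) (simp add: mult_right_mono flip: mult.assoc)
      also have "\<dots> = norm v * ?n x" by (simp add: sum_distrib_left)
      also have "\<dots> \<le> norm v * K" using K[OF x] by (intro mult_left_mono) auto
      finally show "norm (frechet_derivative \<xi> (at x) v) \<le> K * norm v" by (simp add: mult.commute)
    qed
  qed (use that in auto)
  then show ?thesis using that r by blast
qed

text \<open>The target is only an inner product space, so the integrals are real ones, taken for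
  each frame component. Subtracting the integral up to 0 makes the value at 0 vanish on a two-sided
  interval.\<close>

lemma antiderivative_exists:
  fixes g :: "real \<Rightarrow> 'a::real_inner"
  assumes B: "frame_basis (B :: 'a set)" and g: "continuous_on UNIV g"
  shows "\<exists>F. F 0 = 0 \<and> (\<forall>t\<in>{-e..e}. (F has_vector_derivative g t) (at t within {-e..e}))"
proof -
  define F where "F t = (\<Sum>b\<in>B. (integral {-e..t} (\<lambda>s. g s \<bullet> b) - integral {-e..0} (\<lambda>s. g s \<bullet> b)) *\<^sub>R b)" for t
  have "(F has_vector_derivative (\<Sum>b\<in>B. (g t \<bullet> b) *\<^sub>R b)) (at t within {-e..e})" if "t \<in> {-e..e}" for t
    unfolding F_def
  proof (intro has_vector_derivative_sum)
    fix b
    have "((\<lambda>t. integral {-e..t} (\<lambda>s. g s \<bullet> b)) has_vector_derivative g t \<bullet> b) (at t within {-e..e})"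
      using that by (intro integral_has_vector_derivative continuous_intros continuous_on_subset[OF g]) auto
    then have "((\<lambda>t. integral {-e..t} (\<lambda>s. g s \<bullet> b) - integral {-e..0} (\<lambda>s. g s \<bullet> b))
        has_vector_derivative g t \<bullet> b) (at t within {-e..e})"
      by (auto intro!: derivative_eq_intros)
    from bounded_linear.has_vector_derivative[OF bounded_linear_scaleR_left this]
    show "((\<lambda>t. (integral {-e..t} (\<lambda>s. g s \<bullet> b) - integral {-e..0} (\<lambda>s. g s \<bullet> b)) *\<^sub>R b)
        has_vector_derivative (g t \<bullet> b) *\<^sub>R b) (at t within {-e..e})" .
  qed
  moreover have "(\<Sum>b\<in>B. (g t \<bullet> b) *\<^sub>R b) = g t" for t
    using B by (simp add: frame_basis_def)
  ultimately show ?thesis by (intro exI[of _ F]) (simp add: F_def)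
qed

lemma antiderivative_bound:
  fixes F :: "real \<Rightarrow> 'a::real_normed_vector"
  assumes "F 0 = 0" and F: "\<And>t. t \<in> {-e..e} \<Longrightarrow> (F has_vector_derivative g t) (at t within {-e..e})"
    and g: "\<And>t. norm (g t) \<le> D" and t: "t \<in> {-e..e}"
  shows "norm (F t) \<le> e * D"
proof -
  have "norm (F t - F 0) \<le> D * norm (t - 0)"
  proof (rule differentiable_bound[OF convex_real_interval(5)])
    show "(F has_derivative (\<lambda>s. s *\<^sub>R g x)) (at x within {-e..e})" if "x \<in> {-e..e}" for x
      using F[OF that] by (simp add: has_vector_derivative_def)
    show "onorm (\<lambda>s. s *\<^sub>R g x) \<le> D" for x
      using g[of x] by (intro onorm_bound order_trans[OF norm_ge_zero g[of x]]) (simp add: mult.commute[of D] mult_left_mono)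
  qed (use t in auto)
  also have "\<dots> \<le> D * e" using t order_trans[OF norm_ge_zero g[of 0]] by (intro mult_left_mono) auto
  finally show ?thesis using assms(1) by (simp add: mult.commute)
qed

text \<open>The Picard operator is a contraction of the bounded continuous curves in the closed
  ball. The curves live on the whole line, so that Banach's theorem applies in the space of bounded
  continuous functions.\<close>

lemma ode_solution:
  fixes \<xi> :: "'a::{real_inner, heine_borel} \<Rightarrow> 'a"
  assumes B: "frame_basis (B :: 'a set)" and r: "r > 0"
    and lip: "\<And>u w. u \<in> cball p r \<Longrightarrow> w \<in> cball p r \<Longrightarrow> norm (\<xi> u - \<xi> w) \<le> K * norm (u - w)"
  obtains e y where "e > 0" "y 0 = p" "\<And>t. y t \<in> cball p r" "continuous_on UNIV y"
    "\<And>t. \<bar>t\<bar> < e \<Longrightarrow> (y has_vector_derivative \<xi> (y t)) (at t)"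
proof -
  define L where "L = \<bar>K\<bar>"
  have lip: "norm (\<xi> u - \<xi> w) \<le> L * norm (u - w)" if "u \<in> cball p r" "w \<in> cball p r" for u w
    using lip[OF that] mult_right_mono[OF abs_ge_self[of K] norm_ge_zero[of "u - w"]] unfolding L_def by linarith
  have L: "L \<ge> 0" by (simp add: L_def)
  have cont\<xi>: "continuous_on (cball p r) \<xi>"
  proof (rule lipschitz_on_continuous_on[of L])
    show "L-lipschitz_on (cball p r) \<xi>" using lip L by (auto simp: lipschitz_on_def dist_norm)
  qed
  then have "bounded (\<xi> ` cball p r)"
    by (intro compact_imp_bounded compact_continuous_image compact_cball)
  then obtain M where M: "\<And>u. u \<in> cball p r \<Longrightarrow> norm (\<xi> u) \<le> M" by (fastforce simp: bounded_iff)
  have M0: "M \<ge> 0" using order_trans[OF norm_ge_zero M[of p]] r by simp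
  \<comment> \<open>The first bound gives \<open>e * M \<le> r\<close>, so the operator keeps curves
    in the ball; the second gives \<open>e * L \<le> 1 / 2\<close>, the contraction factor. The
    summands 1 cover M = 0 and L = 0.\<close>
  define e where "e = min (r / (M + 1)) (1 / (2 * (L + 1)))"
  have e: "e > 0" using r M0 L by (simp add: e_def)
  have eM: "e * M \<le> r"
  proof -
    have "e * M \<le> r / (M + 1) * M" using M0 by (intro mult_right_mono) (auto simp: e_def)
    also have "\<dots> = r * (M / (M + 1))" by simp
    also have "\<dots> \<le> r * 1" using r M0 by (intro mult_left_mono) auto
    finally show ?thesis by simp
  qed
  have eL: "e * L \<le> 1 / 2"
  proof -
    have "e * L \<le> 1 / (2 * (L + 1)) * L" using L by (intro mult_right_mono) (auto simp: e_def)
    also have "\<dots> = (1 / 2) * (L / (L + 1))" by (simp add: field_simps)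
    also have "\<dots> \<le> (1 / 2) * 1" using L by (intro mult_left_mono) auto
    finally show ?thesis by simp
  qed
  define J where "J g = (SOME F. F 0 = 0 \<and>
      (\<forall>t\<in>{-e..e}. (F has_vector_derivative g t) (at t within {-e..e})))" for g :: "real \<Rightarrow> 'a"
  have J: "J g 0 = 0" "\<And>t. t \<in> {-e..e} \<Longrightarrow> (J g has_vector_derivative g t) (at t within {-e..e})"
    if "continuous_on UNIV g" for g
    using someI_ex[OF antiderivative_exists[OF B that, of e]] unfolding J_def by auto
  \<comment> \<open>Time is clamped to [-e, e]: outside that interval the candidate curves are
    constant, hence still bounded and continuous on the line.\<close>
  define c where "c t = max (-e) (min e t)" for t
  have c: "c t \<in> {-e..e}" for t using e by (auto simp: c_def)
  have contc: "continuous_on UNIV c" unfolding c_def by (intro continuous_intros)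
  define Y where "Y = PiC (UNIV :: real set) (\<lambda>_. cball p r)"
  have Y: "f \<in> Y \<longleftrightarrow> (\<forall>t. apply_bcontfun f t \<in> cball p r)" for f by (simp add: Y_def mem_PiC_iff Pi_def)
  have \<xi>f: "continuous_on UNIV (\<lambda>s. \<xi> (apply_bcontfun f s))" if "f \<in> Y" for f
    using that by (intro continuous_on_compose2[OF cont\<xi>]) (auto simp: Y)
  define h where "h f t = p + J (\<lambda>s. \<xi> (apply_bcontfun f s)) (c t)" for f :: "real \<Rightarrow>\<^sub>C 'a" and t
  have h_ball: "h f t \<in> cball p r" if "f \<in> Y" for f t
  proof -
    have "norm (J (\<lambda>s. \<xi> (apply_bcontfun f s)) (c t)) \<le> e * M"
      using that by (intro antiderivative_bound[OF J(1) J(2)] \<xi>f c M) (auto simp: Y)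
    then show ?thesis using eM by (simp add: h_def dist_norm)
  qed
  have h_cont: "continuous_on UNIV (h f)" if "f \<in> Y" for f
  proof -
    have "continuous_on {-e..e} (J (\<lambda>s. \<xi> (apply_bcontfun f s)))"
      using J(2)[OF \<xi>f[OF that]] has_vector_derivative_continuous continuous_on_eq_continuous_within by blast
    then have "continuous_on UNIV (\<lambda>t. J (\<lambda>s. \<xi> (apply_bcontfun f s)) (c t))"
      using contc by (rule continuous_on_compose2) (use c in blast)
    then show ?thesis unfolding h_def by (intro continuous_intros)
  qed
  have h_bc: "h f \<in> bcontfun" if "f \<in> Y" for f
  proof -
    have "range (h f) \<subseteq> cball p r" using h_ball[OF that] by blast
    then have "bounded (range (h f))" by (rule bounded_subset[OF bounded_cball])
    then show ?thesis using h_cont[OF that] by (simp add: bcontfun_def)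
  qed
  define T where "T f = Bcontfun (h f)" for f
  have T: "apply_bcontfun (T f) = h f" if "f \<in> Y" for f
    using Bcontfun_inverse[OF h_bc[OF that]] by (simp add: T_def)
  have "\<exists>!f. f \<in> Y \<and> T f = f"
  proof (rule Banach_fix[of Y "1/2"])
    show "complete Y" unfolding Y_def by (simp add: complete_eq_closed closed_PiC)
    have "const_bcontfun p \<in> Y" using r by (simp add: Y const_bcontfun.rep_eq)
    then show "Y \<noteq> {}" by auto
    show "T ` Y \<subseteq> Y" using h_ball by (auto simp: Y T)
    show "dist (T f) (T g) \<le> 1 / 2 * dist f g" if fg: "f \<in> Y" "g \<in> Y" for f g
    proof (rule dist_bound)
      fix t
      let ?F = "\<lambda>f. J (\<lambda>s. \<xi> (apply_bcontfun f s))"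
      have "norm (?F f (c t) - ?F g (c t)) \<le> e * (L * dist f g)"
      proof (rule antiderivative_bound[where F = "\<lambda>t. ?F f t - ?F g t"])
        show "?F f 0 - ?F g 0 = 0" using J(1)[OF \<xi>f] fg by simp
        show "((\<lambda>t. ?F f t - ?F g t) has_vector_derivative
            \<xi> (apply_bcontfun f s) - \<xi> (apply_bcontfun g s)) (at s within {-e..e})" if "s \<in> {-e..e}" for s
          by (intro has_vector_derivative_diff J(2) \<xi>f fg that)
        show "norm (\<xi> (apply_bcontfun f s) - \<xi> (apply_bcontfun g s)) \<le> L * dist f g" for s
        proof -
          have "norm (\<xi> (apply_bcontfun f s) - \<xi> (apply_bcontfun g s)) \<le>
              L * norm (apply_bcontfun f s - apply_bcontfun g s)" using fg by (intro lip) (auto simp: Y)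
          also have "\<dots> \<le> L * dist f g" using dist_bounded[of f s g] L by (intro mult_left_mono) (auto simp: dist_norm)
          finally show ?thesis .
        qed
      qed (rule c)
      also have "\<dots> = (e * L) * dist f g" by simp
      also have "\<dots> \<le> 1 / 2 * dist f g" using eL by (intro mult_right_mono) auto
      finally show "dist (apply_bcontfun (T f) t) (apply_bcontfun (T g) t) \<le> 1 / 2 * dist f g"
        using fg by (simp add: T h_def dist_norm)
    qed
  qed auto
  then obtain f where f: "f \<in> Y" "T f = f" by blast
  let ?y = "apply_bcontfun f"
  have fy: "?y t = p + J (\<lambda>s. \<xi> (?y s)) (c t)" for t
    using T[OF f(1)] f(2) by (metis h_def)
  show ?thesis
  proof (rule that[OF e])
    show "?y 0 = p" using fy[of 0] J(1)[OF \<xi>f[OF f(1)]] e by (simp add: c_def)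
    show "?y t \<in> cball p r" for t using f(1) Y by blast
    show "continuous_on UNIV ?y" by simp
    fix t assume t: "\<bar>t\<bar> < e"
    have "(J (\<lambda>s. \<xi> (?y s)) has_vector_derivative \<xi> (?y t)) (at t within {-e..e})"
      using t by (intro J(2)[OF \<xi>f[OF f(1)]]) auto
    then have "(J (\<lambda>s. \<xi> (?y s)) has_vector_derivative \<xi> (?y t)) (at t)"
      using t by (subst (asm) at_within_interior) auto
    then have "((\<lambda>t. p + J (\<lambda>s. \<xi> (?y s)) t) has_vector_derivative \<xi> (?y t)) (at t)"
      by (auto intro!: derivative_eq_intros)
    then show "(?y has_vector_derivative \<xi> (?y t)) (at t)"
    proof (rule has_vector_derivative_transform_within_open)
      show "open {-e<..<e}" "t \<in> {-e<..<e}" using t by auto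
      show "p + J (\<lambda>s. \<xi> (?y s)) s = ?y s" if "s \<in> {-e<..<e}" for s
        using that fy[of s] by (simp add: c_def)
    qed
  qed
qed

text \<open>Gronwall's argument: the squared distance of the curves, damped by exp(-2Kt), has
  nonpositive derivative and starts at 0.\<close>

lemma ode_unique_forward:
  fixes x y :: "real \<Rightarrow> 'a::real_inner"
  assumes "0 \<le> T" and init: "x 0 = y 0"
    and x: "\<And>t. 0 \<le> t \<Longrightarrow> t \<le> T \<Longrightarrow> (x has_vector_derivative x' t) (at t)"
    and y: "\<And>t. 0 \<le> t \<Longrightarrow> t \<le> T \<Longrightarrow> (y has_vector_derivative y' t) (at t)"
    and lip: "\<And>t. 0 \<le> t \<Longrightarrow> t \<le> T \<Longrightarrow> norm (x' t - y' t) \<le> K * norm (x t - y t)"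
  shows "x T = y T"
proof -
  define w where "w t = ((x t - y t) \<bullet> (x t - y t)) * exp (- 2 * K * t)" for t
  have "w T \<le> w 0"
  proof (rule DERIV_nonpos_imp_nonincreasing[OF \<open>0 \<le> T\<close>])
    fix t assume t: "0 \<le> t" "t \<le> T"
    let ?d = "x t - y t" and ?d' = "x' t - y' t"
    have "((\<lambda>t. x t - y t) has_derivative (\<lambda>s. s *\<^sub>R ?d')) (at t)"
      using has_vector_derivative_diff[OF x[OF t] y[OF t]] by (simp add: has_vector_derivative_def)
    from has_derivative_inner[OF this this]
    have "((\<lambda>t. (x t - y t) \<bullet> (x t - y t)) has_derivative
        (\<lambda>s. ?d \<bullet> (s *\<^sub>R ?d') + (s *\<^sub>R ?d') \<bullet> ?d)) (at t)" .
    moreover have "(\<lambda>s. a \<bullet> (s *\<^sub>R b) + (s *\<^sub>R b) \<bullet> a) = times (2 * (a \<bullet> b))" for a b :: 'a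
      by (rule ext) (simp add: inner_commute[of b] algebra_simps)
    ultimately have "((\<lambda>t. (x t - y t) \<bullet> (x t - y t)) has_real_derivative 2 * (?d \<bullet> ?d')) (at t)"
      by (simp only: has_field_derivative_def)
    moreover have "((\<lambda>t. exp (- 2 * K * t)) has_real_derivative - 2 * K * exp (- 2 * K * t)) (at t)"
      by (auto intro!: derivative_eq_intros)
    ultimately have "(w has_real_derivative 2 * (?d \<bullet> ?d') * exp (- 2 * K * t) + (- 2 * K * exp (- 2 * K * t)) * (?d \<bullet> ?d)) (at t)"
      unfolding w_def by (rule DERIV_mult)
    moreover have "?d \<bullet> ?d' \<le> K * (?d \<bullet> ?d)"
    proof -
      have "?d \<bullet> ?d' \<le> norm ?d * norm ?d'" by (rule norm_cauchy_schwarz)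
      also have "\<dots> \<le> norm ?d * (K * norm ?d)" using lip[OF t] by (intro mult_left_mono) auto
      finally show ?thesis by (simp add: dot_square_norm power2_eq_square algebra_simps)
    qed
    then have "2 * (?d \<bullet> ?d') * exp (- 2 * K * t) + (- 2 * K * exp (- 2 * K * t)) * (?d \<bullet> ?d) \<le> 0"
      using mult_right_mono[of "?d \<bullet> ?d'" "K * (?d \<bullet> ?d)" "2 * exp (- 2 * K * t)"]
      by (simp add: algebra_simps)
    ultimately show "\<exists>z. DERIV w t :> z \<and> z \<le> 0" by blast
  qed
  then have "(x T - y T) \<bullet> (x T - y T) * exp (- 2 * K * T) \<le> 0" by (simp add: w_def init)
  then have "(x T - y T) \<bullet> (x T - y T) \<le> 0" by (simp add: mult_le_0_iff)
  then have "(x T - y T) \<bullet> (x T - y T) = 0" by (intro antisym inner_ge_zero)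
  then have "x T - y T = 0" by (simp only: inner_eq_zero_iff)
  then show ?thesis by simp
qed

text \<open>Negative times are reduced to positive ones by reversing time, which changes the sign of
  the field but not the Lipschitz estimate.\<close>

lemma ode_unique:
  fixes x y :: "real \<Rightarrow> 'a::real_inner"
  assumes init: "x 0 = y 0" and T: "\<bar>T\<bar> < d"
    and x: "\<And>t. \<bar>t\<bar> < d \<Longrightarrow> (x has_vector_derivative \<xi> (x t)) (at t)"
    and y: "\<And>t. \<bar>t\<bar> < d \<Longrightarrow> (y has_vector_derivative \<xi> (y t)) (at t)"
    and lip: "\<And>t. \<bar>t\<bar> < d \<Longrightarrow> norm (\<xi> (x t) - \<xi> (y t)) \<le> K * norm (x t - y t)"
  shows "x T = y T"
proof (cases "0 \<le> T")
  case True
  then show ?thesis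
    using T by (intro ode_unique_forward[OF True, of x y "\<lambda>t. \<xi> (x t)" "\<lambda>t. \<xi> (y t)" K] init x y lip) auto
next
  case False
  have rev: "((\<lambda>t. z (- t)) has_vector_derivative - \<xi> (z (- t))) (at t)"
    if "\<And>t. \<bar>t\<bar> < d \<Longrightarrow> (z has_vector_derivative \<xi> (z t)) (at t)" "\<bar>t\<bar> < d" for z t
  proof -
    have "(uminus has_real_derivative -1) (at t)" by (auto intro!: derivative_eq_intros)
    from vector_diff_chain_at[OF this[unfolded has_real_derivative_iff_has_vector_derivative] that(1)[of "- t"]]
    show ?thesis using that(2) by (simp add: o_def)
  qed
  have "x (- (- T)) = y (- (- T))"
  proof (rule ode_unique_forward[of "- T" "\<lambda>t. x (- t)" "\<lambda>t. y (- t)" "\<lambda>t. - \<xi> (x (- t))" "\<lambda>t. - \<xi> (y (- t))" K])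
    show "((\<lambda>t. x (- t)) has_vector_derivative - \<xi> (x (- t))) (at t)" if "0 \<le> t" "t \<le> - T" for t
      using that T by (intro rev x) auto
    show "((\<lambda>t. y (- t)) has_vector_derivative - \<xi> (y (- t))) (at t)" if "0 \<le> t" "t \<le> - T" for t
      using that T by (intro rev y) auto
    show "norm (- \<xi> (x (- t)) - - \<xi> (y (- t))) \<le> K * norm (x (- t) - y (- t))" if "0 \<le> t" "t \<le> - T" for t
      using lip[of "- t"] that T by (simp add: norm_minus_commute)
  qed (use False init in auto)
  then show ?thesis by simp
qed

text \<open>Bootstrapping: if y is C^k, then so is its derivative \<xi>(y), and y is
  C^(k+1).\<close>

lemma ode_solution_smooth:
  fixes y :: "real \<Rightarrow> 'a::real_inner"
  assumes B: "frame_basis (B :: 'a set)" and S: "open S" and \<xi>: "smooth_on S \<xi>"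
    and y: "\<And>t. \<bar>t\<bar> < e \<Longrightarrow> (y has_vector_derivative \<xi> (y t)) (at t)" and yS: "\<And>t. \<bar>t\<bar> < e \<Longrightarrow> y t \<in> S"
  shows "smooth_on {-e<..<e} y"
proof -
  have "Ck_on k {-e<..<e} y" for k
  proof (induction k)
    case 0
    have "continuous (at t) y" if "t \<in> {-e<..<e}" for t
      using has_vector_derivative_continuous[OF y] that by auto
    then show ?case by (simp add: continuous_at_imp_continuous_on)
  next
    case (Suc k)
    have k: "Ck_on k {-e<..<e} (\<lambda>t. \<xi> (y t))"
      using \<xi> yS by (intro Ck_on_compose[OF B _ Suc, of S]) (auto simp: smooth_on_def)
    show ?case
    proof (rule Ck_on_SucI)
      show "(y has_derivative (\<lambda>s. s *\<^sub>R \<xi> (y t))) (at t)" if "t \<in> {-e<..<e}" for t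
        using y[of t] that by (simp add: has_vector_derivative_def abs_less_iff)
      show "Ck_on k {-e<..<e} (\<lambda>t. v *\<^sub>R \<xi> (y t))" for v
        by (rule Ck_on_bounded_linear[OF bounded_linear_scaleR_right _ k]) simp
    qed simp
  qed
  then show ?thesis by (simp add: smooth_on_def)
qed

subsection \<open>Existence of the exponential map\<close>

context poisson_lie_group
begin

text \<open>For fixed s, the curves y(s + t) and the product of y(s) with y(t) both solve the
  equation of a left-invariant field and agree at t = 0. Uniqueness makes them equal.\<close>

lemma local_one_parameter:
  obtains c :: "real \<Rightarrow> 'g" and d U \<phi> y where "d > 0" "(U, \<phi>) \<in> charts G" "smooth_on {-d<..<d} y"
    "\<And>t. \<bar>t\<bar> < d \<Longrightarrow> y t \<in> \<phi> ` U \<and> c t = inv_into U \<phi> (y t)"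
    "\<And>s t. \<bar>s\<bar> < d \<Longrightarrow> \<bar>t\<bar> < d \<Longrightarrow> c (s + t) = c s \<otimes> c t"
    "\<And>f. f \<in> Cinf G \<Longrightarrow> ((\<lambda>t. f (c t)) has_field_derivative lf x f \<one>) (at 0)"
proof -
  obtain U \<phi> where c: "(U, \<phi>) \<in> charts G" "\<one> \<in> U" using chart_at .
  define p where "p = \<phi> \<one>"
  have p: "p \<in> \<phi> ` U" "inv_into U \<phi> p = \<one>" using c chart(5)[OF c] by (auto simp: p_def)
  let ?i = "inv_into U \<phi>"
  define m where "m = mult_chart U \<phi> U \<phi> \<phi>"
  define D where "D = mult_dom U \<phi> U \<phi> U"
  have oD: "open D" unfolding D_def by (rule open_mult_dom[OF c(1) c(1) chart(1)[OF c(1)]])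
  have sm: "smooth_on D m" unfolding D_def m_def by (rule smooth_mult_chart[OF c(1) c(1) c(1)])
  have D: "(u, w) \<in> D \<longleftrightarrow> u \<in> \<phi> ` U \<and> w \<in> \<phi> ` U \<and> ?i u \<otimes> ?i w \<in> U" for u w
    by (auto simp: D_def mult_dom_def)
  have m: "m (u, w) = \<phi> (?i u \<otimes> ?i w)" for u w by (simp add: m_def mult_chart_def)
  have im: "?i (m (u, w)) = ?i u \<otimes> ?i w" "m (u, w) \<in> \<phi> ` U" if "(u, w) \<in> D" for u w
    using that chart(5)[OF c(1)] by (auto simp: D m)
  have D1: "(u, p) \<in> D" "m (u, p) = u" if "u \<in> \<phi> ` U" for u
    using that p chart(6,7)[OF c(1) that] by (auto simp: D m)
  have D1': "(p, u) \<in> D" "m (p, u) = u" if "u \<in> \<phi> ` U" for u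
    using that p chart(6,7)[OF c(1) that] by (auto simp: D m)
  obtain \<eta> where \<eta>_rep: "field_rep (lf x) U \<phi> \<eta>" by (rule field_rep_exists[OF lf_vfield[of x] c(1)])
  note \<eta> = field_repD(2)[OF \<eta>_rep]
  define v where "v = \<eta> p"
  define m' where "m' u w = frechet_derivative (\<lambda>w. m (u, w)) (at w)" for u w
  have dm: "((\<lambda>w. m (u, w)) has_derivative m' u w) (at w)"
    "m' u w h = frechet_derivative m (at (u, w)) (0, h)" if "(u, w) \<in> D" for u w h
  proof -
    note d = smooth_on_has_derivative[OF sm that]
    have "((\<lambda>w. (u, w)) has_derivative (\<lambda>h. (0, h))) (at w)" by (auto intro!: derivative_eq_intros)
    note dd = has_derivative_compose[OF this d]
    show "m' u w h = frechet_derivative m (at (u, w)) (0, h)"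
      unfolding m'_def frechet_derivative_eqI[OF dd] ..
    show "((\<lambda>w. m (u, w)) has_derivative m' u w) (at w)"
      unfolding m'_def frechet_derivative_eqI[OF dd] by (rule dd)
  qed
  \<comment> \<open>The left-invariant field in coordinates, obtained by differentiating
    multiplication at the identity. In this form its invariance is the derivative of the associative
    law; \<open>lf x\<close> enters through the initial vector \<open>v\<close>.\<close>
  define \<xi> where "\<xi> u = m' u p v" for u
  have \<xi>_smooth: "smooth_on (\<phi> ` U) \<xi>"
  proof -
    have "smooth_on (\<phi> ` U) (\<lambda>u. (u, p))"
      by (intro smooth_on_Pair smooth_on_ident smooth_on_const chart(2)[OF c(1)])
    from smooth_on_compose[OF model_basis2 chart(2)[OF c(1)] this smooth_on_derivative[OF sm]]
    have "smooth_on (\<phi> ` U) (\<lambda>u. frechet_derivative m (at (u, p)) (0, v))" using D1 by blast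
    then show ?thesis
      using smooth_on_cong[OF chart(2)[OF c(1)]] dm(2)[OF D1(1)] unfolding \<xi>_def by (metis (no_types, lifting))
  qed
  have \<xi>p: "\<xi> p = v"
  proof -
    have "((\<lambda>w. w) has_derivative (\<lambda>h. h)) (at p)" by (rule has_derivative_ident)
    then have "((\<lambda>w. m (p, w)) has_derivative (\<lambda>h. h)) (at p)"
      by (rule has_derivative_transform_within_open[OF _ chart(2)[OF c(1)] p(1)]) (simp add: D1')
    then show ?thesis by (simp add: \<xi>_def m'_def frechet_derivative_eqI)
  qed
  have \<xi>_left_invariant: "m' a w (\<xi> w) = \<xi> (m (a, w))" if aw: "(a, w) \<in> D" for a w
  proof -
    have w: "w \<in> \<phi> ` U" using aw D by blast
    have maw: "m (a, w) \<in> \<phi> ` U" using im[OF aw] by simp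
    \<comment> \<open>Associativity can be written in coordinates only while all intermediate
      products stay in the chart; \<open>N\<close> and then \<open>N'\<close> are neighbourhoods of
      \<open>p\<close> where they do.\<close>
    define N where "N = (\<lambda>h. (w, h)) -` D \<inter> (\<lambda>h. (m (a, w), h)) -` D"
    have N: "open N" "p \<in> N"
      unfolding N_def using D1[OF w] D1[OF maw]
      by (auto intro!: open_Int open_vimage oD continuous_intros)
    obtain N' where N': "open N'" "p \<in> N'" "\<And>h. h \<in> N' \<Longrightarrow> h \<in> N \<and> (a, m (w, h)) \<in> D"
    proof -
      have "continuous_on N (\<lambda>h. m (w, h))"
        by (intro continuous_on_compose2[OF smooth_on_continuous[OF sm]] continuous_intros) (auto simp: N_def)
      then have "continuous_on N (\<lambda>h. (a, m (w, h)))" by (intro continuous_intros)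
      from continuous_open_preimage[OF this N(1) oD]
      have "open (N \<inter> (\<lambda>h. (a, m (w, h))) -` D)" .
      then show ?thesis using N(2) aw D1[OF w] by (intro that[of "N \<inter> (\<lambda>h. (a, m (w, h))) -` D"]) auto
    qed
    have assoc: "m (a, m (w, h)) = m (m (a, w), h)" if "h \<in> N'" for h
    proof -
      have "(w, h) \<in> D" using N'(3)[OF that] by (simp add: N_def)
      then show ?thesis using im(1)[of w h] im(1)[OF aw] by (simp add: m m_assoc)
    qed
    have "((\<lambda>w'. m (a, w')) has_derivative m' a w) (at (m (w, p)))"
      using dm(1)[OF aw] D1(2)[OF w] by simp
    from has_derivative_compose[OF dm(1)[OF D1(1)[OF w]] this]
    have "((\<lambda>h. m (a, m (w, h))) has_derivative (\<lambda>h. m' a w (m' w p h))) (at p)" .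
    then have "((\<lambda>h. m (m (a, w), h)) has_derivative (\<lambda>h. m' a w (m' w p h))) (at p)"
      by (rule has_derivative_transform_within_open[OF _ N'(1,2)]) (rule assoc)
    from frechet_derivative_eqI[OF this] show ?thesis by (simp add: \<xi>_def m'_def)
  qed
  obtain r K where r: "r > 0" "cball p r \<subseteq> \<phi> ` U"
    "\<And>u w. u \<in> cball p r \<Longrightarrow> w \<in> cball p r \<Longrightarrow> norm (\<xi> u - \<xi> w) \<le> K * norm (u - w)"
    by (rule smooth_locally_lipschitz[OF model_basis chart(2)[OF c(1)] p(1) \<xi>_smooth]) (rule that)
  obtain e y where y: "e > 0" "y 0 = p" "\<And>t. y t \<in> cball p r" "continuous_on UNIV y"
    "\<And>t. \<bar>t\<bar> < e \<Longrightarrow> (y has_vector_derivative \<xi> (y t)) (at t)"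
    by (rule ode_solution[where p = p and \<xi> = \<xi>, OF model_basis r(1) r(3)]) (assumption | rule that)+
  have yU: "y t \<in> \<phi> ` U" for t using y(3) r(2) by blast
  have y_smooth: "smooth_on {-e<..<e} y"
    by (rule ode_solution_smooth[OF model_basis chart(2)[OF c(1)] \<xi>_smooth y(5) yU])
  \<comment> \<open>Products of two points of the curve must stay in the ball where the Lipschitz
    estimate holds, and s + t must stay in the interval of the solution, whence e / 2.\<close>
  obtain d where d: "d > 0" "d \<le> e / 2"
    "\<And>s t. \<bar>s\<bar> < d \<Longrightarrow> \<bar>t\<bar> < d \<Longrightarrow> (y s, y t) \<in> D \<and> m (y s, y t) \<in> ball p r"
  proof -
    define W where "W = D \<inter> m -` ball p r"
    have oW: "open W" unfolding W_def
      by (intro continuous_open_preimage smooth_on_continuous sm oD open_ball)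
    have "(p, p) \<in> W" using D1[OF p(1)] r(1) by (simp add: W_def)
    have "continuous_on UNIV (\<lambda>z. (y (fst z), y (snd z)))"
      by (intro continuous_on_Pair continuous_on_compose2[OF y(4)] continuous_intros) auto
    then have "open ((\<lambda>z. (y (fst z), y (snd z))) -` W)" using oW by (simp add: open_vimage)
    moreover have "(0, 0) \<in> (\<lambda>z. (y (fst z), y (snd z))) -` W" using \<open>(p, p) \<in> W\<close> y(2) by simp
    ultimately obtain A B where AB: "open A" "open B" "(0::real) \<in> A" "(0::real) \<in> B"
      "A \<times> B \<subseteq> (\<lambda>z. (y (fst z), y (snd z))) -` W" by (rule open_prod_elim) (rule that, auto)
    obtain a where a: "a > 0" "ball 0 a \<subseteq> A" using openE[OF AB(1,3)] .
    obtain b where b: "b > 0" "ball 0 b \<subseteq> B" using openE[OF AB(2,4)] .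
    show ?thesis
    proof (rule that[of "min (min a b) (e / 2)"])
      fix s t :: real assume "\<bar>s\<bar> < min (min a b) (e / 2)" "\<bar>t\<bar> < min (min a b) (e / 2)"
      then have "s \<in> ball 0 a" "t \<in> ball 0 b" by auto
      then have "s \<in> A" "t \<in> B" using a(2) b(2) by blast+
      then have "(y s, y t) \<in> W" using AB(5) by auto
      then show "(y s, y t) \<in> D \<and> m (y s, y t) \<in> ball p r" by (simp add: W_def)
    qed (use a b y in auto)
  qed
  have hom: "y (s + t) = m (y s, y t)" if s: "\<bar>s\<bar> < d" and t: "\<bar>t\<bar> < d" for s t
  proof (rule ode_unique[where x = "\<lambda>t. y (s + t)" and y = "\<lambda>t. m (y s, y t)" and d = d and \<xi> = \<xi> and K = K])
    show "y (s + 0) = m (y s, y 0)" using y(2) D1(2)[OF yU] by simp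
    fix t assume t: "\<bar>t\<bar> < d"
    have "((\<lambda>t. s + t) has_vector_derivative 1) (at t)" by (auto intro!: derivative_eq_intros)
    from vector_diff_chain_at[OF this, of y "\<xi> (y (s + t))"]
    show "((\<lambda>t. y (s + t)) has_vector_derivative \<xi> (y (s + t))) (at t)"
      using y(5)[of "s + t"] s t d(2) by (simp add: o_def)
    have "(y has_derivative (\<lambda>h. h *\<^sub>R \<xi> (y t))) (at t)"
      using y(5)[of t] t d(2) y(1) by (simp add: has_vector_derivative_def)
    note yd = this and D3 = d(3)[OF s t]
    from D3 have D4: "(y s, y t) \<in> D" by blast
    from has_derivative_compose[OF yd dm(1)[OF D4]]
    have "((\<lambda>t. m (y s, y t)) has_derivative (\<lambda>h. m' (y s) (y t) (h *\<^sub>R \<xi> (y t)))) (at t)" .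
    moreover have "m' (y s) (y t) (h *\<^sub>R \<xi> (y t)) = h *\<^sub>R \<xi> (m (y s, y t))" for h
      using linear_scale[OF has_derivative_linear[OF dm(1)[OF D4]]] \<xi>_left_invariant[OF D4] by simp
    ultimately show "((\<lambda>t. m (y s, y t)) has_vector_derivative \<xi> (m (y s, y t))) (at t)"
      by (simp add: has_vector_derivative_def)
    show "norm (\<xi> (y (s + t)) - \<xi> (m (y s, y t))) \<le> K * norm (y (s + t) - m (y s, y t))"
      using D3 ball_subset_cball by (intro r(3) y(3)) blast
  qed (rule t)
  show ?thesis
  proof (rule that[of d U \<phi> y "\<lambda>t. ?i (y t)"])
    show "d > 0" "(U, \<phi>) \<in> charts G" using d c by auto
    show "smooth_on {-d<..<d} y" using d by (intro smooth_on_subset[OF y_smooth]) auto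
    show "?i (y (s + t)) = ?i (y s) \<otimes> ?i (y t)" if "\<bar>s\<bar> < d" "\<bar>t\<bar> < d" for s t
      using hom[OF that] d(3)[OF that] im(1) by simp
    show "y t \<in> \<phi> ` U \<and> ?i (y t) = ?i (y t)" if "\<bar>t\<bar> < d" for t using yU by simp
    fix f assume f: "f \<in> Cinf G"
    have "(y has_derivative (\<lambda>h. h *\<^sub>R v)) (at 0)"
      using y(5)[of 0] y(1,2) \<xi>p by (simp add: has_vector_derivative_def)
    from has_derivative_compose[OF this Cinf_derivative[OF f c(1) p(1), folded y(2)]]
    have "((\<lambda>t. f (?i (y t))) has_derivative (\<lambda>h. frechet_derivative (\<lambda>u. f (?i u)) (at p) (h *\<^sub>R v))) (at 0)"
      by (simp add: y(2))
    moreover have "frechet_derivative (\<lambda>u. f (?i u)) (at p) (h *\<^sub>R v) = lf x f \<one> * h" for h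
      using linear_scale[OF has_derivative_linear[OF Cinf_derivative[OF f c(1) p(1)]]] \<eta>[OF f p(1)] p(2)
      by (simp add: v_def)
    ultimately show "((\<lambda>t. f (?i (y t))) has_field_derivative lf x f \<one>) (at 0)"
      by (simp add: has_field_derivative_def)
  qed
qed

text \<open>Any two admissible denominators give the same value by comparison with their product.
  Additivity holds because c(s/n) and c(t/n) commute: both products equal c((s + t)/n).\<close>

lemma one_parameter_extension:
  assumes d: "d > 0" and c: "\<And>s t. \<bar>s\<bar> < d \<Longrightarrow> \<bar>t\<bar> < d \<Longrightarrow> c (s + t) = c s \<otimes> c t"
  obtains C :: "real \<Rightarrow> 'g" where "\<And>s t. C (s + t) = C s \<otimes> C t" "\<And>t. \<bar>t\<bar> < d \<Longrightarrow> C t = c t"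
proof -
  have c0: "c 0 = \<one>"
  proof -
    have "c 0 \<otimes> c 0 = c 0 \<otimes> \<one>" using c[of 0 0] d by simp
    then show ?thesis by simp
  qed
  have frac: "c t = c (t / k) [^] k" if t: "\<bar>t\<bar> < d" and k: "k > 0" for t and k :: nat
  proof -
    have "c (j * t / k) = c (t / k) [^] j" if "j \<le> k" for j
      using that
    proof (induction j)
      case (Suc j)
      have "\<bar>j * t / k\<bar> \<le> \<bar>t\<bar>"
      proof -
        have "real j * \<bar>t\<bar> \<le> k * \<bar>t\<bar>" using Suc.prems by (intro mult_right_mono) auto
        then show ?thesis using k by (simp add: abs_mult field_simps)
      qed
      moreover have "\<bar>t / k\<bar> \<le> \<bar>t\<bar>"
      proof -
        have "1 * \<bar>t\<bar> \<le> k * \<bar>t\<bar>" using k by (intro mult_right_mono) auto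
        then show ?thesis using k by (simp add: field_simps)
      qed
      ultimately have "c (j * t / k + t / k) = c (j * t / k) \<otimes> c (t / k)" using t by (intro c) auto
      moreover have "j * t / k + t / k = Suc j * t / k" by (simp add: algebra_simps add_divide_distrib)
      ultimately show ?case using Suc by simp
    qed (simp add: c0)
    from this[of k] show ?thesis using k by simp
  qed
  define N where "N t = (SOME n::nat. (0::nat) < n \<and> \<bar>t / n\<bar> < d)" for t
  have N_ex: "\<exists>n::nat. (0::nat) < n \<and> \<bar>s / n\<bar> < d \<and> \<bar>t / n\<bar> < d \<and> \<bar>(s + t) / n\<bar> < d" for s t
  proof -
    obtain n :: nat where n: "(\<bar>s\<bar> + \<bar>t\<bar>) / d < n" using reals_Archimedean2 by blast
    have "0 \<le> (\<bar>s\<bar> + \<bar>t\<bar>) / d" using d by simp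
    then have n0: "real n > 0" using n by linarith
    have "(\<bar>s\<bar> + \<bar>t\<bar>) / n < d" using n d n0 by (simp add: field_simps)
    moreover have "\<bar>a\<bar> \<le> \<bar>s\<bar> + \<bar>t\<bar> \<Longrightarrow> \<bar>a / n\<bar> \<le> (\<bar>s\<bar> + \<bar>t\<bar>) / n" for a
      using n0 by (simp add: divide_right_mono)
    note this[of s] this[of t] this[OF abs_triangle_ineq]
    ultimately show ?thesis using n0 by (intro exI[of _ n]) auto
  qed
  have N: "N t > 0" "\<bar>t / N t\<bar> < d" for t
    using someI_ex[of "\<lambda>n::nat. (0::nat) < n \<and> \<bar>t / n\<bar> < d"] N_ex[of t 0] unfolding N_def by auto
  define C where "C t = c (t / N t) [^] N t" for t
  have C: "C t = c (t / n) [^] n" if n: "n > 0" "\<bar>t / n\<bar> < d" for t and n :: nat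
  proof -
    have "C t = c (t / N t / n) [^] (n * N t)"
      using frac[OF N(2)[of t] n(1)] by (simp add: C_def nat_pow_pow)
    also have "\<dots> = c (t / n / N t) [^] (N t * n)" by (simp add: mult.commute)
    also have "\<dots> = c (t / n) [^] n" using frac[OF n(2) N(1)[of t]] by (simp add: nat_pow_pow)
    finally show ?thesis .
  qed
  show ?thesis
  proof (rule that)
    fix s t
    obtain n :: nat where n: "n > 0" "\<bar>s / n\<bar> < d" "\<bar>t / n\<bar> < d" "\<bar>(s + t) / n\<bar> < d" using N_ex by blast
    have "c (s / n) \<otimes> c (t / n) = c (t / n) \<otimes> c (s / n)"
      using c[OF n(2,3)] c[OF n(3,2)] by (simp add: add.commute)
    then have "(c (s / n) \<otimes> c (t / n)) [^] n = c (s / n) [^] n \<otimes> c (t / n) [^] n"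
      by (intro pow_mult_distrib) auto
    then show "C (s + t) = C s \<otimes> C t"
      using c[OF n(2,3)] by (simp add: C[OF n(1,2)] C[OF n(1,3)] C[OF n(1,4)] add_divide_distrib)
    show "C t = c t" if "\<bar>t\<bar> < d" for t using C[of 1 t] that by simp
  qed
qed

lemma smooth_curve_iff:
  "smooth_map id_atlas (charts G) C \<longleftrightarrow> continuous_on UNIV C \<and>
    (\<forall>(V, \<psi>)\<in>charts G. smooth_on (C -` V) (\<lambda>t :: real. \<psi> (C t)))"
proof -
  have "inv_into UNIV (\<lambda>t::real. t) = (\<lambda>t. t)" using inv_id by (simp add: id_def)
  then show ?thesis by (simp add: smooth_map_def id_atlas_def o_def)
qed

text \<open>Around any t0 the extended curve is the left translate by C(t0) of the local smooth
  piece, so smoothness everywhere follows from smoothness of multiplication.\<close>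

lemma one_parameter_exists:
  "\<exists>C. one_parameter_subgroup G C \<and>
    (\<forall>f\<in>Cinf G. ((\<lambda>t. f (C t)) has_field_derivative lf x f \<one>) (at 0))"
proof -
  obtain c :: "real \<Rightarrow> 'g" and d U \<phi> y where d: "d > 0" and ch: "(U, \<phi>) \<in> charts G" and y: "smooth_on {-d<..<d} y"
    "\<And>t. \<bar>t\<bar> < d \<Longrightarrow> y t \<in> \<phi> ` U \<and> c t = inv_into U \<phi> (y t)"
    and c: "\<And>s t. \<bar>s\<bar> < d \<Longrightarrow> \<bar>t\<bar> < d \<Longrightarrow> c (s + t) = c s \<otimes> c t"
    and der: "\<And>f. f \<in> Cinf G \<Longrightarrow> ((\<lambda>t. f (c t)) has_field_derivative lf x f \<one>) (at 0)"
    by (rule local_one_parameter[of x]) (assumption | rule that)+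
  obtain C where C: "\<And>s t. C (s + t) = C s \<otimes> C t" "\<And>t. \<bar>t\<bar> < d \<Longrightarrow> C t = c t"
    by (rule one_parameter_extension[where c = c, OF d c]) (assumption | rule that)+
  have near: "C t = C t0 \<otimes> inv_into U \<phi> (y (t - t0))" "y (t - t0) \<in> \<phi> ` U" if "t \<in> {t0 - d<..<t0 + d}" for t t0
  proof -
    have *: "\<bar>t - t0\<bar> < d" using that by auto
    have "C t = C (t0 + (t - t0))" by simp
    also have "\<dots> = C t0 \<otimes> C (t - t0)" by (rule C(1))
    finally show "C t = C t0 \<otimes> inv_into U \<phi> (y (t - t0))" "y (t - t0) \<in> \<phi> ` U"
      using C(2)[OF *] y(2)[OF *] by simp_all
  qed
  have y_shift: "smooth_on {t0 - d<..<t0 + d} (\<lambda>t. y (t - t0))" for t0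
  proof -
    have "smooth_on {t0 - d<..<t0 + d} (\<lambda>t. t + - t0)"
      by (intro smooth_on_add smooth_on_ident smooth_on_const) auto
    from smooth_on_compose[OF frame_basis_real _ this y(1)]
    have "smooth_on {t0 - d<..<t0 + d} (\<lambda>t. y (t + - t0))" by fastforce
    then show ?thesis by simp
  qed
  have contC: "continuous_on UNIV C"
  proof -
    have "continuous (at t0) C" for t0
    proof -
      let ?I = "{t0 - d<..<t0 + d}"
      have "continuous_on ?I (\<lambda>t. inv_into U \<phi> (y (t - t0)))"
        using near(2) by (intro continuous_on_compose2[OF chart(4)[OF ch] smooth_on_continuous[OF y_shift]]) blast
      then have "continuous_on ?I (\<lambda>t. C t0 \<otimes> inv_into U \<phi> (y (t - t0)))"
        using continuous_on_compose2[OF continuous_group_mult, of ?I "\<lambda>t. (C t0, inv_into U \<phi> (y (t - t0)))"]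
        by (simp add: continuous_on_Pair)
      then have "continuous_on ?I C" using near(1) by (subst continuous_on_cong[OF refl]) auto
      then show ?thesis using d by (simp add: continuous_on_eq_continuous_at)
    qed
    then show ?thesis by (simp add: continuous_at_imp_continuous_on)
  qed
  have smC: "smooth_on (C -` V) (\<lambda>t. \<psi> (C t))" if V: "(V, \<psi>) \<in> charts G" for V \<psi>
  proof (rule smooth_on_local)
    fix t0 assume t0: "t0 \<in> C -` V"
    obtain A \<alpha> where A: "(A, \<alpha>) \<in> charts G" "C t0 \<in> A" using chart_at .
    define T where "T = {t0 - d<..<t0 + d} \<inter> C -` V"
    have T: "open T" "t0 \<in> T" unfolding T_def
      using t0 d open_vimage[OF chart(1)[OF V] contC] by (auto intro: open_Int)
    have sub: "(\<alpha> (C t0), y (t - t0)) \<in> mult_dom A \<alpha> U \<phi> V" if "t \<in> T" for t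
      using that near[of t t0] A chart(5)[OF A] by (auto simp: T_def mult_dom_def)
    have "smooth_on T (\<lambda>t. (\<alpha> (C t0), y (t - t0)))"
      by (intro smooth_on_Pair smooth_on_const T smooth_on_subset[OF y_shift]) (auto simp: T_def)
    from smooth_on_compose[OF model_basis2 T(1) this smooth_mult_chart[OF A(1) ch V]]
    have "smooth_on T (\<lambda>t. mult_chart A \<alpha> U \<phi> \<psi> (\<alpha> (C t0), y (t - t0)))" using sub by blast
    then have "smooth_on T (\<lambda>t. \<psi> (C t))"
      by (rule smooth_on_cong[THEN iffD1, OF T(1), rotated])
        (use near(1) in \<open>auto simp: mult_chart_def T_def chart(5)[OF A]\<close>)
    then show "\<exists>T. open T \<and> t0 \<in> T \<and> smooth_on T (\<lambda>t. \<psi> (C t))" using T by blast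
  qed
  have "((\<lambda>t. f (C t)) has_field_derivative lf x f \<one>) (at 0)" if "f \<in> Cinf G" for f
    by (rule has_field_derivative_transform_within_open[OF der[OF that], of "{-d<..<d}"])
      (use d C(2) in auto)
  moreover have "one_parameter_subgroup G C"
    unfolding one_parameter_subgroup_def smooth_curve_iff using contC smC C(1) by auto
  ultimately show ?thesis by blast
qed

lemma one_parameter_scale:
  assumes C: "one_parameter_subgroup G C"
    and der: "\<forall>f\<in>Cinf G. ((\<lambda>t. f (C t)) has_field_derivative lf x f \<one>) (at 0)"
  shows "one_parameter_subgroup G (\<lambda>t. C (t * k))"
    and "\<forall>f\<in>Cinf G. ((\<lambda>t. f (C (t * k))) has_field_derivative lf (k *\<^sub>R x) f \<one>) (at 0)"
proof -
  have C': "continuous_on UNIV C" "\<And>V \<psi>. (V, \<psi>) \<in> charts G \<Longrightarrow> smooth_on (C -` V) (\<lambda>t. \<psi> (C t))"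
    "\<And>s t. C (s + t) = C s \<otimes> C t"
    using C unfolding one_parameter_subgroup_def smooth_curve_iff by auto
  have cont: "continuous_on UNIV (\<lambda>t. C (t * k))"
    by (intro continuous_on_compose2[OF C'(1)] continuous_intros) auto
  moreover have "smooth_on ((\<lambda>t. C (t * k)) -` V) (\<lambda>t. \<psi> (C (t * k)))" if V: "(V, \<psi>) \<in> charts G" for V \<psi>
  proof -
    have o: "open ((\<lambda>t. C (t * k)) -` V)" by (rule open_vimage[OF chart(1)[OF V] cont])
    have "smooth_on ((\<lambda>t. C (t * k)) -` V) (\<lambda>t. t * k)"
      by (intro smooth_on_mult smooth_on_ident smooth_on_const o)
    from smooth_on_compose[OF frame_basis_real o this C'(2)[OF V]] show ?thesis by auto
  qed
  ultimately show "one_parameter_subgroup G (\<lambda>t. C (t * k))"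
    unfolding one_parameter_subgroup_def smooth_curve_iff using C'(3) by (auto simp: algebra_simps)
  show "\<forall>f\<in>Cinf G. ((\<lambda>t. f (C (t * k))) has_field_derivative lf (k *\<^sub>R x) f \<one>) (at 0)"
  proof
    fix f assume "f \<in> Cinf G"
    then have "((\<lambda>t. f (C t)) has_field_derivative lf x f \<one>) (at (0 * k))" using der by simp
    moreover have "((\<lambda>t. t * k) has_field_derivative k) (at 0)" by (auto intro!: derivative_eq_intros)
    ultimately have "((\<lambda>t. f (C (t * k))) has_field_derivative lf x f \<one> * k) (at 0)"
      by (rule DERIV_chain2[where f = "\<lambda>t. f (C t)" and g = "\<lambda>t. t * k"])
    then show "((\<lambda>t. f (C (t * k))) has_field_derivative lf (k *\<^sub>R x) f \<one>) (at 0)"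
      by (simp add: lf_scale mult.commute)
  qed
qed

text \<open>Choosing one vector on each line makes the choices of one-parameter subgroups compatible with
  scaling, so that no uniqueness statement is needed.\<close>

lemma exponential_exists:
  "\<exists>E. \<forall>x. one_parameter_subgroup G (\<lambda>t. E (t *\<^sub>R x)) \<and>
     (\<forall>f\<in>Cinf G. ((\<lambda>t. f (E (t *\<^sub>R x))) has_field_derivative lf x f \<one>) (at 0))"
proof -
  obtain C where C: "\<And>x. one_parameter_subgroup G (C x)"
    "\<And>x. \<forall>f\<in>Cinf G. ((\<lambda>t. f (C x t)) has_field_derivative lf x f \<one>) (at 0)"
    using one_parameter_exists by metis
  define line where "line x = {s *\<^sub>R x | s. s \<noteq> 0}" for x :: 'v
  define rep where "rep x = (SOME z. z \<in> line x)" for x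
  \<comment> \<open>For x = 0 the representative is 0 and every coefficient would do; it is fixed as
    0, so that \<open>E 0\<close> is the identity.\<close>
  define k where "k x = (SOME s. x = s *\<^sub>R rep x \<and> (x = 0 \<longrightarrow> s = 0))" for x
  have line_scale: "line (t *\<^sub>R x) = line x" if "t \<noteq> 0" for t x
  proof -
    have "s *\<^sub>R x \<in> line (t *\<^sub>R x)" if "s \<noteq> 0" for s
      unfolding line_def using that \<open>t \<noteq> 0\<close> by (auto intro!: exI[of _ "s / t"])
    moreover have "s *\<^sub>R (t *\<^sub>R x) \<in> line x" if "s \<noteq> 0" for s
      unfolding line_def using that \<open>t \<noteq> 0\<close> by (auto intro!: exI[of _ "s * t"])
    ultimately show ?thesis by (auto simp: line_def[of x] line_def[of "t *\<^sub>R x"])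
  qed
  have "x \<in> line x" for x by (auto simp: line_def intro: exI[of _ 1])
  then have rep: "rep x \<in> line x" for x unfolding rep_def by (metis someI)
  have k: "x = k x *\<^sub>R rep x \<and> (x = 0 \<longrightarrow> k x = 0)" for x
    unfolding k_def
  proof (rule someI_ex)
    obtain s where s: "s \<noteq> 0" "rep x = s *\<^sub>R x" using rep[of x] by (auto simp: line_def)
    then show "\<exists>s. x = s *\<^sub>R rep x \<and> (x = 0 \<longrightarrow> s = 0)"
      by (cases "x = 0") (auto intro: exI[of _ "1 / s"] exI[of _ 0])
  qed
  define E where "E x = C (rep x) (k x)" for x
  have C0: "C x 0 = \<one>" for x
  proof -
    have "C x (0 + 0) = C x 0 \<otimes> C x 0" using C(1)[of x] unfolding one_parameter_subgroup_def by blast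
    then have "C x 0 \<otimes> C x 0 = C x 0 \<otimes> \<one>" by simp
    then show ?thesis by simp
  qed
  have E: "E (t *\<^sub>R x) = C (rep x) (t * k x)" for t x
  proof (cases "t = 0 \<or> x = 0")
    case True
    then have "k (t *\<^sub>R x) = 0" "t * k x = 0" using k[of "t *\<^sub>R x"] k[of x] by auto
    then show ?thesis by (simp only: E_def C0)
  next
    case False
    then have r: "rep (t *\<^sub>R x) = rep x" by (simp add: rep_def line_scale)
    have "k (t *\<^sub>R x) *\<^sub>R rep x = t *\<^sub>R x" using k[of "t *\<^sub>R x"] r by simp
    also have "\<dots> = (t * k x) *\<^sub>R rep x" using k[of x] by (metis scaleR_scaleR)
    finally have "k (t *\<^sub>R x) = t * k x" using k[of x] False by auto
    then show ?thesis by (simp add: E_def r)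
  qed
  show ?thesis
  proof (intro exI[of _ E] allI)
    fix x
    show "one_parameter_subgroup G (\<lambda>t. E (t *\<^sub>R x)) \<and>
       (\<forall>f\<in>Cinf G. ((\<lambda>t. f (E (t *\<^sub>R x))) has_field_derivative lf x f \<one>) (at 0))"
      using one_parameter_scale[OF C(1) C(2), of "rep x" "k x"] k[of x] unfolding E by metis
  qed
qed

lemma lie_exp:
  "one_parameter_subgroup G (\<lambda>t. lie_exp G (t *\<^sub>R x))"
  "f \<in> Cinf G \<Longrightarrow> ((\<lambda>t. f (lie_exp G (t *\<^sub>R x))) has_field_derivative lf x f \<one>) (at 0)"
  using someI_ex[OF exponential_exists] unfolding lie_exp_def by blast+

end

section \<open>Left-trivialised Poisson tensor\<close>

context poisson_lie_group
begin

abbreviation br :: "('g \<Rightarrow> real) \<Rightarrow> ('g \<Rightarrow> real) \<Rightarrow> 'g \<Rightarrow> real" where "br \<equiv> pbracket G"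

text \<open>\<open>ltensor\<close> is the Poisson tensor and \<open>dl f\<close> the differential of \<open>f\<close> in the left trivialisation.\<close>

definition ltensor :: "('v \<Rightarrow>\<^sub>L real) \<Rightarrow> ('v \<Rightarrow>\<^sub>L real) \<Rightarrow> 'g \<Rightarrow> real" where
  "ltensor \<phi> \<psi> = bivector G (om \<phi>) (om \<psi>)"

definition covector :: "'g form \<Rightarrow> 'g \<Rightarrow> ('v \<Rightarrow>\<^sub>L real)" where
  "covector \<tau> p = Blinfun (\<lambda>x. \<tau> (lf x) p)"

definition dl :: "('g \<Rightarrow> real) \<Rightarrow> 'g \<Rightarrow> ('v \<Rightarrow>\<^sub>L real)" where
  "dl f p = Blinfun (\<lambda>x. lf x f p)"

lemma dl_apply: "dl f p x = lf x f p"
  by (simp add: dl_def linear_functional_apply[OF lf_linear])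

lemma form_lf_linear:
  assumes \<tau>: "\<tau> \<in> forms G"
  shows "linear (\<lambda>x. \<tau> (lf x) p)"
proof (rule linearI)
  show "\<tau> (lf (x + y)) p = \<tau> (lf x) p + \<tau> (lf y) p" for x y
    using formsD(3)[OF \<tau> lf_vfield[of x] lf_vfield[of y]] by (simp only: left_field_add plus_fun_apply)
  show "\<tau> (lf (r *\<^sub>R x)) p = r *\<^sub>R \<tau> (lf x) p" for r x
    using formsD(4)[OF \<tau> Cinf_const[of r] lf_vfield[of x]] by (simp only: left_field_scale) (simp add: const_def)
qed

lemma covector_apply: "\<tau> \<in> forms G \<Longrightarrow> covector \<tau> p x = \<tau> (lf x) p"
  by (simp add: covector_def linear_functional_apply[OF form_lf_linear])

lemma bivector_rules:
  assumes "\<sigma> \<in> forms G" "\<tau> \<in> forms G"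
  shows "bivector G \<sigma> \<tau> \<in> Cinf G" "bivector G \<sigma> \<tau> p = - bivector G \<tau> \<sigma> p"
    "\<rho> \<in> forms G \<Longrightarrow> bivector G \<sigma> (\<tau> + \<rho>) p = bivector G \<sigma> \<tau> p + bivector G \<sigma> \<rho> p"
    "a \<in> Cinf G \<Longrightarrow> bivector G \<sigma> (a \<cdot> \<tau>) p = a p * bivector G \<sigma> \<tau> p"
proof -
  note b = bivector[unfolded bivector_on_def]
  show "bivector G \<sigma> \<tau> \<in> Cinf G" using b assms by blast
  have "bivector G \<sigma> \<tau> = - bivector G \<tau> \<sigma>" using b assms by blast
  then show "bivector G \<sigma> \<tau> p = - bivector G \<tau> \<sigma> p" by simp
  show "bivector G \<sigma> (\<tau> + \<rho>) p = bivector G \<sigma> \<tau> p + bivector G \<sigma> \<rho> p" if "\<rho> \<in> forms G"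
  proof -
    have "bivector G \<sigma> (\<tau> + \<rho>) = bivector G \<sigma> \<tau> + bivector G \<sigma> \<rho>" using b assms that by blast
    then show ?thesis by simp
  qed
  show "bivector G \<sigma> (a \<cdot> \<tau>) p = a p * bivector G \<sigma> \<tau> p" if "a \<in> Cinf G"
  proof -
    have "bivector G \<sigma> (a \<cdot> \<tau>) = a * bivector G \<sigma> \<tau>" using b assms that by blast
    then show ?thesis by simp
  qed
qed

lemma bivector_sum:
  assumes \<sigma>: "\<sigma> \<in> forms G"
  shows "finite I \<Longrightarrow> (\<And>i. i \<in> I \<Longrightarrow> \<tau> i \<in> forms G) \<Longrightarrow>
    bivector G \<sigma> (sum \<tau> I) p = (\<Sum>i\<in>I. bivector G \<sigma> (\<tau> i) p)"
proof (induction I rule: finite_induct)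
  case empty
  have "bivector G \<sigma> (0 + 0) p = bivector G \<sigma> 0 p + bivector G \<sigma> 0 p"
    by (rule bivector_rules(3)[OF \<sigma> forms_zero forms_zero])
  then have "bivector G \<sigma> 0 p = 0" by (simp only: add_0_right)
  then show ?case by (simp only: sum.empty)
next
  case (insert i I)
  have "bivector G \<sigma> (\<tau> i + sum \<tau> I) p = bivector G \<sigma> (\<tau> i) p + bivector G \<sigma> (sum \<tau> I) p"
    using insert.prems by (intro bivector_rules(3)[OF \<sigma>] forms_sum) auto
  moreover have "bivector G \<sigma> (sum \<tau> I) p = (\<Sum>i\<in>I. bivector G \<sigma> (\<tau> i) p)" using insert by auto
  ultimately show ?case by (simp only: sum.insert[OF insert.hyps])
qed

lemma bivector_right_expansion:
  assumes "\<sigma> \<in> forms G" "\<tau> \<in> forms G"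
  shows "bivector G \<sigma> \<tau> p = (\<Sum>k<dm. \<tau> (lf (eb k)) p * bivector G \<sigma> (om (fb k)) p)"
proof -
  have *: "\<tau> (lf (eb k)) \<cdot> om (fb k) \<in> forms G" for k
    by (intro forms_fscale formsD(2)[OF assms(2)] lf_vfield om_form)
  have "bivector G \<sigma> \<tau> p = bivector G \<sigma> (\<Sum>k<dm. \<tau> (lf (eb k)) \<cdot> om (fb k)) p"
    using form_expansion[OF assms(2)] by simp
  also have "\<dots> = (\<Sum>k<dm. bivector G \<sigma> (\<tau> (lf (eb k)) \<cdot> om (fb k)) p)"
    by (rule bivector_sum[OF assms(1)]) (auto intro: *)
  also have "\<dots> = (\<Sum>k<dm. \<tau> (lf (eb k)) p * bivector G \<sigma> (om (fb k)) p)"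
    by (intro sum.cong refl bivector_rules(4)[OF assms(1) om_form] formsD(2)[OF assms(2)] lf_vfield)
  finally show ?thesis .
qed

text \<open>\<open>bivector_on\<close> provides linearity in the second argument; antisymmetry
  transfers it to the first.\<close>

lemma bivector_expansion:
  assumes "\<sigma> \<in> forms G" "\<tau> \<in> forms G"
  shows "bivector G \<sigma> \<tau> p =
    (\<Sum>k<dm. \<Sum>l<dm. \<sigma> (lf (eb k)) p * \<tau> (lf (eb l)) p * ltensor (fb k) (fb l) p)"
proof -
  have "bivector G \<sigma> (om \<psi>) p = (\<Sum>k<dm. \<sigma> (lf (eb k)) p * bivector G (om (fb k)) (om \<psi>) p)" for \<psi>
  proof -
    have "bivector G \<sigma> (om \<psi>) p = - (\<Sum>k<dm. \<sigma> (lf (eb k)) p * bivector G (om \<psi>) (om (fb k)) p)"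
      using bivector_rules(2)[OF assms(1) om_form] bivector_right_expansion[OF om_form assms(1)] by simp
    also have "\<dots> = (\<Sum>k<dm. \<sigma> (lf (eb k)) p * - bivector G (om \<psi>) (om (fb k)) p)"
      by (simp add: sum_negf)
    also have "\<dots> = (\<Sum>k<dm. \<sigma> (lf (eb k)) p * bivector G (om (fb k)) (om \<psi>) p)"
      by (simp only: bivector_rules(2)[OF om_form om_form, of _ \<psi>])
    finally show ?thesis .
  qed
  then have "bivector G \<sigma> \<tau> p = (\<Sum>l<dm. \<Sum>k<dm. \<sigma> (lf (eb k)) p * \<tau> (lf (eb l)) p * ltensor (fb k) (fb l) p)"
    by (simp add: bivector_right_expansion[OF assms] sum_distrib_left ltensor_def mult_ac)
  then show ?thesis by (subst sum.swap)
qed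

lemma ltensor_Cinf: "ltensor \<phi> \<psi> \<in> Cinf G"
  unfolding ltensor_def by (rule bivector_rules(1)[OF om_form om_form])

lemma ltensor_antisym: "ltensor \<phi> \<psi> p = - ltensor \<psi> \<phi> p"
  unfolding ltensor_def by (rule bivector_rules(2)[OF om_form om_form])

lemma ltensor_expansion:
  "ltensor \<phi> \<psi> p = (\<Sum>k<dm. \<Sum>l<dm. \<phi> (eb k) * \<psi> (eb l) * ltensor (fb k) (fb l) p)"
  using bivector_expansion[OF om_form om_form, of \<phi> \<psi> p] by (simp add: ltensor_def om_lf const_def)

lemma ltensor_linear_right: "linear (\<lambda>\<psi>. ltensor \<phi> \<psi> p)"
  unfolding ltensor_expansion[of \<phi>]
  by (rule linearI) (simp_all add: blinfun.add_left blinfun.scaleR_left algebra_simps sum.distrib sum_distrib_left)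

lemma br_dl: "a \<in> Cinf G \<Longrightarrow> b \<in> Cinf G \<Longrightarrow> br a b p = ltensor (dl a p) (dl b p) p"
  using bivector_expansion[OF ext_d_form ext_d_form, of a b p] ltensor_expansion[of "dl a p" "dl b p" p]
  by (simp add: pbracket_bivector ext_d_lf dl_apply)

lemma br_expansion:
  "a \<in> Cinf G \<Longrightarrow> b \<in> Cinf G \<Longrightarrow>
    br a b p = (\<Sum>k<dm. \<Sum>l<dm. lf (eb k) a p * lf (eb l) b p * ltensor (fb k) (fb l) p)"
  using ltensor_expansion[of "dl a p" "dl b p" p] by (simp add: dl_apply br_dl)

lemma br_Cinf: "a \<in> Cinf G \<Longrightarrow> b \<in> Cinf G \<Longrightarrow> br a b \<in> Cinf G"
  using pbracket unfolding poisson_bracket_on_def by blast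

lemma br_antisym: "a \<in> Cinf G \<Longrightarrow> b \<in> Cinf G \<Longrightarrow> br a b p = - br b a p"
  using pbracket unfolding poisson_bracket_on_def by (metis fun_Compl_def)

lemma br_const: "a \<in> Cinf G \<Longrightarrow> br a (const c) p = 0"
  by (simp add: br_expansion Cinf_const vfield_const[OF lf_vfield])

text \<open>A combination of the functions \<open>ufun k\<close>, translated from the identity to
  \<open>p\<close>, has the required differential. Identities involving differentials at a point
  thereby become identities for arbitrary covectors.\<close>

lemma dl_surj:
  obtains f where "f \<in> Cinf G" "dl f p = \<alpha>"
proof -
  define f where "f = (\<Sum>k<dm. (\<lambda>q. \<alpha> (eb k) * ufun k (inv p \<otimes> q)))"
  have u: "k < dm \<Longrightarrow> (\<lambda>q. ufun k (inv p \<otimes> q)) \<in> Cinf G" for k by (intro Cinf_translate ufun)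
  have f: "f \<in> Cinf G" unfolding f_def by (intro Cinf_sum Cinf_scale u) auto
  have "lf x f p = \<alpha> x" for x
  proof -
    have "lf x f p = (\<Sum>k<dm. lf x (\<lambda>q. \<alpha> (eb k) * ufun k (inv p \<otimes> q))) p"
      unfolding f_def by (subst vfield_sum[OF lf_vfield]) (auto intro: Cinf_scale u)
    also have "\<dots> = (\<Sum>k<dm. \<alpha> (eb k) * fb k x)"
      unfolding sum_fun_apply
      by (intro sum.cong refl) (simp add: vfield_scale[OF lf_vfield u] lf_translate[OF ufun(1)] lf_ufun)
    also have "\<dots> = \<alpha> x"
      by (subst (3) dual_expansion) (simp add: blinfun.sum_left blinfun.scaleR_left)
    finally show ?thesis .
  qed
  then have "dl f p = \<alpha>" by (intro blinfun_eqI) (simp add: dl_apply)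
  then show ?thesis using that f by blast
qed

subsection \<open>Translations and multiplicativity\<close>

lemma Ad_star_apply: "Ad_star G g \<phi> x = \<phi> (Ad G (inv g) x)"
proof -
  have "linear (\<lambda>x. \<phi> (Ad G (inv g) x))"
    using linear_compose[OF Ad_linear bounded_linear.linear[OF blinfun.bounded_linear_right]]
    by (simp add: o_def)
  then show ?thesis unfolding Ad_star_def by (simp add: linear_functional_apply)
qed

text \<open>Left translation preserves coordinates in the invariant frame and merely translates the
  coefficient functions; smoothness of the pushed field is seen from this expansion.\<close>

lemma push_ltrans_vfield:
  assumes X: "X \<in> vfields G"
  shows "push_field G (ltrans G g) X \<in> vfields G"
    and "mc (push_field G (ltrans G g) X) (g \<otimes> p) = mc X p"
proof -
  have val: "push_field G (ltrans G g) X f p = lf (mc X (inv g \<otimes> p)) f p" if "f \<in> Cinf G" for f p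
    using that mc_apply[OF X Cinf_translate(1)[OF that], of "inv g \<otimes> p" g] lf_translate[OF that, of _ g "inv g \<otimes> p"]
    by (simp add: push_field_ltrans m_assoc[symmetric])
  have "push_field G (ltrans G g) X f p =
      (\<Sum>k<dm. (\<lambda>p. blinfun_apply (fb k) (mc X (inv g \<otimes> p))) \<cdot> lf (eb k)) f p" for f p
  proof (cases "f \<in> Cinf G")
    case True
    show ?thesis unfolding val[OF True]
      by (subst lf_expansion) (simp add: sum_fun_apply fscale_apply)
  qed (simp add: push_field_def lf_off sum_fun_apply fscale_apply)
  then have "push_field G (ltrans G g) X = (\<Sum>k<dm. (\<lambda>p. blinfun_apply (fb k) (mc X (inv g \<otimes> p))) \<cdot> lf (eb k))"
    by blast
  also have "\<dots> \<in> vfields G"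
    by (intro vfield_sum_closed vfield_fscale lf_vfield Cinf_translate(1)[OF mc_smooth[OF X]])
  finally show V: "push_field G (ltrans G g) X \<in> vfields G" .
  show "mc (push_field G (ltrans G g) X) (g \<otimes> p) = mc X p"
    by (rule mc_eqI[OF V]) (simp add: val m_assoc[symmetric])
qed

lemma push_rtrans_vfield:
  assumes X: "X \<in> vfields G"
  shows "push_field G (rtrans G h) X \<in> vfields G"
    and "mc (push_field G (rtrans G h) X) (p \<otimes> h) = Ad G (inv h) (mc X p)"
proof -
  have val: "push_field G (rtrans G h) X f p = lf (Ad G (inv h) (mc X (p \<otimes> inv h))) f p" if "f \<in> Cinf G" for f p
    using that mc_apply[OF X Cinf_translate(2)[OF that], of "p \<otimes> inv h" h]
      Ad_inv_apply[OF that, of _ h "p \<otimes> inv h"]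
    by (simp add: push_field_rtrans m_assoc)
  have "push_field G (rtrans G h) X f p =
      (\<Sum>k<dm. (\<lambda>p. blinfun_apply (fb k) (mc X (p \<otimes> inv h))) \<cdot> lf (Ad G (inv h) (eb k))) f p" for f p
  proof (cases "f \<in> Cinf G")
    case True
    have "linear (\<lambda>x. lf (Ad G (inv h) x) f p)"
      using linear_compose[OF Ad_linear lf_linear] by (simp add: o_def)
    from linear_expansion[OF this, of "mc X (p \<otimes> inv h)"] show ?thesis unfolding val[OF True]
      by (simp add: sum_fun_apply fscale_apply)
  qed (simp add: push_field_def lf_off sum_fun_apply fscale_apply)
  then have "push_field G (rtrans G h) X =
      (\<Sum>k<dm. (\<lambda>p. blinfun_apply (fb k) (mc X (p \<otimes> inv h))) \<cdot> lf (Ad G (inv h) (eb k)))"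
    by blast
  also have "\<dots> \<in> vfields G"
    by (intro vfield_sum_closed vfield_fscale lf_vfield Cinf_translate(2)[OF mc_smooth[OF X]])
  finally show V: "push_field G (rtrans G h) X \<in> vfields G" .
  show "mc (push_field G (rtrans G h) X) (p \<otimes> h) = Ad G (inv h) (mc X p)"
    by (rule mc_eqI[OF V]) (simp add: val m_assoc)
qed

lemma pull_om_ltrans: "pull_form G (ltrans G g) (om \<phi>) = om \<phi>"
proof (intro ext)
  fix X p
  show "pull_form G (ltrans G g) (om \<phi>) X p = om \<phi> X p"
  proof (cases "X \<in> vfields G")
    case True
    have "pull_form G (ltrans G g) (om \<phi>) X p = om \<phi> (push_field G (ltrans G g) X) (g \<otimes> p)"
      using True by (simp add: pull_form_def) (simp add: ltrans_def)
    then show ?thesis using True by (simp add: om_apply push_ltrans_vfield)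
  qed (simp add: pull_form_def left_form_def)
qed

lemma pull_om_rtrans: "pull_form G (rtrans G h) (om \<phi>) = om (Ad_star G h \<phi>)"
proof (intro ext)
  fix X p
  show "pull_form G (rtrans G h) (om \<phi>) X p = om (Ad_star G h \<phi>) X p"
  proof (cases "X \<in> vfields G")
    case True
    have "pull_form G (rtrans G h) (om \<phi>) X p = om \<phi> (push_field G (rtrans G h) X) (p \<otimes> h)"
      using True by (simp add: pull_form_def) (simp add: rtrans_def)
    then show ?thesis using True by (simp add: om_apply push_rtrans_vfield Ad_star_apply)
  qed (simp add: pull_form_def left_form_def)
qed

text \<open>Left-invariant forms are fixed by pull-back along left translations, so the push-forward
  only moves the point of evaluation.\<close>

lemma D_left_eq: "D_left G g \<phi> \<psi> = ltensor \<phi> \<psi> g"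
  unfolding D_left_def push_bivector_def pull_om_ltrans inv_into_ltrans by (simp add: ltensor_def)

text \<open>For functions with prescribed differentials at the product, varying the second factor
  leaves them unchanged in the left trivialisation. Varying the first carries a tangent vector past
  \<open>h\<close>, which produces \<open>Ad_star G h\<close>.\<close>

lemma ltensor_mult:
  "ltensor \<phi> \<psi> (g \<otimes> h) = ltensor \<phi> \<psi> h + ltensor (Ad_star G h \<phi>) (Ad_star G h \<psi>) g"
proof -
  obtain a where a: "a \<in> Cinf G" "dl a (g \<otimes> h) = \<phi>" by (rule dl_surj)
  obtain b where b: "b \<in> Cinf G" "dl b (g \<otimes> h) = \<psi>" by (rule dl_surj)
  have L: "dl (\<lambda>y. f (g \<otimes> y)) h = dl f (g \<otimes> h)" if "f \<in> Cinf G" for f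
    by (rule blinfun_eqI) (simp add: dl_apply lf_translate[OF that])
  have R: "dl (\<lambda>x. f (x \<otimes> h)) g = Ad_star G h (dl f (g \<otimes> h))" if "f \<in> Cinf G" for f
    by (rule blinfun_eqI) (simp add: dl_apply Ad_star_apply Ad_inv_apply[OF that])
  have "br (\<lambda>x. a (x \<otimes> h)) (\<lambda>x. b (x \<otimes> h)) g + br (\<lambda>y. a (g \<otimes> y)) (\<lambda>y. b (g \<otimes> y)) h = br a b (g \<otimes> h)"
    using fun_cong[OF mult_poisson[OF a(1) b(1)], of "(g, h)"] by (simp add: prod_pbracket_def)
  then show ?thesis
    using a b by (simp add: br_dl Cinf_translate L R)
qed

section \<open>The cobracket as a derivative of the Poisson tensor\<close>

lemma Ad_star_one: "Ad_star G \<one> \<phi> = \<phi>"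
  by (rule blinfun_eqI) (simp add: Ad_star_apply Ad_one)

lemma ltensor_one: "ltensor \<phi> \<psi> \<one> = 0"
  using ltensor_mult[of \<phi> \<psi> \<one> \<one>] by (simp add: Ad_star_one)

lemma ltensor_inv: "ltensor (Ad_star G h \<phi>) (Ad_star G h \<psi>) (inv h) = - ltensor \<phi> \<psi> h"
  using ltensor_mult[of \<phi> \<psi> "inv h" h] by (simp add: ltensor_one)

text \<open>With k = exp(-tx), the right-translated tensor at the identity is the tensor at
  \<open>inv k\<close> twisted by \<open>Ad_star G k\<close>. By \<open>ltensor_inv\<close> this is
  minus the tensor at k, and that sign cancels the one from -t in the derivative.\<close>

lemma cobracket_eq: "cobracket G x \<phi> \<psi> = lf x (ltensor \<phi> \<psi>) \<one>"
proof -
  have "push_bivector G (rtrans G (lie_exp G (- t *\<^sub>R x))) (om \<phi>) (om \<psi>) \<one> =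
      - ltensor \<phi> \<psi> (lie_exp G ((- t) *\<^sub>R x))" for t
    unfolding push_bivector_def pull_om_rtrans inv_into_rtrans
    using ltensor_inv[of "lie_exp G (- (t *\<^sub>R x))" \<phi> \<psi>] by (simp add: ltensor_def)
  then have "cobracket G x \<phi> \<psi> = deriv (\<lambda>t. - ltensor \<phi> \<psi> (lie_exp G ((- t) *\<^sub>R x))) 0"
    by (simp add: cobracket_def)
  also have "\<dots> = lf x (ltensor \<phi> \<psi>) \<one>"
  proof (rule DERIV_imp_deriv)
    have "((\<lambda>t. ltensor \<phi> \<psi> (lie_exp G (t *\<^sub>R x))) has_field_derivative lf x (ltensor \<phi> \<psi>) \<one>) (at (- 0))"
      using lie_exp(2)[OF ltensor_Cinf] by simp
    moreover have "(uminus has_field_derivative - 1) (at (0::real))" by (auto intro!: derivative_eq_intros)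
    ultimately have "((\<lambda>t. ltensor \<phi> \<psi> (lie_exp G (- t *\<^sub>R x))) has_field_derivative lf x (ltensor \<phi> \<psi>) \<one> * - 1) (at 0)"
      by (rule DERIV_chain2[where f = "\<lambda>t. ltensor \<phi> \<psi> (lie_exp G (t *\<^sub>R x))" and g = uminus])
    from DERIV_minus[OF this]
    show "((\<lambda>t. - ltensor \<phi> \<psi> (lie_exp G (- t *\<^sub>R x))) has_field_derivative lf x (ltensor \<phi> \<psi>) \<one>) (at 0)"
      by simp
  qed
  finally show ?thesis .
qed

lemma lf_mult: "f \<in> Cinf G \<Longrightarrow> h \<in> Cinf G \<Longrightarrow> lf x (\<lambda>p. f p * h p) p = lf x f p * h p + f p * lf x h p"
  using vfield_algebra(2)[OF lf_vfield, of f h x] by (simp add: times_fun_def fun_eq_iff)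

lemma Cinf_mult': "f \<in> Cinf G \<Longrightarrow> h \<in> Cinf G \<Longrightarrow> (\<lambda>p. f p * h p) \<in> Cinf G"
  using Cinf_mult[of f h] by (simp add: times_fun_def)

lemma Cinf_sum': "(\<And>i. i \<in> I \<Longrightarrow> f i \<in> Cinf G) \<Longrightarrow> (\<lambda>p. \<Sum>i\<in>I. f i p) \<in> Cinf G"
  using Cinf_sum[of I f] by (simp add: sum_fun_apply[abs_def])

lemma lf_sum_fun:
  "(\<And>i. i \<in> I \<Longrightarrow> f i \<in> Cinf G) \<Longrightarrow> lf x (\<lambda>p. \<Sum>i\<in>I. f i p) p = (\<Sum>i\<in>I. lf x (f i) p)"
proof -
  assume "\<And>i. i \<in> I \<Longrightarrow> f i \<in> Cinf G"
  then have "lf x (sum f I) p = (\<Sum>i\<in>I. lf x (f i) p)" by (simp add: vfield_sum[OF lf_vfield] sum_fun_apply)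
  moreover have "sum f I = (\<lambda>p. \<Sum>i\<in>I. f i p)" by (rule ext) (rule sum_fun_apply)
  ultimately show ?thesis by simp
qed

lemma cobracket_expansion:
  "cobracket G x \<phi> \<psi> = (\<Sum>k<dm. \<Sum>l<dm. \<phi> (eb k) * \<psi> (eb l) * cobracket G x (fb k) (fb l))"
proof -
  have "ltensor \<phi> \<psi> = (\<lambda>p. \<Sum>k<dm. \<Sum>l<dm. (\<phi> (eb k) * \<psi> (eb l)) * ltensor (fb k) (fb l) p)"
    by (rule ext) (rule ltensor_expansion)
  then show ?thesis
    unfolding cobracket_eq
    by (simp add: lf_sum_fun Cinf_sum' Cinf_scale ltensor_Cinf vfield_scale[OF lf_vfield])
qed

lemma cobracket_antisym: "cobracket G x \<phi> \<psi> = - cobracket G x \<psi> \<phi>"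
proof -
  have "ltensor \<phi> \<psi> = (\<lambda>p. - 1 * ltensor \<psi> \<phi> p)" using ltensor_antisym[of \<phi> \<psi>] by auto
  then show ?thesis
    using vfield_scale[OF lf_vfield ltensor_Cinf, of x "- 1" \<psi> \<phi>] by (simp add: cobracket_eq)
qed

lemma dual_bracket_apply: "dual_bracket G \<phi> \<psi> x = cobracket G x \<phi> \<psi>"
  unfolding dual_bracket_def
  by (subst linear_functional_apply) (simp_all add: cobracket_eq lf_linear)

text \<open>The left-invariant fields act on the Poisson bracket as derivations up to the cobracket:
  differentiate \<open>{a,b}(g h) = {a(\<cdot> h), b(\<cdot> h)}(g) + {a(g \<cdot>), b(g \<cdot>)}(h)\<close> in \<open>h\<close> at the identity.\<close>

lemma lf_br:
  assumes a: "a \<in> Cinf G" and b: "b \<in> Cinf G"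
  shows "lf x (br a b) g = br (lf x a) b g + br a (lf x b) g + cobracket G x (dl a g) (dl b g)"
proof -
  let ?P = "\<lambda>k l. ltensor (fb k) (fb l)"
  \<comment> \<open>Both are coordinates of differentials as functions of \<open>h\<close>:
    \<open>Da\<close> belongs to the right translate of \<open>f\<close> at \<open>g\<close>,
    \<open>Ta\<close> to the left translate at \<open>h\<close>. For \<open>Da\<close>,
    differentiation in \<open>h\<close> is exchanged with \<open>eb k\<close> by
    \<open>op_commute\<close>.\<close>
  define Da where "Da f k h = lf (eb k) (\<lambda>q. f (q \<otimes> h)) g" for f k h
  define Ta where "Ta f k h = lf (eb k) f (g \<otimes> h)" for f k h
  have Da: "Da f k \<in> Cinf G" "Da f k \<one> = lf (eb k) f g" "lf x (Da f k) \<one> = lf (eb k) (lf x f) g"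
    if f: "f \<in> Cinf G" for f k
  proof -
    let ?F = "\<lambda>z. f (fst z \<otimes> snd z)"
    note F = smooth2_mult[OF f]
    have eq: "Da f k = (\<lambda>h. op_fst (lf (eb k)) ?F (g, h))" by (simp add: Da_def op_fst_def fun_eq_iff)
    show "Da f k \<in> Cinf G" unfolding eq by (rule smooth2_slice_snd[OF smooth2_op_fst[OF lf_vfield F]])
    show "Da f k \<one> = lf (eb k) f g" by (simp add: Da_def)
    have "lf x (Da f k) \<one> = op_snd (lf x) (op_fst (lf (eb k)) ?F) (g, \<one>)"
      by (simp add: eq op_snd_def)
    also have "\<dots> = op_fst (lf (eb k)) (op_snd (lf x) ?F) (g, \<one>)"
      by (simp only: op_commute[OF lf_vfield lf_vfield F])
    also have "\<dots> = lf (eb k) (lf x f) g"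
      by (simp add: op_fst_def op_snd_def lf_translate[OF f])
    finally show "lf x (Da f k) \<one> = lf (eb k) (lf x f) g" .
  qed
  have Ta: "Ta f k \<in> Cinf G" "Ta f k \<one> = lf (eb k) f g" for f k
    unfolding Ta_def by (rule Cinf_translate(1)[OF lf_Cinf]) simp
  have "br a b (g \<otimes> h) = (\<Sum>k<dm. \<Sum>l<dm. Da a k h * Da b l h * ?P k l g) +
      (\<Sum>k<dm. \<Sum>l<dm. Ta a k h * Ta b l h * ?P k l h)" for h
    using fun_cong[OF mult_poisson[OF a b], of "(g, h)"]
    by (simp add: prod_pbracket_def br_expansion a b Cinf_translate Da_def Ta_def lf_translate)
  then have "(\<lambda>h. br a b (g \<otimes> h)) = (\<lambda>h. \<Sum>k<dm. \<Sum>l<dm. ?P k l g * (Da a k h * Da b l h)) +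
      (\<lambda>h. \<Sum>k<dm. \<Sum>l<dm. Ta a k h * Ta b l h * ?P k l h)"
    by (simp add: fun_eq_iff mult_ac)
  moreover have "lf x (br a b) g = lf x (\<lambda>h. br a b (g \<otimes> h)) \<one>"
    by (rule lf_at[OF br_Cinf[OF a b]])
  moreover have C1: "(\<lambda>h. \<Sum>k<dm. \<Sum>l<dm. ?P k l g * (Da a k h * Da b l h)) \<in> Cinf G"
    by (intro Cinf_sum' Cinf_scale Cinf_mult' Da a b)
  moreover have C2: "(\<lambda>h. \<Sum>k<dm. \<Sum>l<dm. Ta a k h * Ta b l h * ?P k l h) \<in> Cinf G"
    by (intro Cinf_sum' Cinf_mult' Ta ltensor_Cinf)
  ultimately have "lf x (br a b) g = lf x (\<lambda>h. \<Sum>k<dm. \<Sum>l<dm. ?P k l g * (Da a k h * Da b l h)) \<one> +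
      lf x (\<lambda>h. \<Sum>k<dm. \<Sum>l<dm. Ta a k h * Ta b l h * ?P k l h) \<one>"
    using vfield_algebra(1)[OF lf_vfield C1 C2, of x] by simp
  also have "lf x (\<lambda>h. \<Sum>k<dm. \<Sum>l<dm. ?P k l g * (Da a k h * Da b l h)) \<one> =
      (\<Sum>k<dm. \<Sum>l<dm. ?P k l g * (lf (eb k) (lf x a) g * lf (eb l) b g + lf (eb k) a g * lf (eb l) (lf x b) g))"
    by (simp add: lf_sum_fun Cinf_sum' Cinf_scale Cinf_mult' Da a b vfield_scale[OF lf_vfield] lf_mult)
  also have "\<dots> = br (lf x a) b g + br a (lf x b) g"
    by (simp add: br_expansion a b lf_Cinf sum.distrib[symmetric] algebra_simps)
  \<comment> \<open>The tensor vanishes at the identity, so only the terms in which the tensor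
    itself is differentiated survive.\<close>
  also have "lf x (\<lambda>h. \<Sum>k<dm. \<Sum>l<dm. Ta a k h * Ta b l h * ?P k l h) \<one> =
      (\<Sum>k<dm. \<Sum>l<dm. lf (eb k) a g * lf (eb l) b g * lf x (?P k l) \<one>)"
    by (simp add: lf_sum_fun Cinf_sum' Cinf_mult' Ta ltensor_Cinf lf_mult ltensor_one)
  also have "\<dots> = cobracket G x (dl a g) (dl b g)"
    by (subst cobracket_expansion) (simp add: dl_apply cobracket_eq)
  finally show ?thesis .
qed

end

section \<open>Flatness and bicovariance\<close>

context poisson_lie_group
begin

abbreviation lb :: "'v \<Rightarrow> 'v \<Rightarrow> 'v" where "lb \<equiv> lie_bracket G"

lemma linear_apply: "linear (\<lambda>\<phi>. blinfun_apply \<phi> y)"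
  by (rule linearI) (simp_all add: blinfun.add_left blinfun.scaleR_left)

lemma linear_apply_right: "linear (blinfun_apply \<phi>)"
  by (rule bounded_linear.linear[OF blinfun.bounded_linear_right])

lemma bilinear_value_expansion:
  fixes \<Xi> :: "('v \<Rightarrow>\<^sub>L real) \<Rightarrow> ('v \<Rightarrow>\<^sub>L real) \<Rightarrow> ('v \<Rightarrow>\<^sub>L real)"
  assumes "bilinear \<Xi>"
  shows "\<Xi> \<phi> \<psi> y = (\<Sum>i<dm. \<Sum>j<dm. \<phi> (eb i) * \<psi> (eb j) * \<Xi> (fb i) (fb j) y)"
proof -
  have 1: "linear (\<lambda>\<phi>. \<Xi> \<phi> \<psi> y)" for \<psi>
    using linear_compose[of "\<lambda>\<phi>. \<Xi> \<phi> \<psi>", OF _ linear_apply] assms by (simp add: bilinear_def o_def)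
  have 2: "linear (\<lambda>\<psi>. \<Xi> \<phi> \<psi> y)" for \<phi>
    using linear_compose[of "\<lambda>\<psi>. \<Xi> \<phi> \<psi>", OF _ linear_apply] assms by (simp add: bilinear_def o_def)
  have "\<Xi> \<phi> \<psi> y = (\<Sum>i<dm. \<phi> (eb i) *\<^sub>R \<Xi> (fb i) \<psi> y)" by (rule dual_linear_expansion[OF 1])
  also have "\<dots> = (\<Sum>i<dm. \<phi> (eb i) *\<^sub>R (\<Sum>j<dm. \<psi> (eb j) *\<^sub>R \<Xi> (fb i) (fb j) y))"
    by (intro sum.cong refl arg_cong[where f = "\<lambda>z. _ *\<^sub>R z"] dual_linear_expansion[OF 2])
  finally show ?thesis by (simp add: sum_distrib_left mult.assoc)
qed

text \<open>The frame-free form of the coordinate formula. It rests on the bracket term being linear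
  in \<open>y\<close>: the function \<open>\<tau> (lf y)\<close> is a combination of the frame
  values with constant coefficients.\<close>

lemma gamma_of_lf:
  assumes \<Xi>: "bilinear \<Xi>" and a: "a \<in> Cinf G" and \<tau>: "\<tau> \<in> forms G"
  shows "gamma_of G \<Xi> a \<tau> (lf y) p = br a (\<tau> (lf y)) p + \<Xi> (dl a p) (covector \<tau> p) y"
proof -
  have \<tau>C: "\<tau> (lf y) \<in> Cinf G" for y by (rule formsD(2)[OF \<tau> lf_vfield])
  have lin: "linear (\<lambda>y. br a (\<tau> (lf y)) p)"
  proof -
    have br_sum: "br a (\<tau> (lf y)) p = (\<Sum>k<dm. fb k y * br a (\<tau> (lf (eb k))) p)" for y
    proof -
      have e: "\<tau> (lf y) = (\<Sum>k<dm. (\<lambda>q. fb k y * \<tau> (lf (eb k)) q))"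
      proof
        fix q
        from linear_expansion[OF form_lf_linear[OF \<tau>, of q], of y]
        show "\<tau> (lf y) q = (\<Sum>k<dm. (\<lambda>q. fb k y * \<tau> (lf (eb k)) q)) q"
          by (simp only: sum_fun_apply real_scaleR_def)
      qed
      have "lf z (\<tau> (lf y)) p = (\<Sum>k<dm. fb k y * lf z (\<tau> (lf (eb k))) p)" for z
        unfolding e by (subst vfield_sum[OF lf_vfield])
          (auto simp: sum_fun_apply vfield_scale[OF lf_vfield \<tau>C] intro: Cinf_scale \<tau>C)
      then have "dl (\<tau> (lf y)) p = (\<Sum>k<dm. fb k y *\<^sub>R dl (\<tau> (lf (eb k))) p)"
        by (intro blinfun_eqI) (simp add: dl_apply blinfun.sum_left blinfun.scaleR_left)
      then show ?thesis
        by (simp add: br_dl a \<tau>C linear_sum[OF ltensor_linear_right] linear_scale[OF ltensor_linear_right])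
    qed
    have "linear (\<lambda>y. \<Sum>k<dm. fb k y * c k)" for c :: "nat \<Rightarrow> real"
      by (intro linearI) (simp_all add: blinfun.add_right blinfun.scaleR_right algebra_simps sum.distrib sum_distrib_left)
    moreover have "(\<lambda>y. br a (\<tau> (lf y)) p) = (\<lambda>y. \<Sum>k<dm. fb k y * br a (\<tau> (lf (eb k))) p)"
      by (rule ext) (rule br_sum)
    ultimately show ?thesis by (simp only:)
  qed
  have lin2: "linear (\<lambda>y. br a (\<tau> (lf y)) p + \<Xi> (dl a p) (covector \<tau> p) y)"
    by (intro linear_compose_add lin linear_apply_right)
  have "gamma_of G \<Xi> a \<tau> (lf y) p = (\<Sum>k<dm. (br a (\<tau> (lf (eb k))) p +
      (\<Sum>i<dm. \<Sum>j<dm. \<Xi> (fb i) (fb j) (eb k) * lf (eb i) a p * \<tau> (lf (eb j)) p)) * fb k y)"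
    by (simp add: gamma_of_def sum_fun_apply fscale_apply om_lf const_def)
  also have "\<dots> = (\<Sum>k<dm. fb k y *\<^sub>R (br a (\<tau> (lf (eb k))) p + \<Xi> (dl a p) (covector \<tau> p) (eb k)))"
    by (subst bilinear_value_expansion[OF \<Xi>]) (simp add: dl_apply covector_apply[OF \<tau>] mult_ac)
  also have "\<dots> = br a (\<tau> (lf y)) p + \<Xi> (dl a p) (covector \<tau> p) y"
    by (rule linear_expansion[OF lin2, symmetric])
  finally show ?thesis .
qed

lemma covector_om: "covector (om \<zeta>) p = \<zeta>"
  by (rule blinfun_eqI) (simp add: covector_apply om_form om_lf const_def)

lemma lf_neg: "f \<in> Cinf G \<Longrightarrow> lf x (- f) p = - lf x f p"
  using vfield_scale[OF lf_vfield[of x], of f "-1"] by (simp add: fun_Compl_def)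

lemma dual_bracket_sum: "dual_bracket G \<phi> \<psi> = (\<Sum>j<dm. cobracket G (eb j) \<phi> \<psi> *\<^sub>R fb j)"
  using dual_expansion[of "dual_bracket G \<phi> \<psi>"] by (simp add: dual_bracket_apply)

end

subsection \<open>The curvature\<close>

locale left_covariant_preconnection = poisson_lie_group G
  for G :: "('g::{t2_space, second_countable_topology}, 'a::{real_inner, heine_borel},
             'v::real_normed_vector) poisson_lie_group" (structure) +
  fixes \<gamma> :: "('g \<Rightarrow> real) \<Rightarrow> 'g form \<Rightarrow> 'g form"
    and \<Xi> :: "('v \<Rightarrow>\<^sub>L real) \<Rightarrow> ('v \<Rightarrow>\<^sub>L real) \<Rightarrow> ('v \<Rightarrow>\<^sub>L real)"
  assumes preconn: "preconnection G \<gamma>" and left_cov: "left_covariant_via G \<Xi> \<gamma>"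
begin

lemma \<Xi>: "bilinear \<Xi>"
  using left_cov by (simp add: left_covariant_via_def)

lemma \<Xi>_linear_left: "linear (\<lambda>\<phi>. \<Xi> \<phi> \<psi>)" and \<Xi>_linear_right: "linear (\<Xi> \<phi>)"
  using \<Xi> by (auto simp: bilinear_def)

lemma \<Xi>_value_linear_left: "linear (\<lambda>\<phi>. \<Xi> \<phi> \<psi> y)"
  using linear_compose[OF \<Xi>_linear_left linear_apply] by (simp add: o_def)

lemma \<gamma>_form: "a \<in> Cinf G \<Longrightarrow> \<tau> \<in> forms G \<Longrightarrow> \<gamma> a \<tau> \<in> forms G"
  using preconn by (simp add: preconnection_def)

lemma \<gamma>_lf:
  "a \<in> Cinf G \<Longrightarrow> \<tau> \<in> forms G \<Longrightarrow> \<gamma> a \<tau> (lf y) p = br a (\<tau> (lf y)) p + \<Xi> (dl a p) (covector \<tau> p) y"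
  using left_cov gamma_of_lf[OF \<Xi>] by (simp add: left_covariant_via_def)

lemma \<gamma>_om: "a \<in> Cinf G \<Longrightarrow> \<gamma> a (om \<zeta>) (lf y) p = \<Xi> (dl a p) \<zeta> y"
  by (simp add: \<gamma>_lf om_form om_lf br_const covector_om)

lemma \<gamma>_add: "a \<in> Cinf G \<Longrightarrow> \<sigma> \<in> forms G \<Longrightarrow> \<tau> \<in> forms G \<Longrightarrow> \<gamma> a (\<sigma> + \<tau>) = \<gamma> a \<sigma> + \<gamma> a \<tau>"
  using preconn by (simp add: preconnection_def)

lemma \<gamma>_leibniz:
  "a \<in> Cinf G \<Longrightarrow> b \<in> Cinf G \<Longrightarrow> \<tau> \<in> forms G \<Longrightarrow> \<gamma> a (b \<cdot> \<tau>) = b \<cdot> \<gamma> a \<tau> + br a b \<cdot> \<tau>"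
  using preconn by (simp add: preconnection_def)

definition curvature :: "('g \<Rightarrow> real) \<Rightarrow> ('g \<Rightarrow> real) \<Rightarrow> 'g form \<Rightarrow> 'g form" where
  "curvature a b \<tau> = \<gamma> a (\<gamma> b \<tau>) - \<gamma> b (\<gamma> a \<tau>) - \<gamma> (br a b) \<tau>"

definition bracket_defect where
  "bracket_defect \<phi> \<psi> \<zeta> = \<Xi> \<phi> (\<Xi> \<psi> \<zeta>) - \<Xi> \<psi> (\<Xi> \<phi> \<zeta>) - \<Xi> (dual_bracket G \<phi> \<psi>) \<zeta>"

text \<open>The inner form has the nonconstant coefficients \<open>\<Xi> (dl b p) \<zeta>\<close>.
  Expanding \<open>dl b p\<close> in the dual basis isolates the functions
  \<open>lf (eb j) b\<close>, on which the outer bracket with \<open>a\<close> acts.\<close>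

lemma \<gamma>_\<gamma>_om:
  assumes a: "a \<in> Cinf G" and b: "b \<in> Cinf G"
  shows "\<gamma> a (\<gamma> b (om \<zeta>)) (lf y) p =
    (\<Sum>j<dm. \<Xi> (fb j) \<zeta> y * br a (lf (eb j) b) p) + \<Xi> (dl a p) (\<Xi> (dl b p) \<zeta>) y"
proof -
  have "\<gamma> b (om \<zeta>) (lf y) q = (\<Sum>j<dm. \<Xi> (fb j) \<zeta> y * lf (eb j) b q)" for q y
    unfolding \<gamma>_om[OF b] by (subst dual_linear_expansion[OF \<Xi>_value_linear_left]) (simp add: dl_apply mult.commute)
  then have e: "\<gamma> b (om \<zeta>) (lf y) = (\<Sum>j<dm. (\<lambda>q. \<Xi> (fb j) \<zeta> y * lf (eb j) b q))" for y
    by (intro ext) (simp add: sum_fun_apply)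
  have "dl (\<Sum>j<dm. (\<lambda>q. \<Xi> (fb j) \<zeta> y * lf (eb j) b q)) p = (\<Sum>j<dm. \<Xi> (fb j) \<zeta> y *\<^sub>R dl (lf (eb j) b) p)"
    by (intro blinfun_eqI, subst dl_apply, subst vfield_sum[OF lf_vfield])
      (auto simp: sum_fun_apply vfield_scale[OF lf_vfield lf_Cinf] dl_apply blinfun.sum_left
        blinfun.scaleR_left intro: Cinf_scale lf_Cinf)
  then have "br a (\<gamma> b (om \<zeta>) (lf y)) p = (\<Sum>j<dm. \<Xi> (fb j) \<zeta> y * br a (lf (eb j) b) p)"
    by (simp add: e br_dl a Cinf_sum Cinf_scale lf_Cinf linear_sum[OF ltensor_linear_right]
        linear_scale[OF ltensor_linear_right])
  moreover have "covector (\<gamma> b (om \<zeta>)) p = \<Xi> (dl b p) \<zeta>"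
    by (rule blinfun_eqI) (simp add: covector_apply \<gamma>_form om_form b \<gamma>_om)
  ultimately show ?thesis by (simp add: \<gamma>_lf a b \<gamma>_form om_form)
qed

text \<open>Substituting \<open>lf_br\<close> removes all brackets of functions. The remaining
  cobracket, summed over the dual basis, reassembles into the dual Lie bracket.\<close>

lemma curvature_om:
  assumes a: "a \<in> Cinf G" and b: "b \<in> Cinf G"
  shows "curvature a b (om \<zeta>) (lf y) p = bracket_defect (dl a p) (dl b p) \<zeta> y"
proof -
  have "\<gamma> (br a b) (om \<zeta>) (lf y) p = (\<Sum>j<dm. lf (eb j) (br a b) p * \<Xi> (fb j) \<zeta> y)"
    unfolding \<gamma>_om[OF br_Cinf[OF a b]]
    by (subst dual_linear_expansion[OF \<Xi>_value_linear_left]) (simp add: dl_apply)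
  also have "\<dots> = (\<Sum>j<dm. \<Xi> (fb j) \<zeta> y * br a (lf (eb j) b) p) - (\<Sum>j<dm. \<Xi> (fb j) \<zeta> y * br b (lf (eb j) a) p)
      + (\<Sum>j<dm. cobracket G (eb j) (dl a p) (dl b p) * \<Xi> (fb j) \<zeta> y)"
    by (simp add: lf_br[OF a b] br_antisym[OF lf_Cinf b] sum.distrib[symmetric] sum_subtractf[symmetric] algebra_simps)
  also have "(\<Sum>j<dm. cobracket G (eb j) (dl a p) (dl b p) * \<Xi> (fb j) \<zeta> y) =
      \<Xi> (dual_bracket G (dl a p) (dl b p)) \<zeta> y"
    by (subst dual_bracket_sum) (simp add: linear_sum[OF \<Xi>_value_linear_left] linear_scale[OF \<Xi>_value_linear_left])
  finally show ?thesis
    by (simp add: curvature_def bracket_defect_def \<gamma>_\<gamma>_om a b blinfun.diff_left)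
qed

text \<open>The mixed Leibniz terms are symmetric in \<open>a\<close> and \<open>b\<close> and
  cancel in the commutator; what multiplies \<open>\<tau>\<close> itself is the Jacobi identity for
  a, b, c.\<close>

lemma curvature_fscale:
  assumes a: "a \<in> Cinf G" and b: "b \<in> Cinf G" and c: "c \<in> Cinf G" and \<tau>: "\<tau> \<in> forms G"
  shows "curvature a b (c \<cdot> \<tau>) = c \<cdot> curvature a b \<tau>"
proof -
  have jac: "br a (br b c) p - br b (br a c) p - br (br a b) c p = 0" for p
  proof -
    have "br a (br b c) + br b (br c a) + br c (br a b) = 0"
      using pbracket a b c unfolding poisson_bracket_on_def by blast
    then have "br a (br b c) p + br b (br c a) p + br c (br a b) p = 0" by (metis plus_fun_apply zero_fun_apply)
    moreover have "br c a = - br a c" using pbracket a c unfolding poisson_bracket_on_def by blast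
    then have "dl (br c a) p = - dl (br a c) p"
      by (intro blinfun_eqI) (simp add: dl_apply lf_neg[OF br_Cinf[OF a c]] blinfun.minus_left)
    then have "br b (br c a) p = - br b (br a c) p"
      using br_dl[OF b br_Cinf[OF c a], of p] br_dl[OF b br_Cinf[OF a c], of p]
        linear_neg[OF ltensor_linear_right] by simp
    moreover have "br c (br a b) p = - br (br a b) c p" by (rule br_antisym[OF c br_Cinf[OF a b]])
    ultimately show ?thesis by simp
  qed
  have "\<gamma> a (\<gamma> b (c \<cdot> \<tau>)) = c \<cdot> \<gamma> a (\<gamma> b \<tau>) + br a c \<cdot> \<gamma> b \<tau> + (br b c \<cdot> \<gamma> a \<tau> + br a (br b c) \<cdot> \<tau>)"
    if a: "a \<in> Cinf G" and b: "b \<in> Cinf G" for a b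
    by (simp add: \<gamma>_leibniz \<gamma>_add a b c \<tau> \<gamma>_form br_Cinf forms_fscale)
  note g = this[OF a b] this[OF b a] \<gamma>_leibniz[OF br_Cinf[OF a b] c \<tau>]
  show ?thesis
  proof (intro ext)
    fix X p
    have "curvature a b (c \<cdot> \<tau>) X p = c p * curvature a b \<tau> X p +
        (br a (br b c) p - br b (br a c) p - br (br a b) c p) * \<tau> X p"
      by (simp add: curvature_def g fscale_apply algebra_simps)
    then show "curvature a b (c \<cdot> \<tau>) X p = (c \<cdot> curvature a b \<tau>) X p" by (simp add: jac fscale_apply)
  qed
qed

lemma curvature_add:
  assumes "a \<in> Cinf G" "b \<in> Cinf G" "\<sigma> \<in> forms G" "\<tau> \<in> forms G"
  shows "curvature a b (\<sigma> + \<tau>) = curvature a b \<sigma> + curvature a b \<tau>"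
  by (simp add: curvature_def \<gamma>_add assms \<gamma>_form br_Cinf algebra_simps)

lemma curvature_form:
  assumes "a \<in> Cinf G" "b \<in> Cinf G" "\<tau> \<in> forms G"
  shows "curvature a b \<tau> \<in> forms G"
proof -
  have neg: "- \<sigma> \<in> forms G" if "\<sigma> \<in> forms G" for \<sigma>
    using forms_fscale[OF Cinf_const[of "- 1"] that] by (simp add: fscale_def const_def fun_Compl_def times_fun_def)
  have "curvature a b \<tau> = \<gamma> a (\<gamma> b \<tau>) + - \<gamma> b (\<gamma> a \<tau>) + - \<gamma> (br a b) \<tau>"
    by (simp add: curvature_def)
  also have "\<dots> \<in> forms G" by (intro forms_add neg \<gamma>_form assms br_Cinf)
  finally show ?thesis .
qed

text \<open>In one direction the curvature is evaluated at the identity on functions with arbitrary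
  differentials there. In the other, additivity and linearity over functions reduce any form to the
  left-invariant frame.\<close>

theorem flat_iff: "flat G \<gamma> \<longleftrightarrow>
  (\<forall>\<phi> \<psi> \<zeta>. \<Xi> (dual_bracket G \<phi> \<psi>) \<zeta> = \<Xi> \<phi> (\<Xi> \<psi> \<zeta>) - \<Xi> \<psi> (\<Xi> \<phi> \<zeta>))"
proof -
  have "flat G \<gamma> \<longleftrightarrow> (\<forall>a\<in>Cinf G. \<forall>b\<in>Cinf G. \<forall>\<tau>\<in>forms G. curvature a b \<tau> = 0)"
    by (simp add: flat_def curvature_def)
  also have "\<dots> \<longleftrightarrow> (\<forall>\<phi> \<psi> \<zeta>. bracket_defect \<phi> \<psi> \<zeta> = 0)"
  proof (intro iffI allI ballI)
    fix \<phi> \<psi> \<zeta>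
    assume R: "\<forall>a\<in>Cinf G. \<forall>b\<in>Cinf G. \<forall>\<tau>\<in>forms G. curvature a b \<tau> = 0"
    obtain a where a: "a \<in> Cinf G" "dl a \<one> = \<phi>" by (rule dl_surj)
    obtain b where b: "b \<in> Cinf G" "dl b \<one> = \<psi>" by (rule dl_surj)
    have "curvature a b (om \<zeta>) = 0" using R a b om_form by blast
    then show "bracket_defect \<phi> \<psi> \<zeta> = 0"
      using curvature_om[OF a(1) b(1), of \<zeta> _ \<one>] a b by (intro blinfun_eqI) simp
  next
    fix a b \<tau>
    assume K: "\<forall>\<phi> \<psi> \<zeta>. bracket_defect \<phi> \<psi> \<zeta> = 0" and a: "a \<in> Cinf G" and b: "b \<in> Cinf G" and \<tau>: "\<tau> \<in> forms G"
    have 0: "curvature a b (om \<zeta>) = 0" for \<zeta>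
      using K curvature_om[OF a b, of \<zeta>]
      by (intro form_eqI curvature_form a b om_form forms_zero ext) simp
    have t: "\<tau> (lf (eb k)) \<cdot> om (fb k) \<in> forms G" for k
      by (intro forms_fscale formsD(2)[OF \<tau>] lf_vfield om_form)
    have zero: "curvature a b (sum (\<lambda>k. \<tau> (lf (eb k)) \<cdot> om (fb k)) I) = 0" if "finite I" for I
      using that
    proof (induction I rule: finite_induct)
      case empty
      have "curvature a b (0 + 0) = curvature a b 0 + curvature a b 0"
        by (rule curvature_add[OF a b forms_zero forms_zero])
      then have "curvature a b 0 = 0" by (simp only: add_0_right) (metis add_cancel_right_right)
      then show ?case by (simp only: sum.empty)
    next
      case (insert k I)
      have "curvature a b (\<tau> (lf (eb k)) \<cdot> om (fb k)) = \<tau> (lf (eb k)) \<cdot> curvature a b (om (fb k))"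
        by (intro curvature_fscale a b om_form formsD(2)[OF \<tau>] lf_vfield)
      also have "\<dots> = 0" by (simp only: 0) (simp add: fun_eq_iff fscale_apply)
      finally have "curvature a b (\<tau> (lf (eb k)) \<cdot> om (fb k)) = 0" .
      moreover have "curvature a b (\<tau> (lf (eb k)) \<cdot> om (fb k) + (\<Sum>k\<in>I. \<tau> (lf (eb k)) \<cdot> om (fb k))) =
          curvature a b (\<tau> (lf (eb k)) \<cdot> om (fb k)) + curvature a b (\<Sum>k\<in>I. \<tau> (lf (eb k)) \<cdot> om (fb k))"
        by (intro curvature_add a b t forms_sum)
      ultimately show ?case
        by (simp only: sum.insert[OF insert.hyps] insert.IH add_0_right)
    qed
    show "curvature a b \<tau> = 0" using zero[of "{..<dm}"] form_expansion[OF \<tau>] by simp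
  qed
  also have "\<dots> \<longleftrightarrow> (\<forall>\<phi> \<psi> \<zeta>. \<Xi> (dual_bracket G \<phi> \<psi>) \<zeta> = \<Xi> \<phi> (\<Xi> \<psi> \<zeta>) - \<Xi> \<psi> (\<Xi> \<phi> \<zeta>))"
    unfolding bracket_defect_def right_minus_eq by (simp add: eq_commute)
  finally show ?thesis .
qed

section \<open>Right actions of the dual and left actions of its opposite\<close>

lemma \<Xi>_neg: "\<Xi> \<phi> (- \<psi>) = - \<Xi> \<phi> \<psi>" "\<Xi> (- \<phi>) \<psi> = - \<Xi> \<phi> \<psi>"
  using linear_neg[OF \<Xi>_linear_right] linear_neg[OF \<Xi>_linear_left] by auto

lemma bilinear_neg: "bilinear (\<lambda>\<phi> \<zeta>. - \<Xi> \<phi> \<zeta>)" "bilinear (\<lambda>\<zeta> \<phi>. - \<Xi> \<phi> \<zeta>)"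
  using linear_compose_neg[OF \<Xi>_linear_right] linear_compose_neg[OF \<Xi>_linear_left]
  by (auto simp: bilinear_def)

text \<open>Compositions contain \<Xi> twice, so their signs cancel, while the bracket side keeps
  one sign. That sign is compensated by the reversed order of composition in a right action.\<close>

lemma right_action_iff: "right_lie_action (dual_bracket G) (\<lambda>\<zeta> \<phi>. - \<Xi> \<phi> \<zeta>) \<longleftrightarrow>
  (\<forall>\<phi> \<psi> \<zeta>. \<Xi> (dual_bracket G \<phi> \<psi>) \<zeta> = \<Xi> \<phi> (\<Xi> \<psi> \<zeta>) - \<Xi> \<psi> (\<Xi> \<phi> \<zeta>))"
proof -
  have "- \<Xi> (dual_bracket G \<phi> \<psi>) \<zeta> = - \<Xi> \<psi> (- \<Xi> \<phi> \<zeta>) - - \<Xi> \<phi> (- \<Xi> \<psi> \<zeta>) \<longleftrightarrow>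
      \<Xi> (dual_bracket G \<phi> \<psi>) \<zeta> = \<Xi> \<phi> (\<Xi> \<psi> \<zeta>) - \<Xi> \<psi> (\<Xi> \<phi> \<zeta>)" for \<phi> \<psi> \<zeta>
    by (simp add: \<Xi>_neg) (metis minus_diff_eq minus_minus)
  then show ?thesis by (simp add: right_lie_action_def bilinear_neg)
qed

lemma left_action_iff:
  "left_lie_action (\<lambda>\<phi> \<psi>. - dual_bracket G \<phi> \<psi>) (\<lambda>\<phi> \<zeta>. - \<Xi> \<phi> \<zeta>) \<longleftrightarrow>
  (\<forall>\<phi> \<psi> \<zeta>. \<Xi> (dual_bracket G \<phi> \<psi>) \<zeta> = \<Xi> \<phi> (\<Xi> \<psi> \<zeta>) - \<Xi> \<psi> (\<Xi> \<phi> \<zeta>))"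
  by (simp add: left_lie_action_def bilinear_neg \<Xi>_neg)

subsection \<open>Bicovariance as the vanishing of a cocycle\<close>

text \<open>On a left-invariant form \<gamma> returns \<Xi> of the differential, which is arbitrary
  at the identity. This identifies the map under the existential quantifier of
  \<open>bicovariant\<close> with the given one.\<close>

lemma \<Xi>_unique:
  assumes "left_covariant_via G \<Xi>' \<gamma>"
  shows "\<Xi>' = \<Xi>"
proof (intro ext blinfun_eqI)
  fix \<phi> \<psi> y
  interpret other: left_covariant_preconnection G \<gamma> \<Xi>'
    by unfold_locales (use assms preconn in auto)
  obtain a where a: "a \<in> Cinf G" "dl a \<one> = \<phi>" by (rule dl_surj)
  show "\<Xi>' \<phi> \<psi> y = \<Xi> \<phi> \<psi> y"
    using \<gamma>_om[OF a(1), of \<psi> y \<one>] other.\<gamma>_om[OF a(1), of \<psi> y \<one>] a(2) by simp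
qed

lemma lie_bracket_linear_left: "linear (\<lambda>x. lb x y)"
  unfolding lie_bracket_antisym[of _ y] by (rule linear_compose_neg[OF lie_bracket_linear_right])

text \<open>This is the coadjoint action of \<open>y\<close> on \<psi>; it also equals
  \<open>- ad_star G x \<psi> y\<close> as a functional of \<open>x\<close>. That second reading
  turns the Sweedler sum of the bicovariance condition into one value of the Poisson tensor.\<close>

definition co_ad :: "('v \<Rightarrow>\<^sub>L real) \<Rightarrow> 'v \<Rightarrow> ('v \<Rightarrow>\<^sub>L real)" where
  "co_ad \<psi> y = Blinfun (\<lambda>x. \<psi> (lb x y))"

lemma co_ad_apply: "co_ad \<psi> y x = \<psi> (lb x y)"
proof -
  have "linear (\<lambda>x. \<psi> (lb x y))"
    using linear_compose[OF lie_bracket_linear_left linear_apply_right] by (simp add: o_def)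
  then show ?thesis by (simp add: co_ad_def linear_functional_apply)
qed

lemma ad_star_apply: "ad_star G x \<phi> y = - \<phi> (lb x y)"
proof -
  have "linear (\<lambda>y. - \<phi> (lb x y))"
    using linear_compose_neg[OF linear_compose[OF lie_bracket_linear_right linear_apply_right]] by (simp add: o_def)
  then show ?thesis by (simp add: ad_star_def linear_functional_apply)
qed

text \<open>Left side minus right side of the bicovariance condition, evaluated at \<open>y\<close>:
  the outer coadjoint action is moved onto \<open>y\<close>, and the Sweedler sum becomes a
  contraction with \<open>co_ad \<psi> y\<close>.\<close>

definition bicov_defect :: "'g \<Rightarrow> ('v \<Rightarrow>\<^sub>L real) \<Rightarrow> ('v \<Rightarrow>\<^sub>L real) \<Rightarrow> 'v \<Rightarrow> real" where
  "bicov_defect g \<phi> \<psi> y = \<Xi> \<phi> \<psi> y - \<Xi> (Ad_star G g \<phi>) (Ad_star G g \<psi>) (Ad G g y) + ltensor \<phi> (co_ad \<psi> y) g"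

lemma D_left_ad_star:
  fixes \<phi> \<psi> :: "'v \<Rightarrow>\<^sub>L real"
  shows "(\<Sum>i<dm. \<Sum>j<dm. (D_left G g (fb i) (fb j) * \<phi> (eb i)) *\<^sub>R ad_star G (eb j) \<psi>) y = - ltensor \<phi> (co_ad \<psi> y) g"
proof -
  have "- ltensor \<phi> (co_ad \<psi> y) g = - (\<Sum>k<dm. \<Sum>l<dm. \<phi> (eb k) * \<psi> (lb (eb l) y) * ltensor (fb k) (fb l) g)"
    by (subst ltensor_expansion) (simp add: co_ad_apply)
  then show ?thesis
    by (simp add: blinfun.sum_left blinfun.scaleR_left ad_star_apply D_left_eq sum_negf[symmetric] mult_ac)
qed

lemma blinfun_eq_iff_apply: "f = g \<longleftrightarrow> (\<forall>y. blinfun_apply f y = blinfun_apply g y)"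
  by (auto intro: blinfun_eqI)

lemma bicovariant_iff: "bicovariant G \<gamma> \<longleftrightarrow> (\<forall>g \<phi> \<psi> y. bicov_defect g \<phi> \<psi> y = 0)"
proof -
  have "bicovariant G \<gamma> \<longleftrightarrow> (\<forall>g \<phi> \<psi>. \<Xi> \<phi> \<psi> - Ad_star G (inv g) (\<Xi> (Ad_star G g \<phi>) (Ad_star G g \<psi>)) =
      (\<Sum>i<dm. \<Sum>j<dm. (D_left G g (fb i) (fb j) * \<phi> (eb i)) *\<^sub>R ad_star G (eb j) \<psi>))"
    unfolding bicovariant_def using left_cov \<Xi>_unique by blast
  also have "\<dots> \<longleftrightarrow> (\<forall>g \<phi> \<psi> y. bicov_defect g \<phi> \<psi> y = 0)"
  proof -
    have "(\<Xi> \<phi> \<psi> - Ad_star G (inv g) (\<Xi> (Ad_star G g \<phi>) (Ad_star G g \<psi>))) y =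
        (\<Sum>i<dm. \<Sum>j<dm. (D_left G g (fb i) (fb j) * \<phi> (eb i)) *\<^sub>R ad_star G (eb j) \<psi>) y \<longleftrightarrow>
        bicov_defect g \<phi> \<psi> y = 0" for g \<phi> \<psi> y
      unfolding D_left_ad_star bicov_defect_def blinfun.diff_left Ad_star_apply[of "inv g"] by auto
    then show ?thesis by (simp only: blinfun_eq_iff_apply)
  qed
  finally show ?thesis .
qed

lemma Ad_star_mult: "Ad_star G (h \<otimes> g) \<phi> = Ad_star G h (Ad_star G g \<phi>)"
  by (rule blinfun_eqI) (simp add: Ad_star_apply inv_mult_group Ad_mult)

lemma Ad_inv_Ad: "Ad G (inv g) (Ad G g x) = x" "Ad G g (Ad G (inv g) x) = x"
  by (simp_all add: Ad_mult[symmetric] Ad_one)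

lemma co_ad_Ad: "co_ad (Ad_star G g \<psi>) (Ad G g y) = Ad_star G g (co_ad \<psi> y)"
  by (rule blinfun_eqI) (simp add: co_ad_apply Ad_star_apply Ad_bracket Ad_inv_Ad)

text \<open>The \<Xi> terms telescope. The tensor term follows multiplicativity, and
  \<open>co_ad_Ad\<close> matches its second argument because \<open>Ad\<close> preserves the Lie
  bracket.\<close>

lemma bicov_defect_cocycle:
  "bicov_defect (h \<otimes> g) \<phi> \<psi> y =
    bicov_defect g \<phi> \<psi> y + bicov_defect h (Ad_star G g \<phi>) (Ad_star G g \<psi>) (Ad G g y)"
  by (simp add: bicov_defect_def Ad_star_mult Ad_mult co_ad_Ad ltensor_mult)

lemma bicov_defect_one: "bicov_defect \<one> \<phi> \<psi> y = 0"
  by (simp add: bicov_defect_def Ad_star_one Ad_one ltensor_one)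

text \<open>The derivative of \<open>bicov_defect\<close> at the identity in the direction
  \<open>x\<close>: each of the three arguments moved by \<open>g\<close> contributes one
  term.\<close>

definition infinitesimal_defect where
  "infinitesimal_defect x \<phi> \<psi> y = cobracket G x \<phi> (co_ad \<psi> y)
    - \<Xi> (ad_star G x \<phi>) \<psi> y - \<Xi> \<phi> (ad_star G x \<psi>) y - \<Xi> \<phi> \<psi> (lb x y)"

lemma Ad_star_Cinf: "(\<lambda>g. Ad_star G g \<phi> y) \<in> Cinf G"
  unfolding Ad_star_apply using Cinf_translate(3)[OF Ad_smooth] .

lemma Ad_star_derivative: "lf x (\<lambda>g. Ad_star G g \<phi> y) \<one> = ad_star G x \<phi> y"
  using lf_inverse_at_one[OF Ad_smooth[of \<phi> y], where x = x and q = \<one>] by (simp add: Ad_star_apply ad_star_apply Ad_derivative)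

lemma bicov_defect_derivative:
  "(\<lambda>g. bicov_defect g \<phi> \<psi> y) \<in> Cinf G"
  "lf x (\<lambda>g. bicov_defect g \<phi> \<psi> y) \<one> = infinitesimal_defect x \<phi> \<psi> y"
proof -
  \<comment> \<open>\<Xi> is only known to be bilinear, so it is written through its structure
    constants. The moving term then becomes a finite sum of products of smooth functions of
    \<open>g\<close>, to which the product rule applies.\<close>
  let ?c = "\<lambda>i j k. \<Xi> (fb i) (fb j) (eb k)"
  have \<Xi>3: "\<Xi> \<alpha> \<beta> z = (\<Sum>i<dm. \<Sum>j<dm. \<Sum>k<dm. ?c i j k * (\<alpha> (eb i) * (\<beta> (eb j) * fb k z)))" for \<alpha> \<beta> z
  proof -
    have "\<Xi> (fb i) (fb j) z = (\<Sum>k<dm. fb k z *\<^sub>R ?c i j k)" for i j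
      by (rule linear_expansion[OF linear_apply_right])
    then show ?thesis
      by (subst bilinear_value_expansion[OF \<Xi>]) (simp add: sum_distrib_left mult_ac)
  qed
  define T where "T g = (\<Sum>i<dm. \<Sum>j<dm. \<Sum>k<dm. ?c i j k *
      (Ad_star G g \<phi> (eb i) * (Ad_star G g \<psi> (eb j) * fb k (Ad G g y))))" for g
  have T: "T \<in> Cinf G" unfolding T_def
    by (intro Cinf_sum' Cinf_scale Cinf_mult' Ad_star_Cinf Ad_smooth)
  have "lf x T \<one> = (\<Sum>i<dm. \<Sum>j<dm. \<Sum>k<dm. ?c i j k * (ad_star G x \<phi> (eb i) * (\<psi> (eb j) * fb k y) +
      \<phi> (eb i) * (ad_star G x \<psi> (eb j) * fb k y + \<psi> (eb j) * fb k (lb x y))))"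
    unfolding T_def
    by (simp add: lf_sum_fun Cinf_sum' Cinf_scale Cinf_mult' Ad_star_Cinf Ad_smooth vfield_scale[OF lf_vfield]
        lf_mult Ad_star_derivative Ad_derivative Ad_star_one Ad_one)
  also have "\<dots> = \<Xi> (ad_star G x \<phi>) \<psi> y + \<Xi> \<phi> (ad_star G x \<psi>) y + \<Xi> \<phi> \<psi> (lb x y)"
    unfolding \<Xi>3[of "ad_star G x \<phi>" \<psi> y] \<Xi>3[of \<phi> "ad_star G x \<psi>" y] \<Xi>3[of \<phi> \<psi> "lb x y"]
    by (simp add: sum.distrib algebra_simps)
  finally have dT: "lf x T \<one> = \<Xi> (ad_star G x \<phi>) \<psi> y + \<Xi> \<phi> (ad_star G x \<psi>) y + \<Xi> \<phi> \<psi> (lb x y)" .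
  have e: "(\<lambda>g. bicov_defect g \<phi> \<psi> y) = const (\<Xi> \<phi> \<psi> y) + ((\<lambda>g. - 1 * T g) + ltensor \<phi> (co_ad \<psi> y))"
  proof
    fix g
    show "bicov_defect g \<phi> \<psi> y = (const (\<Xi> \<phi> \<psi> y) + ((\<lambda>g. - 1 * T g) + ltensor \<phi> (co_ad \<psi> y))) g"
      unfolding bicov_defect_def T_def \<Xi>3[of "Ad_star G g \<phi>" "Ad_star G g \<psi>" "Ad G g y"]
      by (simp add: const_def)
  qed
  have C: "(\<lambda>g. - 1 * T g) + ltensor \<phi> (co_ad \<psi> y) \<in> Cinf G"
    by (intro Cinf_add Cinf_scale T ltensor_Cinf)
  show "(\<lambda>g. bicov_defect g \<phi> \<psi> y) \<in> Cinf G" unfolding e by (intro Cinf_add Cinf_const C)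
  have "lf x (\<lambda>g. bicov_defect g \<phi> \<psi> y) \<one> = - 1 * lf x T \<one> + lf x (ltensor \<phi> (co_ad \<psi> y)) \<one>"
    unfolding e vfield_algebra(1)[OF lf_vfield Cinf_const C]
      vfield_algebra(1)[OF lf_vfield Cinf_scale[OF T] ltensor_Cinf] vfield_scale[OF lf_vfield T]
    by (simp add: vfield_const[OF lf_vfield])
  then show "lf x (\<lambda>g. bicov_defect g \<phi> \<psi> y) \<one> = infinitesimal_defect x \<phi> \<psi> y"
    by (simp add: dT infinitesimal_defect_def cobracket_eq)
qed

text \<open>By the cocycle identity the right-invariant derivatives of the defect at \<open>g\<close> are its
  derivatives at the identity, up to the action of \<open>g\<close> on the arguments.\<close>

lemma bicov_defect_zero:
  assumes conn: "connected (UNIV :: 'g set)" and inf: "\<And>x \<phi> \<psi> y. infinitesimal_defect x \<phi> \<psi> y = 0"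
  shows "bicov_defect g \<phi> \<psi> y = 0"
proof -
  let ?f = "\<lambda>g. bicov_defect g \<phi> \<psi> y"
  note f = bicov_defect_derivative(1)[of \<phi> \<psi> y]
  have "lf x ?f g = 0" for x g
  proof -
    let ?h = "\<lambda>h. bicov_defect h (Ad_star G g \<phi>) (Ad_star G g \<psi>) (Ad G g y)"
    have "lf x ?f g = lf (Ad G g x) (\<lambda>h. ?f (h \<otimes> g)) \<one>"
      using Ad_inv_apply[OF f, of "Ad G g x" g \<one>] by (simp add: Ad_inv_Ad)
    also have "(\<lambda>h. ?f (h \<otimes> g)) = const (?f g) + ?h"
      by (rule ext) (simp add: bicov_defect_cocycle const_def)
    also have "lf (Ad G g x) (const (?f g) + ?h) \<one> = lf (Ad G g x) ?h \<one>"
      unfolding vfield_algebra(1)[OF lf_vfield Cinf_const bicov_defect_derivative(1)]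
      by (simp add: vfield_const[OF lf_vfield])
    also have "\<dots> = 0" by (simp add: bicov_defect_derivative(2) inf)
    finally show ?thesis .
  qed
  from constant_if_lf_zero[OF conn f this] show ?thesis using bicov_defect_one by metis
qed

section \<open>The almost crossed module condition\<close>

lemma ad_star_action: "left_lie_action (lie_bracket G) (ad_star G)"
proof -
  have "linear (\<lambda>x. ad_star G x \<phi>)" for \<phi>
    by (rule linearI; rule blinfun_eqI)
      (simp_all add: ad_star_apply linear_add[OF lie_bracket_linear_left] linear_scale[OF lie_bracket_linear_left]
        blinfun.add_right blinfun.scaleR_right blinfun.add_left blinfun.scaleR_left)
  moreover have "linear (ad_star G x)" for x
    by (rule linearI; rule blinfun_eqI) (simp_all add: ad_star_apply blinfun.add_left blinfun.scaleR_left)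
  moreover have "ad_star G (lb x y) v = ad_star G x (ad_star G y v) - ad_star G y (ad_star G x v)" for x y v
    by (rule blinfun_eqI)
      (simp add: ad_star_apply lie_bracket_jacobi blinfun.diff_left blinfun.diff_right)
  ultimately show ?thesis by (simp add: left_lie_action_def bilinear_def)
qed

text \<open>Evaluated at \<open>y\<close>, the Sweedler sums collapse: contracting the cobracket of
  \<phi> with \<open>x\<close> gives \<open>ad_star G x \<phi>\<close>, and contracting the
  cobracket of \<open>x\<close> gives its value on \<phi> and \<open>co_ad v y\<close>.\<close>

lemma almost_crossed_iff:
  "left_almost_crossed_module G (ad_star G) (\<lambda>\<phi> \<psi>. - \<Xi> \<phi> \<psi>) \<longleftrightarrow>
    (\<forall>x \<phi> \<psi> y. infinitesimal_defect x \<phi> \<psi> y = 0)"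
proof -
  let ?A = "\<lambda>x \<phi> v. \<Sum>i<dm. \<Sum>j<dm. (dual_cobracket G \<phi> (eb i) (eb j) * fb j x) *\<^sub>R - \<Xi> (fb i) v"
  let ?B = "\<lambda>x \<phi> v. \<Sum>i<dm. \<Sum>j<dm. (cobracket G x (fb i) (fb j) * blinfun_apply \<phi> (eb j)) *\<^sub>R ad_star G (eb i) v"
  have A: "?A x \<phi> v y = - \<Xi> (ad_star G x \<phi>) v y" for x \<phi> v y
  proof -
    have "\<phi> (lb (eb i) x) = (\<Sum>j<dm. fb j x *\<^sub>R \<phi> (lb (eb i) (eb j)))" for i
    proof (rule linear_expansion)
      show "linear (\<lambda>x. \<phi> (lb (eb i) x))"
        using linear_compose[OF lie_bracket_linear_right linear_apply_right] by (simp add: o_def)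
    qed
    then have "?A x \<phi> v y = - (\<Sum>i<dm. \<phi> (lb (eb i) x) * \<Xi> (fb i) v y)"
      by (simp add: dual_cobracket_def blinfun.sum_left blinfun.scaleR_left blinfun.minus_left sum_distrib_right
          sum_negf mult_ac) (simp add: sum_distrib_left mult_ac)
    also have "\<dots> = - (\<Sum>i<dm. ad_star G x \<phi> (eb i) *\<^sub>R \<Xi> (fb i) v y)"
      by (simp add: ad_star_apply lie_bracket_antisym[of _ x] blinfun.minus_right)
    also have "\<dots> = - \<Xi> (ad_star G x \<phi>) v y"
      by (simp only: dual_linear_expansion[OF \<Xi>_value_linear_left, symmetric])
    finally show ?thesis .
  qed
  have B: "?B x \<phi> v y = cobracket G x \<phi> (co_ad v y)" for x \<phi> v y
  proof -
    \<comment> \<open>The module condition pairs \<phi> with the second leg of the cobracket, the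
      defect pairs it with the first. Exchanging the legs absorbs the sign in
      \<open>ad_star\<close>.\<close>
    have "cobracket G x \<phi> (co_ad v y) = - cobracket G x (co_ad v y) \<phi>" by (rule cobracket_antisym)
    also have "\<dots> = - (\<Sum>k<dm. \<Sum>l<dm. v (lb (eb k) y) * \<phi> (eb l) * cobracket G x (fb k) (fb l))"
      by (subst cobracket_expansion) (simp add: co_ad_apply)
    finally show ?thesis
      by (simp add: blinfun.sum_left blinfun.scaleR_left ad_star_apply sum_negf[symmetric] mult_ac)
  qed
  have "?A x \<phi> v + ?B x \<phi> v = ad_star G x (- \<Xi> \<phi> v) - - \<Xi> \<phi> (ad_star G x v) \<longleftrightarrow>
      (\<forall>y. infinitesimal_defect x \<phi> v y = 0)" for x \<phi> v
  proof -
    have "?A x \<phi> v + ?B x \<phi> v = ad_star G x (- \<Xi> \<phi> v) - - \<Xi> \<phi> (ad_star G x v) \<longleftrightarrow>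
        (\<forall>y. (?A x \<phi> v + ?B x \<phi> v) y = (ad_star G x (- \<Xi> \<phi> v) - - \<Xi> \<phi> (ad_star G x v)) y)"
      by (rule blinfun_eq_iff_apply)
    also have "\<dots> \<longleftrightarrow> (\<forall>y. infinitesimal_defect x \<phi> v y = 0)"
      unfolding blinfun.add_left A B blinfun.diff_left blinfun.minus_left ad_star_apply[of x "- \<Xi> \<phi> v"]
        infinitesimal_defect_def
      by (intro iff_allI iffI; linarith)
    finally show ?thesis .
  qed
  then show ?thesis
    unfolding left_almost_crossed_module_def using ad_star_action bilinear_neg(1) by simp
qed

lemma infinitesimal_of_bicovariant:
  assumes "bicovariant G \<gamma>"
  shows "infinitesimal_defect x \<phi> \<psi> y = 0"
proof -
  have "(\<lambda>g. bicov_defect g \<phi> \<psi> y) = const 0" using assms by (auto simp: bicovariant_iff const_def)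
  then show ?thesis
    using bicov_defect_derivative(2)[of x \<phi> \<psi> y] vfield_const[OF lf_vfield[of x], of 0] by simp
qed

end

theorem theorem4p1:
  fixes G :: "('g::{t2_space, second_countable_topology}, 'a::{real_inner, heine_borel},
               'v::real_normed_vector) poisson_lie_group"
    and \<gamma> :: "('g \<Rightarrow> real) \<Rightarrow> 'g form \<Rightarrow> 'g form"
    and \<Xi> :: "('v \<Rightarrow>\<^sub>L real) \<Rightarrow> ('v \<Rightarrow>\<^sub>L real) \<Rightarrow> ('v \<Rightarrow>\<^sub>L real)"
  assumes "poisson_lie_group G"
    and "preconnection G \<gamma>"
    and "poisson_compatible G \<gamma>"
    and "left_covariant_via G \<Xi> \<gamma>"
  shows "(flat G \<gamma> \<longleftrightarrow> right_lie_action (dual_bracket G) (\<lambda>\<zeta> \<phi>. - \<Xi> \<phi> \<zeta>)) \<and>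
    (right_lie_action (dual_bracket G) (\<lambda>\<zeta> \<phi>. - \<Xi> \<phi> \<zeta>) \<longleftrightarrow>
      left_lie_action (\<lambda>\<phi> \<psi>. - dual_bracket G \<phi> \<psi>) (\<lambda>\<phi> \<zeta>. - \<Xi> \<phi> \<zeta>)) \<and>
    (right_lie_action (dual_bracket G) (\<lambda>\<zeta> \<phi>. - \<Xi> \<phi> \<zeta>) \<longleftrightarrow>
      (\<forall>\<phi> \<psi> \<zeta>. \<Xi> (dual_bracket G \<phi> \<psi>) \<zeta> = \<Xi> \<phi> (\<Xi> \<psi> \<zeta>) - \<Xi> \<psi> (\<Xi> \<phi> \<zeta>))) \<and>
    (bicovariant G \<gamma> \<longrightarrow>
      left_almost_crossed_module G (ad_star G) (\<lambda>\<phi> \<psi>. - \<Xi> \<phi> \<psi>)) \<and>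
    (flat G \<gamma> \<and> connected (UNIV :: 'g set) \<and> simply_connected (UNIV :: 'g set) \<longrightarrow>
      (bicovariant G \<gamma> \<longleftrightarrow>
       left_crossed_module G (ad_star G) (\<lambda>\<phi> \<psi>. - \<Xi> \<phi> \<psi>)))"
proof -
  interpret left_covariant_preconnection G \<gamma> \<Xi>
    using assms by (simp add: left_covariant_preconnection_def left_covariant_preconnection_axioms_def)
  have almost: "left_almost_crossed_module G (ad_star G) (\<lambda>\<phi> \<psi>. - \<Xi> \<phi> \<psi>)" if "bicovariant G \<gamma>"
    using infinitesimal_of_bicovariant[OF that] by (simp add: almost_crossed_iff)
  moreover have "bicovariant G \<gamma>"
    if "connected (UNIV :: 'g set)" "left_almost_crossed_module G (ad_star G) (\<lambda>\<phi> \<psi>. - \<Xi> \<phi> \<psi>)"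
    using that bicov_defect_zero by (simp add: almost_crossed_iff bicovariant_iff)
  \<comment> \<open>Flatness already supplies the action half of a crossed module, so in the last
    clause only the almost crossed condition has to be compared with bicovariance.\<close>
  ultimately show ?thesis
    unfolding left_crossed_module_def right_action_iff left_action_iff flat_iff by blast
qed

end
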